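(* Let $K\subset\mathbb{R}^{2n}$ be a convex body and let $\gamma\in\mathrm{Sys}(K)$ be an action-minimizing closed characteristic. Then for almost every $t\in S^1$, at least one of the following holds: $-J\dot\gamma(t)$ lies on an extreme ray of the normal cone $N_K(\gamma(t))$; or $\gamma$ moves along a coisotropic face of $\partial K$ at time $t$; or $\gamma$ exhibits isotropic gliding at time $t$ (i.e. $t$ belongs to an isotropic gliding set of $\gamma$).
   Context: Conventions. $\mathbb{R}^{2n}$ has coordinates $(q,p)$, the Euclidean inner product $\langle\cdot,\cdot\rangle$, the symplectic form $\omega=\sum_i dp_i\wedge dq_i$, and $J(q,p)=(p,-q)$, so that $\omega(u,v)=\langle Ju,v\rangle$. A convex body is a compact convex set with nonempty interior; no smoothness is assumed. $h_K(v)=\sup_{x\in K}\langle x,v\rangle$; for $x\in\partial K$, $N_K(x)=\{v:\langle v,x-y\rangle\ge 0\ \forall y\in K\}$. A closed characteristic on $\partial K$ is a closed curve $\gamma\in W^{1,2}([0,T],\partial K)$, $\gamma(0)=\gamma(T)$ (with $\dot\gamma\neq0$ a.e.), such that $-J\dot\gamma(t)\in N_K(\gamma(t))$ for a.e. $t$. Its action is $\mathcal{A}(\gamma)=\frac12\int\langle -J\dot\gamma,\gamma\rangle\,dt$, and $c_{\rm EHZ}(K)$ is the minimal action of a closed characteristic on $\partial K$. Standing normalization: $K$ is translated and rescaled so that $0\in\mathrm{int}(K)$ and $c_{\rm EHZ}(K)=1$; $\mathrm{Sys}(K)$ is the set of closed characteristics $\gamma:S^1=\mathbb{R}/\mathbb{Z}\to\partial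 K$ of minimal action with $h_K(-J\dot\gamma(t))=2$ for a.e. $t$. Extreme ray: for a linear subspace $\widetilde E$, the set $E=\widetilde E\cap N_K(x)$ is an extreme face of $N_K(x)$ if no $u\in E$ can be written as $u=av_1+(1-a)v_2$ with $v_1,v_2\in N_K(x)\setminus E$, $a\in(0,1)$; it is an extreme ray if $\dim\widetilde E=1$. Coisotropic face: an extreme convex subset $E$ of $\partial K$ (a face of $K$) such that $TE:=\mathrm{span}(E-E)$ is a coisotropic subspace. Put $N_K(E)=\bigcap_{x\in E}N_K(x)$. $\gamma$ moves along the coisotropic face $E$ at time $t$ if there is an open interval $(t_0,t_1)\ni t$ in $S^1$ with $\gamma(s)\in E$ and $\dot\gamma(s)\in JN_K(E)$ for a.e. $s\in(t_0,t_1)$. Isotropic gliding set: a positive measure set $A\subset S^1$ such that for every $t\in A$: (i) $\dot\gamma(t)$ lies in the relative interior of an isotropic linear section of $JN_K(\gamma(t))$ of dimension greater than one (i.e. of $L\cap JN_K(\gamma(t))$ for an isotropic linear subspace $L$, with this intersection of dimension $>1$); and (ii) $\gamma$ does not move along any coisotropic face of $\partial K$ at time $t$. *)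

theory Defs
  imports "HOL-Analysis.Analysis"
begin

type_synonym 'n phase = "(real ^ 'n) \<times> (real ^ 'n)"

definition Jmap :: "'n::finite phase \<Rightarrow> 'n phase" where
  "Jmap x = (snd x, - fst x)"

text \<open>Points are pairs \<open>(q, p)\<close>; this is the form \<open>\<Sum>i. dp\<^sub>i \<and> dq\<^sub>i\<close>.\<close>
definition symp :: "'n::finite phase \<Rightarrow> 'n phase \<Rightarrow> real" where
  "symp u v = (\<Sum>i\<in>UNIV. snd u $ i * fst v $ i - fst u $ i * snd v $ i)"

lemma symp_eq_inner_Jmap: "symp u v = Jmap u \<bullet> v"
  by (simp add: symp_def Jmap_def inner_prod_def inner_vec_def sum_subtractf sum_negf)

definition symp_complement :: "'n::finite phase set \<Rightarrow> 'n phase set" where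
  "symp_complement V = {u. \<forall>v\<in>V. symp u v = 0}"

definition isotropic :: "'n::finite phase set \<Rightarrow> bool" where
  "isotropic V \<longleftrightarrow> subspace V \<and> V \<subseteq> symp_complement V"

definition coisotropic :: "'n::finite phase set \<Rightarrow> bool" where
  "coisotropic V \<longleftrightarrow> subspace V \<and> symp_complement V \<subseteq> V"

definition convex_body :: "'a::euclidean_space set \<Rightarrow> bool" where
  "convex_body K \<longleftrightarrow> compact K \<and> convex K \<and> interior K \<noteq> {}"

definition support_function :: "'a::euclidean_space set \<Rightarrow> 'a \<Rightarrow> real" where
  "support_function K v = (SUP x\<in>K. x \<bullet> v)"

definition normal_cone :: "'a::euclidean_space set \<Rightarrow> 'a \<Rightarrow> 'a set" where
  "normal_cone K x = {v. \<forall>y\<in>K. v \<bullet> (x - y) \<ge> 0}"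

text \<open>\<open>W\<^sup>1\<^sup>,\<^sup>2\<close> on the interval \<open>[a, b]\<close>, for the continuous representative: \<open>f\<close> is a primitive of
  a square-integrable function \<open>g\<close>.  By Lebesgue differentiation \<open>g\<close> agrees almost everywhere with
  the pointwise derivative, so below the velocity of such a curve is its \<open>vector_derivative\<close>;
  on the null set where the curve is not differentiable that term is unspecified.\<close>
definition W12_on :: "real \<Rightarrow> real \<Rightarrow> (real \<Rightarrow> 'a::euclidean_space) \<Rightarrow> bool" where
  "W12_on a b f \<longleftrightarrow>
    (\<exists>g. set_integrable lebesgue {a..b} g \<and>
         set_integrable lebesgue {a..b} (\<lambda>t. (norm (g t))\<^sup>2) \<and>
         (\<forall>t\<in>{a..b}. f t = f a + (LINT s:{a..t}|lebesgue. g s)))"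

definition velocity :: "(real \<Rightarrow> 'a::euclidean_space) \<Rightarrow> real \<Rightarrow> 'a" where
  "velocity \<gamma> t = vector_derivative \<gamma> (at t)"

definition closed_characteristic :: "'n::finite phase set \<Rightarrow> real \<Rightarrow> (real \<Rightarrow> 'n phase) \<Rightarrow> bool" where
  "closed_characteristic K T \<gamma> \<longleftrightarrow>
     0 < T \<and> W12_on 0 T \<gamma> \<and> \<gamma> 0 = \<gamma> T \<and> \<gamma> ` {0..T} \<subseteq> frontier K \<and>
     (AE t\<in>{0..T} in lebesgue. velocity \<gamma> t \<noteq> 0) \<and>
     (AE t\<in>{0..T} in lebesgue. - Jmap (velocity \<gamma> t) \<in> normal_cone K (\<gamma> t))"

definition action :: "real \<Rightarrow> (real \<Rightarrow> 'n::finite phase) \<Rightarrow> real" where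
  "action T \<gamma> = 1/2 * (LINT t:{0..T}|lebesgue. (- Jmap (velocity \<gamma> t)) \<bullet> \<gamma> t)"

definition c_EHZ :: "'n::finite phase set \<Rightarrow> real" where
  "c_EHZ K = Inf {action T \<gamma> | T \<gamma>. closed_characteristic K T \<gamma>}"

text \<open>Curves on the circle \<open>\<real>/\<int>\<close> are 1-periodic functions on the real line.\<close>
definition Sys :: "'n::finite phase set \<Rightarrow> (real \<Rightarrow> 'n phase) set" where
  "Sys K = {\<gamma>. (\<forall>t. \<gamma> (t + 1) = \<gamma> t) \<and> closed_characteristic K 1 \<gamma> \<and> action 1 \<gamma> = c_EHZ K \<and>
               (AE t\<in>{0..1} in lebesgue. support_function K (- Jmap (velocity \<gamma> t)) = 2)}"

definition extreme_section :: "'a::euclidean_space set \<Rightarrow> 'a set \<Rightarrow> bool" where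
  "extreme_section N L \<longleftrightarrow> subspace L \<and>
     \<not> (\<exists>u \<in> L \<inter> N. \<exists>v1 \<in> N - (L \<inter> N). \<exists>v2 \<in> N - (L \<inter> N). \<exists>a::real.
          0 < a \<and> a < 1 \<and> u = a *\<^sub>R v1 + (1 - a) *\<^sub>R v2)"

definition extreme_ray :: "'a::euclidean_space set \<Rightarrow> 'a set \<Rightarrow> bool" where
  "extreme_ray N E \<longleftrightarrow> (\<exists>L. extreme_section N L \<and> dim L = 1 \<and> E = L \<inter> N)"

definition tangent_space :: "'a::euclidean_space set \<Rightarrow> 'a set" where
  "tangent_space E = span {x - y | x y. x \<in> E \<and> y \<in> E}"

definition coisotropic_face :: "'n::finite phase set \<Rightarrow> 'n phase set \<Rightarrow> bool" where
  "coisotropic_face K E \<longleftrightarrow>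
     E \<noteq> {} \<and> E face_of K \<and> E \<subseteq> frontier K \<and> coisotropic (tangent_space E)"

definition face_normal_cone :: "'a::euclidean_space set \<Rightarrow> 'a set \<Rightarrow> 'a set" where
  "face_normal_cone K E = (\<Inter>x\<in>E. normal_cone K x)"

text \<open>An open interval of the circle is given by a lift to the real line.\<close>
definition moves_along ::
  "'n::finite phase set \<Rightarrow> (real \<Rightarrow> 'n phase) \<Rightarrow> 'n phase set \<Rightarrow> real \<Rightarrow> bool" where
  "moves_along K \<gamma> E t \<longleftrightarrow>
     (\<exists>t0 t1. t0 < t \<and> t < t1 \<and>
        (AE s\<in>{t0<..<t1} in lebesgue.
           \<gamma> s \<in> E \<and> velocity \<gamma> s \<in> Jmap ` face_normal_cone K E))"

text \<open>Subsets of the circle are represented in the fundamental domain \<open>[0, 1)\<close>.\<close>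
definition isotropic_gliding_set ::
  "'n::finite phase set \<Rightarrow> (real \<Rightarrow> 'n phase) \<Rightarrow> real set \<Rightarrow> bool" where
  "isotropic_gliding_set K \<gamma> A \<longleftrightarrow>
     A \<subseteq> {0..<1} \<and> A \<in> sets lebesgue \<and> 0 < emeasure lebesgue A \<and>
     (\<forall>t\<in>A. \<gamma> differentiable (at t) \<and>
        (\<exists>L. isotropic L \<and>
             1 < aff_dim (L \<inter> Jmap ` normal_cone K (\<gamma> t)) \<and>
             velocity \<gamma> t \<in> rel_interior (L \<inter> Jmap ` normal_cone K (\<gamma> t))) \<and>
        \<not> (\<exists>E. coisotropic_face K E \<and> moves_along K \<gamma> E t))"

end

theory Submission
  imports Defs "HOL-Complex_Analysis.Great_Picard"
begin

text \<open>Write \<open>w = - Jmap \<gamma>'\<close> for a minimizer \<open>\<gamma>\<close>. The statement is about the minimal face of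
\<open>normal_cone K (\<gamma> t)\<close> that contains \<open>w t\<close>. If this face is a ray for a given \<open>t\<close>, the first
alternative holds. So the point is to show that for almost every \<open>t\<close> the span of the face is
isotropic; then every other time at which \<open>\<gamma>\<close> does not move along a coisotropic face satisfies
the pointwise conditions of isotropic gliding, and it remains to see that the set of these times
is measurable (\<open>open_moves_along\<close>, \<open>nearest_swing_measurable\<close>).

Isotropy has two sources. The first is elementary: an element \<open>v\<close> of \<open>normal_cone K (\<gamma> t)\<close> has
its maximum over \<open>K\<close> at \<open>\<gamma> t\<close>, hence it is orthogonal to the velocity wherever the latter exists
(\<open>normal_cone_orthogonal_derivative\<close>), and so \<open>w t\<close> is symplectically orthogonal to its whole
face. The second is a second variation. Let \<open>a\<close> and \<open>b\<close> be directions in which \<open>w t\<close> can be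
moved both ways inside the face with \<open>a \<bullet> \<gamma> t = b \<bullet> \<gamma> t = 0\<close>. If their symplectic product were
nonzero on a set \<open>P\<close> of positive measure, one could add to \<open>w\<close> on \<open>P\<close> a perturbation \<open>\<phi>\<close> that
runs through \<open>a, b, - a, - b\<close> in succession. Such a \<open>\<phi>\<close> leaves \<open>support_function K (w t)\<close> equal
to 2 and has no first-order effect on the action, while its own action is the positive area of a
parallelogram. The area depends only on the order in which the pieces of \<open>P\<close> are visited, not on
how \<open>P\<close> sits in the circle (\<open>area_step_function\<close>). Because \<open>a\<close> and \<open>b\<close> vary slightly with \<open>t\<close>,
one parallelogram does not quite close up, but among more parallelograms than the dimension some
linear combination does, and it still has positive action (\<open>exists_positive_variation\<close>).

This contradicts the minimality of \<open>\<gamma>\<close> through Clarke's dual principle (\<open>Clarke_inequality\<close>):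
among loops \<open>z\<close> with \<open>support_function K (- Jmap z') \<le> 2\<close> the action is at most 1 if \<open>c_EHZ K =
1\<close>. Its proof is the direct method. A maximizer of the action exists by compactness of the set
of Lipschitz loops (\<open>area_maximizer_exists\<close>); a Lagrange multiplier for the closing condition
(\<open>area_max_multiplier\<close>) and conservation of energy (\<open>support_function_constant_along\<close>) show
that, translated and rescaled, it is a closed characteristic whose action is the inverse of the
maximum. Throughout, curves are represented by their velocities, which are bounded measurable
functions, and the passage between curve and velocity rests on Lebesgue differentiation
(\<open>AE_indefinite_integral_derivative\<close>) and on the representation of Lipschitz curves as
primitives (\<open>Lipschitz_is_prim\<close>).\<close>

section \<open>Lebesgue differentiation of indefinite integrals\<close>

text \<open>By Vitali's theorem a disjoint family of the short intervals with positive integral covers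
almost all of \<open>E\<close>, inside an open neighbourhood \<open>U\<close> of \<open>G = {x. f x \<le> - k}\<close> of nearly the same
measure. Over their union the negative contribution of \<open>G\<close> is outweighed by the integral over \<open>U
- G\<close>, which is small; hence \<open>E\<close> has small measure.\<close>
lemma negligible_vitali_sign:
  fixes f :: "real \<Rightarrow> real"
  assumes f: "integrable lebesgue f" and f2: "integrable lebesgue (\<lambda>x. (f x)\<^sup>2)"
    and k: "0 < k"
    and E: "\<And>x. x \<in> E \<Longrightarrow> f x \<le> - k"
    and V: "\<And>x d. x \<in> E \<Longrightarrow> 0 < d \<Longrightarrow>
      \<exists>c r. 0 < r \<and> r < d \<and> x \<in> cball c r \<and> 0 < (LINT y:cball c r|lebesgue. f y)"
  shows "negligible E"
  unfolding negligible_outer_le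
proof (intro allI impI)
  fix e :: real assume e: "0 < e"
  note emeasure_completion[simp del]
  define G where "G = {x. f x \<le> - k}"
  have fm[measurable]: "f \<in> borel_measurable lebesgue" using f by simp
  have Gm[measurable]: "G \<in> sets lebesgue"
  proof -
    have "f -` {..- k} \<inter> space lebesgue \<in> sets lebesgue" using fm by (rule measurable_sets) simp
    also have "f -` {..- k} \<inter> space lebesgue = G" unfolding G_def by auto
    finally show ?thesis .
  qed
  \<comment> \<open>Square integrability turns small measure into small integral:
     \<open>\<bar>f\<bar> \<le> N + f\<^sup>2 / N\<close> pointwise.\<close>
  define Q where "Q = (LINT x|lebesgue. (f x)\<^sup>2)"
  have Q0: "0 \<le> Q" unfolding Q_def by simp
  \<comment> \<open>With this choice \<open>Q / N\<close> takes at most half of the admissible error \<open>e * k\<close>.\<close>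
  define N where "N = 2 * (Q + 1) / (e * k)"
  have N0: "0 < N" unfolding N_def using e k Q0 by simp
  obtain U where U: "open U" "G \<subseteq> U" "U - G \<in> lmeasurable"
      "emeasure lebesgue (U - G) < ennreal (e * k / (2 * N))"
    using sets_lebesgue_outer_open[OF Gm, of "e * k / (2 * N)"] e k N0 by auto
  have Um[measurable]: "U \<in> sets lebesgue" using U(1) by auto
  have fabs: "\<bar>f x\<bar> \<le> N + (f x)\<^sup>2 / N" for x
  proof -
    have "2 * \<bar>f x\<bar> * N \<le> \<bar>f x\<bar>\<^sup>2 + N\<^sup>2" by (rule sum_squares_bound)
    moreover have "0 \<le> \<bar>f x\<bar> * N" using N0 by simp
    ultimately have "\<bar>f x\<bar> * N \<le> N * N + (f x)\<^sup>2" by (simp add: power2_eq_square)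
    then show ?thesis using N0 by (simp add: field_simps power2_eq_square)
  qed
  have fin_f2: "set_integrable lebesgue (U - G) (\<lambda>x. (f x)\<^sup>2 / N)"
    using integrable_mult_indicator[of "U - G" lebesgue, OF _ integrable_divide[OF f2, of N]]
    by (simp add: set_integrable_def)
  have fin_N: "set_integrable lebesgue (U - G) (\<lambda>x. N)"
    using U(3) by (simp add: set_integrable_def fmeasurable_def)
  have small: "(LINT x:(U - G)|lebesgue. \<bar>f x\<bar>) \<le> e * k"
  proof -
    have mUG: "measure lebesgue (U - G) \<le> e * k / (2 * N)"
      using U(3,4) e k N0 by (simp add: emeasure_eq_measure2 ennreal_less_iff)
    have "(LINT x:(U - G)|lebesgue. \<bar>f x\<bar>) \<le> (LINT x:(U - G)|lebesgue. N + (f x)\<^sup>2 / N)"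
    proof (rule set_integral_mono)
      show "set_integrable lebesgue (U - G) (\<lambda>x. \<bar>f x\<bar>)"
        using f U(3) unfolding set_integrable_def by (intro integrable_mult_indicator) auto
      show "set_integrable lebesgue (U - G) (\<lambda>x. N + (f x)\<^sup>2 / N)"
        using fin_N fin_f2 by (rule set_integral_add)
      show "\<And>x. \<bar>f x\<bar> \<le> N + (f x)\<^sup>2 / N" by (rule fabs)
    qed
    also have "\<dots> = (LINT x:(U - G)|lebesgue. N) + (LINT x:(U - G)|lebesgue. (f x)\<^sup>2 / N)"
      using fin_N fin_f2 by (rule set_integral_add)
    also have "(LINT x:(U - G)|lebesgue. N) = N * measure lebesgue (U - G)"
      using U(3) by (simp add: set_lebesgue_integral_def mult.commute)
    also have "(LINT x:(U - G)|lebesgue. (f x)\<^sup>2 / N) \<le> (LINT x|lebesgue. (f x)\<^sup>2 / N)"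
      unfolding set_lebesgue_integral_def
      using f2 N0 fin_f2 by (intro integral_mono) (auto simp: set_integrable_def indicator_def)
    also have "\<dots> = Q / N" unfolding Q_def by simp
    also have "N * measure lebesgue (U - G) + Q / N \<le> N * (e * k / (2 * N)) + (e * k) / 2"
    proof (rule add_mono)
      show "N * measure lebesgue (U - G) \<le> N * (e * k / (2 * N))"
        using mUG N0 by (intro mult_left_mono) auto
      have "Q * 2 \<le> e * k * N" unfolding N_def using e k by simp
      then show "Q / N \<le> e * k / 2" using N0 by (simp add: field_simps)
    qed
    also have "\<dots> = e * k" using N0 by (simp add: field_simps)
    finally show ?thesis by simp
  qed
  define I where "I = {(c, r). 0 < r \<and> cball c r \<subseteq> U \<and> 0 < (LINT y:cball c r|lebesgue. f y)}"
  obtain C where C: "countable C" "C \<subseteq> I"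
     "pairwise (\<lambda>i j. disjnt (cball (fst i) (snd i)) (cball (fst j) (snd j))) C"
     "negligible (E - (\<Union>i\<in>C. cball (fst i) (snd i)))"
  proof (rule Vitali_covering_theorem_cballs[of I snd E fst])
    show "\<And>i. i \<in> I \<Longrightarrow> 0 < snd i" unfolding I_def by auto
    fix x d :: real assume x: "x \<in> E" and d: "0 < d"
    have "x \<in> U" using x E U(2) unfolding G_def by auto
    then obtain s where s: "0 < s" "ball x s \<subseteq> U" using U(1) openE by blast
    obtain c r where cr: "0 < r" "r < min d (s/2)" "x \<in> cball c r" "0 < (LINT y:cball c r|lebesgue. f y)"
      using V[OF x, of "min d (s/2)"] d s by auto
    have "cball c r \<subseteq> ball x s" using cr by (auto simp: dist_real_def)
    then have "(c, r) \<in> I" unfolding I_def using cr s by auto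
    then show "\<exists>i. i \<in> I \<and> x \<in> cball (fst i) (snd i) \<and> snd i < d"
      using cr by (intro exI[of _ "(c, r)"]) auto
  qed
  define b where "b i = cball (fst i) (snd i)" for i :: "real \<times> real"
  have bm[measurable]: "b i \<in> sets lebesgue" for i unfolding b_def by simp
  define W where "W = (\<Union>i\<in>C. b i)"
  have Wm[measurable]: "W \<in> sets lebesgue" unfolding W_def using C(1) by auto
  have WU: "W \<subseteq> U" unfolding W_def b_def using C(2) I_def by fastforce
  have disj: "disjoint_family_on b C"
    using C(3) unfolding disjoint_family_on_def pairwise_def disjnt_def b_def by blast
  define \<nu> where "\<nu> = density lebesgue (\<lambda>x. ennreal \<bar>f x\<bar>)"
  have [measurable_cong]: "sets \<nu> = sets lebesgue" unfolding \<nu>_def by simp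
  have \<nu>eq: "emeasure \<nu> S = ennreal (LINT x:S|lebesgue. \<bar>f x\<bar>)" if [measurable]: "S \<in> sets lebesgue" for S
  proof -
    have "emeasure \<nu> S = (\<integral>\<^sup>+x. ennreal \<bar>f x\<bar> * indicator S x \<partial>lebesgue)"
      unfolding \<nu>_def by (intro emeasure_density) auto
    also have "\<dots> = (\<integral>\<^sup>+x. ennreal (indicat_real S x *\<^sub>R \<bar>f x\<bar>) \<partial>lebesgue)"
      by (intro nn_integral_cong) (auto simp: indicator_def)
    also have "\<dots> = ennreal (LINT x:S|lebesgue. \<bar>f x\<bar>)"
      unfolding set_lebesgue_integral_def
      using integrable_mult_indicator[OF that integrable_abs[OF f]]
      by (intro nn_integral_eq_integral) auto
    finally show ?thesis .
  qed
  have one: "ennreal k * emeasure lebesgue (b i \<inter> G) \<le> emeasure \<nu> (b i - G)" if i: "i \<in> C" for i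
  proof -
    have pos: "0 < (LINT y:b i|lebesgue. f y)" using i C(2) unfolding I_def b_def by auto
    have int: "set_integrable lebesgue S f" if "S \<in> sets lebesgue" for S
      using f that unfolding set_integrable_def by (intro integrable_mult_indicator) auto
    have fin: "b i \<inter> G \<in> lmeasurable"
      unfolding b_def by (intro bounded_set_imp_lmeasurable bounded_Int) auto
    have "(LINT y:b i|lebesgue. f y) = (LINT y:(b i \<inter> G) \<union> (b i - G)|lebesgue. f y)"
      by (rule arg_cong[where f="\<lambda>S. LINT y:S|lebesgue. f y"]) auto
    also have "\<dots> = (LINT y:(b i \<inter> G)|lebesgue. f y) + (LINT y:(b i - G)|lebesgue. f y)"
      by (intro set_integral_Un int) auto
    also have "(LINT y:(b i \<inter> G)|lebesgue. f y) \<le> (LINT y:(b i \<inter> G)|lebesgue. - k)"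
      using fin by (intro set_integral_mono_AE int)
         (auto simp: G_def set_integrable_def fmeasurable_def)
    also have "\<dots> = - k * measure lebesgue (b i \<inter> G)"
      using fin by (simp add: set_lebesgue_integral_def mult.commute)
    also have "(LINT y:(b i - G)|lebesgue. f y) \<le> (LINT y:(b i - G)|lebesgue. \<bar>f y\<bar>)"
      by (intro set_integral_mono int) (auto intro!: set_integrable_abs int)
    finally have "k * measure lebesgue (b i \<inter> G) \<le> (LINT y:(b i - G)|lebesgue. \<bar>f y\<bar>)"
      using pos by simp
    then have "ennreal (k * measure lebesgue (b i \<inter> G)) \<le> emeasure \<nu> (b i - G)"
      by (simp add: \<nu>eq ennreal_leI)
    then show ?thesis using k fin by (simp add: ennreal_mult emeasure_eq_measure2)
  qed
  have "ennreal k * emeasure lebesgue (W \<inter> G) = ennreal k * (\<integral>\<^sup>+i. emeasure lebesgue (b i \<inter> G) \<partial>count_space C)"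
  proof -
    have "W \<inter> G = (\<Union>i\<in>C. b i \<inter> G)" unfolding W_def by auto
    then show ?thesis
      using C(1) disj by (subst emeasure_UN_countable[symmetric]) (fastforce simp: disjoint_family_on_def)+
  qed
  also have "\<dots> = (\<integral>\<^sup>+i. ennreal k * emeasure lebesgue (b i \<inter> G) \<partial>count_space C)"
    by (simp add: nn_integral_cmult)
  also have "\<dots> \<le> (\<integral>\<^sup>+i. emeasure \<nu> (b i - G) \<partial>count_space C)"
    by (intro nn_integral_mono) (auto intro: one)
  also have "\<dots> = emeasure \<nu> (W - G)"
  proof -
    have "W - G = (\<Union>i\<in>C. b i - G)" unfolding W_def by auto
    then show ?thesis
      using C(1) disj by (subst emeasure_UN_countable[symmetric]) (fastforce simp: disjoint_family_on_def)+
  qed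
  also have "\<dots> \<le> emeasure \<nu> (U - G)" using WU by (intro emeasure_mono) auto
  also have "\<dots> \<le> ennreal (e * k)" using small by (simp add: \<nu>eq ennreal_leI)
  finally have fin: "ennreal k * emeasure lebesgue (W \<inter> G) \<le> ennreal k * ennreal e"
    using k e by (simp add: ennreal_mult mult.commute)
  have le: "emeasure lebesgue (W \<inter> G) \<le> ennreal e"
  proof -
    have "emeasure lebesgue (W \<inter> G) \<noteq> top"
    proof
      assume "emeasure lebesgue (W \<inter> G) = top"
      then have "top \<le> ennreal (k * e)" using fin k by (simp add: ennreal_mult_top ennreal_mult')
      then show False by (simp add: top_unique)
    qed
    then obtain m where m: "emeasure lebesgue (W \<inter> G) = ennreal m" "0 \<le> m"
      by (cases "emeasure lebesgue (W \<inter> G)") auto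
    show ?thesis using fin m k e by (simp add: ennreal_mult[symmetric] ennreal_le_iff)
  qed
  then have lm: "W \<inter> G \<in> lmeasurable"
    by (intro fmeasurableI) (auto intro: le_less_trans[OF _ ennreal_less_top])
  define Z where "Z = E - W"
  have Z: "negligible Z" using C(4) unfolding Z_def W_def b_def .
  have "E \<subseteq> (W \<inter> G) \<union> Z" using E unfolding Z_def G_def by auto
  moreover have "(W \<inter> G) \<union> Z \<in> lmeasurable"
    using lm Z by (intro fmeasurable.Un) (auto simp: negligible_imp_measurable)
  moreover have "measure lebesgue ((W \<inter> G) \<union> Z) \<le> e"
  proof -
    have "measure lebesgue ((W \<inter> G) \<union> Z) \<le> measure lebesgue (W \<inter> G) + measure lebesgue Z"
      using lm Z by (intro measure_Un_le) (auto simp: negligible_imp_measurable fmeasurableD)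
    also have "measure lebesgue Z = 0" using Z by (simp add: negligible_imp_measure0)
    also have "measure lebesgue (W \<inter> G) \<le> e"
      using le lm e by (simp add: emeasure_eq_measure2)
    finally show ?thesis by simp
  qed
  ultimately show "\<exists>T. E \<subseteq> T \<and> T \<in> lmeasurable \<and> measure lebesgue T \<le> e" by blast
qed

text \<open>The exceptional points are sorted by a rational number \<open>q\<close> that separates \<open>g x\<close> from the upper
derivate, and by the size of the gap \<open>q - g x\<close>; each class is negligible by the covering
argument applied to \<open>g - q\<close>.\<close>
lemma AE_upper_derivate_le:
  fixes g :: "real \<Rightarrow> real"
  assumes g: "set_integrable lebesgue {a..b} g" and g2: "set_integrable lebesgue {a..b} (\<lambda>x. (g x)\<^sup>2)"
  shows "AE x in lebesgue. x \<in> {a<..<b} \<longrightarrow> (\<forall>e>0. \<exists>d>0. \<forall>u v.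
      a \<le> u \<and> u \<le> x \<and> x \<le> v \<and> v \<le> b \<and> u < v \<and> v - u < d \<longrightarrow>
      integral {u..v} g \<le> (g x + e) * (v - u))"
proof -
  define R where "R x q \<longleftrightarrow> (\<exists>d>0. \<forall>u v.
      a \<le> u \<and> u \<le> x \<and> x \<le> v \<and> v \<le> b \<and> u < v \<and> v - u < d \<longrightarrow>
      integral {u..v} g \<le> q * (v - u))" for x q :: real
  define E where "E q n = {x \<in> {a<..<b}. g x \<le> q - 1 / real (Suc n) \<and> \<not> R x q}" for q :: real and n :: nat
  have negE: "negligible (E q n)" for q n
  proof (rule negligible_vitali_sign[where f = "\<lambda>x. indicat_real {a..b} x * (g x - q)" and k = "1 / real (Suc n)"])
    have q: "set_integrable lebesgue {c..d} (\<lambda>x. q)" for q c d :: real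
      using absolutely_integrable_on_const[of "cbox c d" q] by simp
    have "set_integrable lebesgue {a..b} (\<lambda>x. g x - q)"
      using g q by (rule set_integral_diff)
    then show "integrable lebesgue (\<lambda>x. indicat_real {a..b} x * (g x - q))"
      by (simp add: set_integrable_def)
    have "set_integrable lebesgue {a..b} (\<lambda>x. (g x)\<^sup>2 - 2 * q * g x + q\<^sup>2)"
      using g g2 q by (intro set_integral_add set_integral_diff) auto
    moreover have "(\<lambda>x. indicat_real {a..b} x *\<^sub>R ((g x)\<^sup>2 - 2 * q * g x + q\<^sup>2)) =
        (\<lambda>x. (indicat_real {a..b} x * (g x - q))\<^sup>2)"
      by (auto simp: fun_eq_iff indicator_def power2_eq_square algebra_simps)
    ultimately show "integrable lebesgue (\<lambda>x. (indicat_real {a..b} x * (g x - q))\<^sup>2)"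
      by (simp add: set_integrable_def)
    show "0 < 1 / real (Suc n)" by simp
    show "\<And>x. x \<in> E q n \<Longrightarrow> indicat_real {a..b} x * (g x - q) \<le> - (1 / real (Suc n))"
      unfolding E_def by auto
    fix x d :: real assume x: "x \<in> E q n" and d: "0 < d"
    then obtain u v where uv: "a \<le> u" "u \<le> x" "x \<le> v" "v \<le> b" "u < v" "v - u < d"
        "\<not> integral {u..v} g \<le> q * (v - u)"
      unfolding E_def R_def by blast
    have cb: "cball ((u + v) / 2) ((v - u) / 2) = {u..v}"
      by (simp add: cball_eq_atLeastAtMost field_simps)
    have gi: "set_integrable lebesgue {u..v} g"
      using g by (rule set_integrable_subset) (use uv in auto)
    have "(LINT y:{u..v}|lebesgue. indicat_real {a..b} y * (g y - q)) = (LINT y:{u..v}|lebesgue. g y - q)"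
      using uv by (intro set_lebesgue_integral_cong) auto
    also have "\<dots> = (LINT y:{u..v}|lebesgue. g y) - (LINT y:{u..v}|lebesgue. q)"
      by (intro set_integral_diff gi q)
    also have "(LINT y:{u..v}|lebesgue. q) = q * (v - u)"
      using uv by (simp add: set_lebesgue_integral_def)
    also have "(LINT y:{u..v}|lebesgue. g y) = integral {u..v} g"
      using gi by (rule set_lebesgue_integral_eq_integral)
    finally show "\<exists>c r. 0 < r \<and> r < d \<and> x \<in> cball c r \<and>
        0 < (LINT y:cball c r|lebesgue. indicat_real {a..b} y * (g y - q))"
      using uv cb by (intro exI[of _ "(u + v) / 2"] exI[of _ "(v - u) / 2"]) auto
  qed
  have "negligible (\<Union>(q, n) \<in> \<rat> \<times> UNIV. E q n)"
    by (intro negligible_countable_Union countable_image countable_SIGMA)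
       (simp_all add: countable_rat, use negE in force)
  then have "AE x in lebesgue. x \<notin> (\<Union>(q, n) \<in> \<rat> \<times> UNIV. E q n)"
    unfolding negligible_iff_null_sets by (rule AE_not_in)
  then show ?thesis
  proof (rule AE_mp, intro AE_I2 impI allI)
    fix x e :: real assume x: "x \<notin> (\<Union>(q, n) \<in> \<rat> \<times> UNIV. E q n)" "x \<in> {a<..<b}" and e: "0 < e"
    obtain q where q: "q \<in> \<rat>" "g x < q" "q < g x + e" using Rats_dense_in_real[of "g x" "g x + e"] e by auto
    obtain n where n: "1 / real (Suc n) < q - g x" using q(2) nat_approx_posE[of "q - g x"] by auto
    have "x \<notin> E q n" using x(1) q(1) by blast
    moreover have "g x \<le> q - 1 / real (Suc n)" using n by linarith
    ultimately have "R x q" using x(2) unfolding E_def by blast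
    then obtain d where d: "d > 0" "\<And>u v. a \<le> u \<and> u \<le> x \<and> x \<le> v \<and> v \<le> b \<and> u < v \<and> v - u < d \<longrightarrow>
      integral {u..v} g \<le> q * (v - u)" unfolding R_def by blast
    show "\<exists>d>0. \<forall>u v. a \<le> u \<and> u \<le> x \<and> x \<le> v \<and> v \<le> b \<and> u < v \<and> v - u < d \<longrightarrow>
      integral {u..v} g \<le> (g x + e) * (v - u)"
    proof (intro exI[of _ d] conjI allI impI d(1))
      fix u v assume uv: "a \<le> u \<and> u \<le> x \<and> x \<le> v \<and> v \<le> b \<and> u < v \<and> v - u < d"
      have "integral {u..v} g \<le> q * (v - u)" using d(2) uv by blast
      also have "\<dots> \<le> (g x + e) * (v - u)" using uv q(3) by (intro mult_right_mono) auto
      finally show "integral {u..v} g \<le> (g x + e) * (v - u)" .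
    qed
  qed
qed

text \<open>The upper bound for \<open>g\<close> and the one for \<open>- g\<close> enclose the difference quotients.\<close>
lemma AE_indefinite_integral_real_derivative:
  fixes g :: "real \<Rightarrow> real"
  assumes g: "set_integrable lebesgue {a..b} g" and g2: "set_integrable lebesgue {a..b} (\<lambda>x. (g x)\<^sup>2)"
  shows "AE x in lebesgue. x \<in> {a<..<b} \<longrightarrow> ((\<lambda>t. integral {a..t} g) has_real_derivative g x) (at x)"
proof -
  have g': "set_integrable lebesgue {a..b} (\<lambda>x. - g x)"
    using set_integrable_mult_right[of "-1" lebesgue "{a..b}" g, OF g] by simp
  have g2': "set_integrable lebesgue {a..b} (\<lambda>x. (- g x)\<^sup>2)" using g2 by simp
  note u1 = AE_upper_derivate_le[OF g g2] and u2 = AE_upper_derivate_le[OF g' g2']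
  have "g integrable_on {a..b}" using g by (rule set_lebesgue_integral_eq_integral)
  then have comb: "integral {a..v} g - integral {a..u} g = integral {u..v} g"
    if "a \<le> u" "u \<le> v" "v \<le> b" for u v
    using Henstock_Kurzweil_Integration.integral_combine[of a u v g] integrable_subinterval_real[of g a b a v] that by auto
  show ?thesis
    using u1 u2
  proof eventually_elim
    case (elim x)
    show ?case
    proof
      assume x: "x \<in> {a<..<b}"
      show "((\<lambda>t. integral {a..t} g) has_real_derivative g x) (at x)"
        unfolding has_field_derivative_def has_derivative_at_alt
      proof (intro conjI allI impI)
        show "bounded_linear ((*) (g x))" by (rule bounded_linear_mult_right)
        fix e :: real assume e: "0 < e"
        obtain d1 where d1: "d1 > 0" "\<And>u v. a \<le> u \<and> u \<le> x \<and> x \<le> v \<and> v \<le> b \<and> u < v \<and> v - u < d1 \<longrightarrow>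
          integral {u..v} g \<le> (g x + e) * (v - u)" using elim(1) x e by blast
        obtain d2 where d2: "d2 > 0" "\<And>u v. a \<le> u \<and> u \<le> x \<and> x \<le> v \<and> v \<le> b \<and> u < v \<and> v - u < d2 \<longrightarrow>
          integral {u..v} (\<lambda>x. - g x) \<le> (- g x + e) * (v - u)" using elim(2) x e by blast
        define d where "d = min (min d1 d2) (min (x - a) (b - x))"
        have key: "\<bar>integral {u..v} g - g x * (v - u)\<bar> \<le> e * (v - u)"
          if "a \<le> u" "u \<le> x" "x \<le> v" "v \<le> b" "u < v" "v - u < d" for u v
        proof -
          have "integral {u..v} g \<le> (g x + e) * (v - u)" using d1(2)[of u v] that by (auto simp: d_def)
          moreover have "integral {u..v} (\<lambda>x. - g x) \<le> (- g x + e) * (v - u)"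
            using d2(2)[of u v] that by (auto simp: d_def)
          ultimately show ?thesis by (auto simp: abs_le_iff algebra_simps)
        qed
        show "\<exists>d>0. \<forall>y. norm (y - x) < d \<longrightarrow>
            norm (integral {a..y} g - integral {a..x} g - g x * (y - x)) \<le> e * norm (y - x)"
        proof (intro exI[of _ d] conjI allI impI)
          show "0 < d" using d1 d2 x by (auto simp: d_def)
          fix y assume y: "norm (y - x) < d"
          then have ab: "a \<le> y" "y \<le> b" by (auto simp: d_def)
          consider "y = x" | "y < x" | "x < y" by linarith
          then show "norm (integral {a..y} g - integral {a..x} g - g x * (y - x)) \<le> e * norm (y - x)"
          proof cases
            case 2
            have "\<bar>integral {y..x} g - g x * (x - y)\<bar> \<le> e * (x - y)"
              using 2 ab x y by (intro key) auto
            moreover have "integral {a..x} g - integral {a..y} g = integral {y..x} g"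
              using 2 ab x by (intro comb) auto
            ultimately have "\<bar>integral {a..y} g - integral {a..x} g - g x * (y - x)\<bar> \<le> e * (x - y)"
              by (auto simp: abs_le_iff algebra_simps)
            then show ?thesis using 2 by (simp add: abs_if)
          next
            case 3
            have "\<bar>integral {x..y} g - g x * (y - x)\<bar> \<le> e * (y - x)"
              using 3 ab x y by (intro key) auto
            moreover have "integral {a..y} g - integral {a..x} g = integral {x..y} g"
              using 3 ab x by (intro comb) auto
            ultimately show ?thesis using 3 by (simp add: abs_if)
          qed simp
        qed
      qed
    qed
  qed
qed

lemma AE_indefinite_integral_derivative:
  fixes g :: "real \<Rightarrow> 'a::euclidean_space"
  assumes g: "set_integrable lebesgue {a..b} g" and g2: "set_integrable lebesgue {a..b} (\<lambda>x. (norm (g x))\<^sup>2)"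
  shows "AE x in lebesgue. x \<in> {a<..<b} \<longrightarrow> ((\<lambda>t. integral {a..t} g) has_vector_derivative g x) (at x)"
proof -
  have *: "AE x in lebesgue. x \<in> {a<..<b} \<longrightarrow> ((\<lambda>t. integral {a..t} (\<lambda>s. g s \<bullet> i)) has_real_derivative g x \<bullet> i) (at x)"
    if i: "i \<in> Basis" for i
  proof (rule AE_indefinite_integral_real_derivative)
    show gi: "set_integrable lebesgue {a..b} (\<lambda>x. g x \<bullet> i)"
      using g absolutely_integrable_component by blast
    show "set_integrable lebesgue {a..b} (\<lambda>x. (g x \<bullet> i)\<^sup>2)"
      unfolding set_integrable_def
    proof (rule Bochner_Integration.integrable_bound)
      show "integrable lebesgue (\<lambda>x. indicat_real {a..b} x *\<^sub>R (norm (g x))\<^sup>2)"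
        using g2 by (simp add: set_integrable_def)
      have m: "(\<lambda>x. indicat_real {a..b} x *\<^sub>R (g x \<bullet> i)) \<in> borel_measurable lebesgue"
        using gi by (simp add: set_integrable_def)
      have "(\<lambda>x. indicat_real {a..b} x *\<^sub>R (g x \<bullet> i)\<^sup>2) = (\<lambda>x. (indicat_real {a..b} x *\<^sub>R (g x \<bullet> i))\<^sup>2)"
        by (auto simp: indicator_def)
      then show "(\<lambda>x. indicat_real {a..b} x *\<^sub>R (g x \<bullet> i)\<^sup>2) \<in> borel_measurable lebesgue"
        using borel_measurable_power[OF m, of 2] by simp
      have "(g x \<bullet> i)\<^sup>2 \<le> (norm (g x))\<^sup>2" for x
        using Basis_le_norm[OF i, of "g x"] by (simp add: abs_le_square_iff[symmetric])
      then show "AE x in lebesgue. norm (indicat_real {a..b} x *\<^sub>R (g x \<bullet> i)\<^sup>2) \<le>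
          norm (indicat_real {a..b} x *\<^sub>R (norm (g x))\<^sup>2)"
        by (auto simp: indicator_def)
    qed
  qed
  have gint: "g integrable_on {a..t}" if "t \<le> b" for t
    by (rule integrable_subinterval_real[OF set_lebesgue_integral_eq_integral(1)[OF g]]) (use that in simp)
  have "AE x in lebesgue. \<forall>i\<in>Basis. x \<in> {a<..<b} \<longrightarrow>
      ((\<lambda>t. integral {a..t} (\<lambda>s. g s \<bullet> i)) has_real_derivative g x \<bullet> i) (at x)"
    by (rule AE_finite_allI[OF finite_Basis *])
  then show ?thesis
  proof (rule AE_mp, intro AE_I2 impI)
    fix x
    assume elim: "\<forall>i\<in>Basis. x \<in> {a<..<b} \<longrightarrow>
      ((\<lambda>t. integral {a..t} (\<lambda>s. g s \<bullet> i)) has_real_derivative g x \<bullet> i) (at x)"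
      and x: "x \<in> {a<..<b}"
    show "((\<lambda>t. integral {a..t} g) has_vector_derivative g x) (at x)"
    proof -
      have "((\<lambda>t. integral {a..t} g \<bullet> i) has_vector_derivative g x \<bullet> i) (at x)" if i: "i \<in> Basis" for i
      proof -
        have "((\<lambda>t. integral {a..t} (\<lambda>s. g s \<bullet> i)) has_vector_derivative g x \<bullet> i) (at x)"
          using elim[rule_format, OF i x] unfolding has_real_derivative_iff_has_vector_derivative .
        moreover have "\<And>t. t \<in> {a<..<b} \<Longrightarrow> integral {a..t} (\<lambda>s. g s \<bullet> i) = integral {a..t} g \<bullet> i"
          using integral_component_eq[OF gint] by simp
        ultimately show ?thesis
          using x by (intro has_vector_derivative_transform_within_open[of "\<lambda>t. integral {a..t} (\<lambda>s. g s \<bullet> i)" "g x \<bullet> i" x "{a<..<b}" "\<lambda>t. integral {a..t} g \<bullet> i"]) auto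
      qed
      then show "((\<lambda>t. integral {a..t} g) has_vector_derivative g x) (at x)"
        unfolding has_vector_derivative_def
        by (subst has_derivative_componentwise_within) (simp add: has_vector_derivative_def)
    qed
  qed
qed

section \<open>Lipschitz functions are primitives\<close>

text \<open>The Stieltjes measures of \<open>F\<close> and of the increasing function \<open>c * x - F x\<close> add up to \<open>c\<close> times
Lebesgue measure, since they do so on intervals.\<close>
lemma interval_measure_le_lborel:
  fixes F :: "real \<Rightarrow> real"
  assumes mono: "\<And>x y. x \<le> y \<Longrightarrow> F x \<le> F y"
    and lip: "\<And>x y. x \<le> y \<Longrightarrow> F y - F x \<le> c * (y - x)"
    and cont: "continuous_on UNIV F" and A: "A \<in> sets borel"
  shows "emeasure (interval_measure F) A \<le> ennreal c * emeasure lborel A"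
proof -
  define G where "G x = c * x - F x" for x
  have monoG: "\<And>x y. x \<le> y \<Longrightarrow> G x \<le> G y" unfolding G_def using lip by (force simp: algebra_simps)
  have contG: "continuous_on UNIV G" unfolding G_def by (intro continuous_intros cont)
  have c0: "0 \<le> c" using lip[of 0 1] mono[of 0 1] by simp
  define M where "M = measure_of UNIV (sets borel) (\<lambda>A. emeasure (interval_measure F) A + emeasure (interval_measure G) A)"
  have sM: "sets M = sets borel" unfolding M_def by (metis sets.sigma_sets_eq sets_measure_of space_borel sets.space_closed)
  have eM: "emeasure M B = emeasure (interval_measure F) B + emeasure (interval_measure G) B" if "B \<in> sets borel" for B
    unfolding M_def
  proof (rule emeasure_measure_of_sigma)
    show "sigma_algebra UNIV (sets (borel :: real measure))" using sets.sigma_algebra_axioms[of "borel :: real measure"] by simp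
    show "positive (sets borel) (\<lambda>A. emeasure (interval_measure F) A + emeasure (interval_measure G) A)"
      by (simp add: positive_def)
    show "countably_additive (sets borel) (\<lambda>A. emeasure (interval_measure F) A + emeasure (interval_measure G) A)"
      unfolding countably_additive_def
    proof (intro allI impI)
      fix S :: "nat \<Rightarrow> real set" assume "range S \<subseteq> sets borel" "disjoint_family S"
      then show "(\<Sum>i. emeasure (interval_measure F) (S i) + emeasure (interval_measure G) (S i)) =
         emeasure (interval_measure F) (\<Union> (range S)) + emeasure (interval_measure G) (\<Union> (range S))"
        by (subst suminf_add[symmetric]) (auto simp: suminf_emeasure)
    qed
  qed (rule that)
  have cr: "continuous (at_right a) F" "continuous (at_right a) G" for a
    using cont contG by (auto simp: continuous_on_eq_continuous_within intro: continuous_within_subset)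
  have Ioc: "emeasure M {a<..b} = ennreal c * emeasure lborel {a<..b}" for a b
  proof (cases "a \<le> b")
    case True
    have "emeasure M {a<..b} = ennreal (F b - F a) + ennreal (G b - G a)"
      using True by (simp add: eM emeasure_interval_measure_Ioc mono monoG cr)
    also have "\<dots> = ennreal ((F b - F a) + (G b - G a))"
      using True mono monoG by (intro ennreal_plus[symmetric]) auto
    also have "(F b - F a) + (G b - G a) = c * (b - a)" by (simp add: G_def algebra_simps)
    also have "ennreal (c * (b - a)) = ennreal c * emeasure lborel {a<..b}"
      using True c0 by (simp add: ennreal_mult)
    finally show ?thesis .
  qed (simp add: eM)
  have sb: "sets borel = sigma_sets UNIV (range (\<lambda>(a, b). {a<..b::real}))"
    by (subst borel_sigma_sets_Ioc) (simp add: sets_measure_of)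
  have "M = density lborel (\<lambda>_. ennreal c)"
  proof (rule measure_eqI_generator_eq[where E = "range (\<lambda>(a, b). {a<..b::real})" and \<Omega> = UNIV and A = "\<lambda>n. {- real n<..real n}"])
    show "Int_stable (range (\<lambda>(a, b). {a<..b::real}))"
      by (auto simp: Int_stable_def)
    show "sets M = sigma_sets UNIV (range (\<lambda>(a, b). {a<..b}))"
      using sM sb by simp
    show "sets (density lborel (\<lambda>_. ennreal c)) = sigma_sets UNIV (range (\<lambda>(a, b). {a<..b::real}))"
      using sb by simp
    show "(\<Union>i. {- real i<..real i}) = UNIV"
    proof (intro set_eqI iffI UNIV_I)
      fix x :: real
      obtain n where "\<bar>x\<bar> < real n" using reals_Archimedean2 by blast
      then show "x \<in> (\<Union>i. {- real i<..real i})" by (intro UN_I[of n]) auto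
    qed
    fix X assume "X \<in> range (\<lambda>(a, b). {a<..b::real})"
    then show "emeasure M X = emeasure (density lborel (\<lambda>_. ennreal c)) X"
      using Ioc by (auto simp: emeasure_density nn_integral_cmult_indicator)
  next
    fix i show "emeasure M {- real i<..real i} \<noteq> \<infinity>" by (simp add: Ioc ennreal_mult_eq_top_iff)
  qed auto
  then have "emeasure M A = ennreal c * emeasure lborel A"
    using A by (simp add: emeasure_density nn_integral_cmult_indicator)
  then show ?thesis using eM[OF A] by (metis add.right_neutral add_left_mono zero_le)
qed

text \<open>The Radon-Nikodym density of the Stieltjes measure is the derivative that is sought.\<close>
lemma monotone_Lipschitz_is_integral:
  fixes F :: "real \<Rightarrow> real"
  assumes mono: "\<And>x y. x \<le> y \<Longrightarrow> F x \<le> F y"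
    and lip: "\<And>x y. x \<le> y \<Longrightarrow> F y - F x \<le> c * (y - x)"
  obtains g where "g \<in> borel_measurable borel" "\<And>x. 0 \<le> g x \<and> g x \<le> c"
    "\<And>a b. a \<le> b \<Longrightarrow> F b - F a = integral {a..b} g"
proof -
  have c0: "0 \<le> c" using lip[of 0 1] mono[of 0 1] by simp
  have cont: "continuous_on UNIV F"
  proof (rule lipschitz_on_continuous_on[of c], rule lipschitz_onI[OF _ c0])
    fix x y :: real
    show "dist (F x) (F y) \<le> c * dist x y"
      using mono[of x y] mono[of y x] lip[of x y] lip[of y x] by (cases "x \<le> y") (auto simp: dist_real_def)
  qed
  define N where "N = interval_measure F"
  have le: "emeasure N A \<le> ennreal c * emeasure lborel A" if "A \<in> sets borel" for A
    unfolding N_def by (rule interval_measure_le_lborel[OF mono lip cont that])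
  have sN: "sets N = sets borel" unfolding N_def by simp
  have "absolutely_continuous lborel N"
    unfolding absolutely_continuous_def
  proof
    fix A :: "real set" assume "A \<in> null_sets lborel"
    then show "A \<in> null_sets N" using le[of A] sN by (auto simp: null_sets_def)
  qed
  then obtain h where h[measurable]: "h \<in> borel_measurable lborel" and dens: "density lborel h = N"
    using sigma_finite_measure.Radon_Nikodym[OF sigma_finite_lborel, of N] sN by auto
  \<comment> \<open>The density exceeds \<open>c\<close> only on a null set, so that truncation at \<open>c\<close> does not change it.\<close>
  define A where "A n = {x. ennreal c < h x} \<inter> {- real n..real n}" for n :: nat
  have Am[measurable]: "A n \<in> sets lborel" for n unfolding A_def by measurable
  have "AE x in lborel. x \<notin> A n" for n
  proof -
    have 1: "(\<integral>\<^sup>+x. h x * indicator (A n) x \<partial>lborel) \<le> (\<integral>\<^sup>+x. ennreal c * indicator (A n) x \<partial>lborel)"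
      using le[of "A n"] Am[of n] by (simp add: dens[symmetric] emeasure_density nn_integral_cmult_indicator)
    have fin: "(\<integral>\<^sup>+x. ennreal c * indicator (A n) x \<partial>lborel) \<noteq> \<infinity>"
    proof -
      have "emeasure lborel (A n) \<le> emeasure lborel {- real n..real n}" by (intro emeasure_mono) (auto simp: A_def)
      also have "\<dots> < \<infinity>" by simp
      finally show ?thesis using Am[of n] by (simp add: nn_integral_cmult_indicator ennreal_mult_eq_top_iff)
    qed
    have "(\<integral>\<^sup>+x. (h x * indicator (A n) x - ennreal c * indicator (A n) x) \<partial>lborel) =
       (\<integral>\<^sup>+x. h x * indicator (A n) x \<partial>lborel) - (\<integral>\<^sup>+x. ennreal c * indicator (A n) x \<partial>lborel)"
    proof (rule nn_integral_diff)
      show "AE x in lborel. ennreal c * indicator (A n) x \<le> h x * indicator (A n) x"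
        by (auto simp: A_def indicator_def)
    qed (use fin in auto)
    also have "\<dots> = 0" using 1 fin le_less_trans[OF 1] by (simp add: diff_eq_0_iff_ennreal less_top)
    finally have "AE x in lborel. h x * indicator (A n) x - ennreal c * indicator (A n) x = 0"
      by (subst (asm) nn_integral_0_iff_AE) auto
    then show ?thesis
    proof eventually_elim
      case (elim x)
      show ?case
      proof
        assume x: "x \<in> A n"
        then have "h x - ennreal c = 0" "ennreal c < h x" using elim by (auto simp: A_def)
        then have "h x \<le> ennreal c" "ennreal c < h x" using diff_eq_0_iff_ennreal by blast+
        then show False by simp
      qed
    qed
  qed
  then have "AE x in lborel. \<forall>n. x \<notin> A n" by (simp add: AE_all_countable)
  then have hc: "AE x in lborel. h x \<le> ennreal c"
  proof eventually_elim
    case (elim x)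
    obtain n where "\<bar>x\<bar> < real n" using reals_Archimedean2 by blast
    then show ?case using elim[rule_format, of n] by (auto simp: A_def)
  qed
  define g where "g x = enn2real (min (h x) (ennreal c))" for x
  have gm[measurable]: "g \<in> borel_measurable borel" unfolding g_def using h by simp
  have g0: "0 \<le> g x \<and> g x \<le> c" for x
    unfolding g_def using c0 by (auto intro: enn2real_leI)
  have hg: "AE x in lborel. h x = ennreal (g x)"
    using hc
  proof eventually_elim
    case (elim x)
    then have "h x < top" by (auto intro: le_less_trans)
    then show ?case using elim by (simp add: g_def min_absorb1)
  qed
  have "F b - F a = integral {a..b} g" if ab: "a \<le> b" for a b
  proof -
    have gi: "set_integrable lborel {a..b} g"
      unfolding set_integrable_def
    proof (rule integrableI_bounded_set_indicator[where B = c])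
      show "AE x in lborel. x \<in> {a..b} \<longrightarrow> norm (g x) \<le> c" using g0 by auto
    qed (use ab in auto)
    have "ennreal (F b - F a) = emeasure N {a..b}"
      unfolding N_def using ab
      by (subst emeasure_interval_measure_Icc[OF ab mono]) (auto intro: continuous_on_subset[OF cont])
    also have "\<dots> = (\<integral>\<^sup>+x. h x * indicator {a..b} x \<partial>lborel)"
      unfolding dens[symmetric] by (simp add: emeasure_density)
    also have "\<dots> = (\<integral>\<^sup>+x. ennreal (indicator {a..b} x *\<^sub>R g x) \<partial>lborel)"
      using hg by (intro nn_integral_cong_AE) (auto simp: indicator_def elim!: eventually_mono)
    also have "\<dots> = ennreal (LINT x:{a..b}|lborel. g x)"
      unfolding set_lebesgue_integral_def using gi g0
      by (intro nn_integral_eq_integral) (auto simp: set_integrable_def)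
    also have "(LINT x:{a..b}|lborel. g x) = integral {a..b} g"
      using gi by (rule set_borel_integral_eq_integral)
    finally have "ennreal (F b - F a) = ennreal (integral {a..b} g)" .
    moreover have "0 \<le> integral {a..b} g" using g0 by (intro integral_nonneg set_borel_integral_eq_integral gi) auto
    ultimately show ?thesis using mono[OF ab] by simp
  qed
  then show thesis using that gm g0 by blast
qed

definition bounded_measurable :: "(real \<Rightarrow> 'a::euclidean_space) \<Rightarrow> bool" where
  "bounded_measurable u \<longleftrightarrow> u \<in> borel_measurable lebesgue \<and> bounded (range u)"

lemma bounded_measurableI:
  "u \<in> borel_measurable lebesgue \<Longrightarrow> (\<And>t. norm (u t) \<le> B) \<Longrightarrow> bounded_measurable u"
  unfolding bounded_measurable_def bounded_iff by blast

lemma bounded_measurableD: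
  assumes "bounded_measurable u"
  shows "u \<in> borel_measurable lebesgue" "\<exists>B>0. \<forall>t. norm (u t) \<le> B"
  using assms unfolding bounded_measurable_def bounded_pos by auto

lemma bounded_measurable_const[simp]: "bounded_measurable (\<lambda>t. c)"
  unfolding bounded_measurable_def by auto

lemma bounded_measurable_add:
  assumes "bounded_measurable u" "bounded_measurable v"
  shows "bounded_measurable (\<lambda>t. u t + v t)"
proof -
  obtain B1 where B1: "\<forall>t. norm (u t) \<le> B1" using bounded_measurableD(2)[OF assms(1)] by blast
  obtain B2 where B2: "\<forall>t. norm (v t) \<le> B2" using bounded_measurableD(2)[OF assms(2)] by blast
  have "norm (u t + v t) \<le> B1 + B2" for t
    by (rule order_trans[OF norm_triangle_ineq add_mono[OF B1[rule_format] B2[rule_format]]])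
  then show ?thesis
    by (rule bounded_measurableI[OF borel_measurable_add[OF assms[THEN bounded_measurableD(1)]]])
qed

lemma bounded_measurable_linear:
  assumes "bounded_measurable u" "bounded_linear f"
  shows "bounded_measurable (\<lambda>t. f (u t))"
proof -
  obtain B where B: "\<forall>t. norm (u t) \<le> B" "0 < B" using assms bounded_measurableD(2) by blast
  obtain K where K: "\<And>x. norm (f x) \<le> norm x * K" "0 < K" using assms(2) bounded_linear.pos_bounded by blast
  have "norm (f (u t)) \<le> B * K" for t using K(1)[of "u t"] B(1) K(2) by (meson mult_right_mono order.trans less_imp_le)
  moreover have "(\<lambda>t. f (u t)) \<in> borel_measurable lebesgue"
    using assms by (intro borel_measurable_continuous_on[of f] linear_continuous_on bounded_measurableD(1))
  ultimately show ?thesis by (rule bounded_measurableI[rotated])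
qed

lemma bounded_measurable_scaleR:
  assumes "bounded_measurable u" shows "bounded_measurable (\<lambda>t. c *\<^sub>R u t)"
  using bounded_measurable_linear[OF assms bounded_linear_scaleR_right] .

lemma bounded_measurable_diff:
  assumes "bounded_measurable u" "bounded_measurable v"
  shows "bounded_measurable (\<lambda>t. u t - v t)"
  using bounded_measurable_add[OF assms(1) bounded_measurable_scaleR[OF assms(2), of "-1"]] by simp

lemma bounded_measurable_inner:
  assumes "bounded_measurable u" "bounded_measurable v"
  shows "bounded_measurable (\<lambda>t. u t \<bullet> v t)"
proof -
  obtain B1 where B1: "\<forall>t. norm (u t) \<le> B1" "0 < B1" using bounded_measurableD(2)[OF assms(1)] by blast
  obtain B2 where B2: "\<forall>t. norm (v t) \<le> B2" using bounded_measurableD(2)[OF assms(2)] by blast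
  note B = B1(1) B2 B1(2)
  have "norm (u t \<bullet> v t) \<le> B1 * B2" for t
    using B by (auto intro!: order_trans[OF Cauchy_Schwarz_ineq2] mult_mono)
  then show ?thesis
    by (rule bounded_measurableI[OF borel_measurable_inner[OF assms[THEN bounded_measurableD(1)]]])
qed

lemma bounded_measurable_norm:
  assumes "bounded_measurable u" shows "bounded_measurable (\<lambda>t. norm (u t))"
proof -
  obtain B where "\<forall>t. norm (u t) \<le> B" using bounded_measurableD(2)[OF assms] by blast
  then have "\<And>t. norm (norm (u t)) \<le> B" by simp
  moreover have "(\<lambda>t. norm (u t)) \<in> borel_measurable lebesgue"
    using bounded_measurableD(1)[OF assms] by (rule measurable_compose) simp
  ultimately show ?thesis by (rule bounded_measurableI[rotated])
qed

lemma bounded_measurable_indicator: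
  assumes "bounded_measurable u" "A \<in> sets lebesgue"
  shows "bounded_measurable (\<lambda>t. indicator A t *\<^sub>R u t)"
proof -
  obtain B where B: "\<forall>t. norm (u t) \<le> B" "0 < B" using assms bounded_measurableD(2) by blast
  then have "\<And>t. norm (indicator A t *\<^sub>R u t) \<le> B" by (auto simp: indicator_def)
  moreover have "(\<lambda>t. indicator A t *\<^sub>R u t) \<in> borel_measurable lebesgue"
    using bounded_measurableD(1)[OF assms(1)] assms(2) by simp
  ultimately show ?thesis by (rule bounded_measurableI[rotated])
qed

lemma bounded_measurable_sum:
  assumes "\<And>i. i \<in> I \<Longrightarrow> bounded_measurable (u i)"
  shows "bounded_measurable (\<lambda>t. \<Sum>i\<in>I. u i t)"
  using assms by (induction I rule: infinite_finite_induct) (simp_all add: bounded_measurable_add)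

lemma bounded_measurable_continuous_on:
  assumes "continuous_on {a..b::real} f"
  shows "bounded_measurable (\<lambda>t. indicator {a..b} t *\<^sub>R f t)"
proof -
  have "bounded (f ` {a..b})" using compact_continuous_image[OF assms] compact_imp_bounded by auto
  then obtain B where "\<forall>t\<in>{a..b}. norm (f t) \<le> B" "0 < B" unfolding bounded_pos by auto
  then have "\<And>t. norm (indicator {a..b} t *\<^sub>R f t) \<le> B" by (auto simp: indicator_def)
  moreover have "(\<lambda>t. indicator {a..b} t *\<^sub>R f t) \<in> borel_measurable lebesgue"
    using borel_measurable_continuous_on_indicator[OF _ assms] by (auto intro: measurable_completion)
  ultimately show ?thesis by (rule bounded_measurableI[rotated])
qed

lemma bounded_measurable_set_integrable:
  assumes "bounded_measurable u"
  shows "set_integrable lebesgue {a..b} u"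
proof -
  obtain B where B: "\<forall>t. norm (u t) \<le> B" "0 < B" using assms bounded_measurableD(2) by blast
  show ?thesis unfolding set_integrable_def
    by (rule integrableI_bounded_set_indicator[where B = B])
      (use B bounded_measurableD(1)[OF assms] in \<open>auto simp: emeasure_lborel_Icc_eq\<close>)
qed

lemma bounded_measurable_integrable_on:
  assumes "bounded_measurable u" shows "u integrable_on {a..b}"
  using bounded_measurable_set_integrable[OF assms] by (rule set_lebesgue_integral_eq_integral)

lemma integrable_inner_continuous:
  assumes u: "bounded_measurable u" and f: "continuous_on {a..b} f"
  shows "(\<lambda>t. u t \<bullet> f t) integrable_on {a..b}"
proof -
  have "bounded_measurable (\<lambda>t. u t \<bullet> indicator {a..b} t *\<^sub>R f t)"
    by (intro bounded_measurable_inner u bounded_measurable_continuous_on f)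
  then have "(\<lambda>t. u t \<bullet> indicator {a..b} t *\<^sub>R f t) integrable_on {a..b}"
    by (rule bounded_measurable_integrable_on)
  then show ?thesis by (rule integrable_eq) auto
qed

definition prim :: "(real \<Rightarrow> 'a::euclidean_space) \<Rightarrow> real \<Rightarrow> 'a" where
  "prim u t = integral {0..t} u"

lemma prim_0[simp]: "prim u 0 = 0" unfolding prim_def by simp

lemma prim_diff:
  assumes u: "bounded_measurable u" and "0 \<le> s" "s \<le> t"
  shows "prim u t - prim u s = integral {s..t} u"
  using Henstock_Kurzweil_Integration.integral_combine[of 0 s t u] assms bounded_measurable_integrable_on[OF u]
  by (simp add: prim_def algebra_simps)

lemma norm_prim_diff_le:
  assumes u: "bounded_measurable u" and B: "\<And>t. norm (u t) \<le> B" and "0 \<le> s" "0 \<le> t"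
  shows "norm (prim u t - prim u s) \<le> B * \<bar>t - s\<bar>"
proof -
  have *: "norm (prim u t - prim u s) \<le> B * (t - s)" if "0 \<le> s" "s \<le> t" for s t
  proof -
    have "(u has_integral (prim u t - prim u s)) (cbox s t)"
      using prim_diff[OF u that] bounded_measurable_integrable_on[OF u, of s t] by (simp add: integrable_integral)
    then show ?thesis
      using has_integral_bound[of B u _ s t] B order_trans[OF norm_ge_zero B] that by simp
  qed
  show ?thesis using *[of s t] *[of t s] assms(3,4) by (cases "s \<le> t") (auto simp: norm_minus_commute)
qed

lemma AE_prim_derivative:
  assumes u: "bounded_measurable u"
  shows "AE t in lebesgue. t \<in> {0<..<1} \<longrightarrow> (prim u has_vector_derivative u t) (at t)"
proof -
  have "bounded_measurable (\<lambda>t. (norm (u t))\<^sup>2)"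
    using bounded_measurable_inner[OF u u] by (simp add: power2_norm_eq_inner)
  then show ?thesis
    unfolding prim_def[abs_def]
    by (intro AE_indefinite_integral_derivative bounded_measurable_set_integrable u)
qed

lemma continuous_on_prim:
  assumes u: "bounded_measurable u"
  shows "continuous_on {0..b} (prim u)"
  unfolding prim_def[abs_def] by (intro indefinite_integral_continuous_1 bounded_measurable_integrable_on u)

lemma Lipschitz_real_is_integral:
  fixes f :: "real \<Rightarrow> real"
  assumes lip: "\<And>x y. \<bar>f x - f y\<bar> \<le> L * \<bar>x - y\<bar>"
  obtains g where "g \<in> borel_measurable borel" "\<And>x. \<bar>g x\<bar> \<le> L"
    "\<And>a b. a \<le> b \<Longrightarrow> f b - f a = integral {a..b} g"
proof -
  have d: "f x - f y \<le> L * y - L * x" "f y - f x \<le> L * y - L * x" if "x \<le> y" for x y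
    using lip[of x y] that by (auto simp: abs_le_iff right_diff_distrib)
  have "f x + L * x \<le> f y + L * y" if "x \<le> y" for x y
    using d[OF that] by linarith
  moreover have "(f y + L * y) - (f x + L * x) \<le> (2 * L) * (y - x)" if "x \<le> y" for x y
    using d[OF that] by (simp add: right_diff_distrib)
  ultimately obtain g where g: "g \<in> borel_measurable borel" "\<And>x. 0 \<le> g x \<and> g x \<le> 2 * L"
    "\<And>a b. a \<le> b \<Longrightarrow> (f b + L * b) - (f a + L * a) = integral {a..b} g"
    using monotone_Lipschitz_is_integral[of "\<lambda>x. f x + L * x" "2 * L"] by blast
  have gi: "g integrable_on {a..b}" for a b
    using g(1) by (intro bounded_measurable_integrable_on bounded_measurableI[of _ "2 * L"])
      (use g(2) in \<open>auto intro: measurable_completion\<close>)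
  show thesis
  proof (rule that[of "\<lambda>x. g x - L"])
    show "(\<lambda>x. g x - L) \<in> borel_measurable borel" using g(1) by simp
    show "\<bar>g x - L\<bar> \<le> L" for x using g(2)[of x] by auto
    show "f b - f a = integral {a..b} (\<lambda>x. g x - L)" if "a \<le> b" for a b
      using g(3)[OF that] that
        Henstock_Kurzweil_Integration.integral_diff[OF gi[of a b] integrable_const_ivl[of L a b]]
      by (simp add: algebra_simps)
  qed
qed

text \<open>The bounded velocity of a Lipschitz curve is recovered coordinatewise, after extending the
curve by constants beyond the ends of the interval.\<close>
lemma Lipschitz_is_prim:
  fixes f :: "real \<Rightarrow> 'a::euclidean_space"
  assumes lip: "\<And>x y. x \<in> {0..1} \<Longrightarrow> y \<in> {0..1} \<Longrightarrow> norm (f x - f y) \<le> L * \<bar>x - y\<bar>"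
  obtains g where "bounded_measurable g" "\<And>t. t \<in> {0..1} \<Longrightarrow> f t = f 0 + prim g t"
proof -
  \<comment> \<open>Composition with \<open>p\<close> extends \<open>f\<close> to the line with the same Lipschitz constant.\<close>
  define p where "p x = max 0 (min 1 x)" for x :: real
  have L0: "0 \<le> L" using order_trans[OF norm_ge_zero lip[of 0 1]] by simp
  have "\<exists>g. g \<in> borel_measurable borel \<and> (\<forall>x. \<bar>g x\<bar> \<le> L) \<and>
      (\<forall>a b. a \<le> b \<longrightarrow> f (p b) \<bullet> i - f (p a) \<bullet> i = integral {a..b} g)" if i: "i \<in> Basis" for i
  proof -
    have "\<bar>f (p x) \<bullet> i - f (p y) \<bullet> i\<bar> \<le> L * \<bar>x - y\<bar>" for x y
    proof -
      have "\<bar>f (p x) \<bullet> i - f (p y) \<bullet> i\<bar> \<le> norm (f (p x) - f (p y))"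
        using Basis_le_norm[OF i, of "f (p x) - f (p y)"] by (simp add: inner_diff_left)
      also have "\<dots> \<le> L * \<bar>p x - p y\<bar>" by (intro lip) (auto simp: p_def)
      also have "\<dots> \<le> L * \<bar>x - y\<bar>" by (intro mult_left_mono L0) (auto simp: p_def)
      finally show ?thesis .
    qed
    then obtain g where "g \<in> borel_measurable borel" "\<And>x. \<bar>g x\<bar> \<le> L"
        "\<And>a b. a \<le> b \<Longrightarrow> f (p b) \<bullet> i - f (p a) \<bullet> i = integral {a..b} g"
      by (rule Lipschitz_real_is_integral[of "\<lambda>x. f (p x) \<bullet> i" L]) blast
    then show ?thesis by blast
  qed
  then have "\<exists>g. \<forall>i\<in>Basis. g i \<in> borel_measurable borel \<and> (\<forall>x. \<bar>g i x\<bar> \<le> L) \<and>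
      (\<forall>a b. a \<le> b \<longrightarrow> f (p b) \<bullet> i - f (p a) \<bullet> i = integral {a..b} (g i))"
    by (intro bchoice ballI)
  then obtain g where g': "\<forall>i\<in>Basis. g i \<in> borel_measurable borel \<and> (\<forall>x. \<bar>g i x\<bar> \<le> L) \<and>
      (\<forall>a b. a \<le> b \<longrightarrow> f (p b) \<bullet> i - f (p a) \<bullet> i = integral {a..b} (g i))"
    by (elim exE) (rule that)
  note g = bspec[OF g']
  define G where "G x = (\<Sum>i\<in>Basis. g i x *\<^sub>R i)" for x
  have bm: "bounded_measurable (g i)" if "i \<in> Basis" for i
    using g[OF that] by (intro bounded_measurableI[of _ L] measurable_completion) auto
  show thesis
  proof
    show bG: "bounded_measurable G" unfolding G_def
      by (intro bounded_measurable_sum bounded_measurable_linear[OF bm bounded_linear_scaleR_left])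
    fix t :: real assume t: "t \<in> {0..1}"
    have "f t - f 0 = (\<Sum>i\<in>Basis. integral {0..t} (g i) *\<^sub>R i)"
    proof (rule euclidean_eqI)
      fix i :: 'a assume i: "i \<in> Basis"
      have "f (p t) \<bullet> i - f (p 0) \<bullet> i = integral {0..t} (g i)" using g[OF i] t by auto
      moreover have "p t = t" "p 0 = 0" using t by (auto simp: p_def)
      ultimately show "(f t - f 0) \<bullet> i = (\<Sum>i\<in>Basis. integral {0..t} (g i) *\<^sub>R i) \<bullet> i"
        using i by (simp add: inner_diff_left)
    qed
    also have "\<dots> = prim G t"
    proof -
      have "((\<lambda>x. g i x *\<^sub>R i) has_integral integral {0..t} (g i) *\<^sub>R i) {0..t}" if "i \<in> Basis" for i
        using that by (intro has_integral_scaleR_left integrable_integral bounded_measurable_integrable_on bm)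
      then have "(G has_integral (\<Sum>i\<in>Basis. integral {0..t} (g i) *\<^sub>R i)) {0..t}"
        unfolding G_def by (intro has_integral_sum) auto
      then show ?thesis unfolding prim_def by (simp add: integral_unique)
    qed
    finally show "f t = f 0 + prim G t" by (simp add: algebra_simps)
  qed
qed

text \<open>A Lipschitz function is the primitive of some \<open>g\<close>, and by Lebesgue differentiation \<open>g\<close> has to
agree almost everywhere with any given derivative.\<close>
lemma Lipschitz_AE_derivative_prim:
  fixes f :: "real \<Rightarrow> 'a::euclidean_space"
  assumes lip: "\<And>x y. x \<in> {0..1} \<Longrightarrow> y \<in> {0..1} \<Longrightarrow> norm (f x - f y) \<le> L * \<bar>x - y\<bar>"
    and h: "AE t in lebesgue. t \<in> {0<..<1} \<longrightarrow> (f has_vector_derivative h t) (at t)"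
    and t: "t \<in> {0..1}"
  shows "f t = f 0 + integral {0..t} h"
proof -
  obtain g where g: "bounded_measurable g" "\<And>t. t \<in> {0..1} \<Longrightarrow> f t = f 0 + prim g t"
    using Lipschitz_is_prim[OF lip] by blast
  have "AE x in lebesgue. x \<in> {0<..<1} \<longrightarrow> h x = g x"
    using h AE_prim_derivative[OF g(1)]
  proof eventually_elim
    case (elim x)
    show ?case
    proof
      assume x: "x \<in> {0<..<1}"
      have "((\<lambda>t. f 0 + prim g t) has_vector_derivative g x) (at x)"
        using has_vector_derivative_add[OF has_vector_derivative_const[of "f 0"] elim(2)[rule_format, OF x]]
        unfolding add_0_left .
      moreover have "f 0 + prim g t = f t" if "t \<in> {0<..<1}" for t
        using g(2)[of t] that by simp
      ultimately have "(f has_vector_derivative g x) (at x)"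
        by (rule has_vector_derivative_transform_within_open[OF _ open_greaterThanLessThan x])
      then show "h x = g x" using vector_derivative_unique_at[OF elim(1)[rule_format, OF x]] by simp
    qed
  qed
  then obtain N where N: "negligible N" "{x. \<not> (x \<in> {0<..<1} \<longrightarrow> h x = g x)} \<subseteq> N"
    unfolding eventually_ae_filter_negligible by (elim exE conjE)
  have "integral {0..t} h = integral {0..t} g"
  proof (rule integral_spike[of "N \<union> {0, 1}"])
    show "negligible (N \<union> {0, 1})" using N(1) by (simp add: negligible_insert)
    fix x assume "x \<in> {0..t} - (N \<union> {0, 1})"
    then have "x \<in> {0<..<1}" "x \<notin> N" using t by auto
    then show "g x = h x" using N(2) by auto
  qed
  then show ?thesis using g(2)[OF t] by (simp add: prim_def)
qed

section \<open>The action as a quadratic form in the velocity\<close>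

lemma Jmap_Jmap[simp]: "Jmap (Jmap x) = - x"
  by (simp add: Jmap_def prod_eq_iff)

lemma linear_Jmap: "linear Jmap"
  by (rule linearI) (simp_all add: Jmap_def prod_eq_iff)

lemma bounded_linear_Jmap: "bounded_linear Jmap"
  using linear_Jmap by (simp add: linear_conv_bounded_linear)

lemmas Jmap_simps = linear_add[OF linear_Jmap] linear_diff[OF linear_Jmap] linear_neg[OF linear_Jmap]
  linear_scale[OF linear_Jmap] linear_0[OF linear_Jmap]

lemma Jmap_inner: "Jmap x \<bullet> y = - (x \<bullet> Jmap y)"
  by (simp add: Jmap_def inner_prod_def inner_commute)

lemma Jmap_inner_self[simp]: "x \<bullet> Jmap x = 0" "Jmap x \<bullet> x = 0"
  by (simp_all add: Jmap_def inner_prod_def inner_commute)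

lemma norm_Jmap[simp]: "norm (Jmap x) = norm x"
  by (simp add: norm_eq_sqrt_inner Jmap_inner)

lemma prim_add:
  assumes "bounded_measurable u" "bounded_measurable v"
  shows "prim (\<lambda>t. u t + v t) s = prim u s + prim v s"
  unfolding prim_def using assms
  by (intro Henstock_Kurzweil_Integration.integral_add bounded_measurable_integrable_on)

lemma prim_scaleR: "prim (\<lambda>t. c *\<^sub>R u t) s = c *\<^sub>R prim u s"
  unfolding prim_def by simp

lemma prim_diff_fun:
  assumes "bounded_measurable u" "bounded_measurable v"
  shows "prim (\<lambda>t. u t - v t) s = prim u s - prim v s"
  unfolding prim_def using assms
  by (intro Henstock_Kurzweil_Integration.integral_diff bounded_measurable_integrable_on)

lemma norm_prim_le:
  assumes u: "bounded_measurable u" and B: "\<And>t. norm (u t) \<le> B" and t: "t \<in> {0..1}"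
  shows "norm (prim u t) \<le> B"
proof -
  have "norm (prim u t) \<le> B * t" using norm_prim_diff_le[OF u B, of 0 t] t by simp
  also have "\<dots> \<le> B * 1" using t order_trans[OF norm_ge_zero B] by (intro mult_left_mono) auto
  finally show ?thesis by simp
qed

text \<open>The curve with velocity \<open>Jmap (u t)\<close> that starts at 0 is \<open>Jmap (prim u t)\<close>; if it is closed,
its action is half of \<open>area u u\<close>.\<close>
definition area :: "(real \<Rightarrow> 'n::finite phase) \<Rightarrow> (real \<Rightarrow> 'n phase) \<Rightarrow> real" where
  "area u v = integral {0..1} (\<lambda>t. u t \<bullet> Jmap (prim v t))"

lemma continuous_on_Jmap_prim:
  assumes "bounded_measurable v" shows "continuous_on {0..1} (\<lambda>t. Jmap (prim v t))"
  by (rule bounded_linear.continuous_on[OF bounded_linear_Jmap continuous_on_prim[OF assms]])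

lemma area_integrable:
  assumes "bounded_measurable u" "bounded_measurable v"
  shows "(\<lambda>t. u t \<bullet> Jmap (prim v t)) integrable_on {0..1}"
  by (rule integrable_inner_continuous[OF assms(1) continuous_on_Jmap_prim[OF assms(2)]])

lemma area_add_left:
  assumes "bounded_measurable u" "bounded_measurable u'" "bounded_measurable v"
  shows "area (\<lambda>t. u t + u' t) v = area u v + area u' v"
  unfolding area_def inner_add_left
  by (intro Henstock_Kurzweil_Integration.integral_add area_integrable assms)

lemma area_add_right:
  assumes "bounded_measurable u" "bounded_measurable v" "bounded_measurable v'"
  shows "area u (\<lambda>t. v t + v' t) = area u v + area u v'"
  unfolding area_def prim_add[OF assms(2,3)] Jmap_simps inner_add_right
  by (intro Henstock_Kurzweil_Integration.integral_add area_integrable assms)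

lemma area_scaleR_left: "area (\<lambda>t. c *\<^sub>R u t) v = c * area u v"
  unfolding area_def by simp

lemma area_scaleR_right: "area u (\<lambda>t. c *\<^sub>R v t) = c * area u v"
  unfolding area_def prim_scaleR Jmap_simps by simp

lemma area_diff_left:
  assumes "bounded_measurable u" "bounded_measurable u'" "bounded_measurable v"
  shows "area (\<lambda>t. u t - u' t) v = area u v - area u' v"
  using area_add_left[OF assms(1) bounded_measurable_scaleR[OF assms(2), of "-1"] assms(3)]
    area_scaleR_left[of "-1" u' v] by simp

lemma area_diff_right:
  assumes "bounded_measurable u" "bounded_measurable v" "bounded_measurable v'"
  shows "area u (\<lambda>t. v t - v' t) = area u v - area u v'"
  using area_add_right[OF assms(1,2) bounded_measurable_scaleR[OF assms(3), of "-1"]]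
    area_scaleR_right[of u "-1" v'] by simp

text \<open>Integration by parts: \<open>prim u t \<bullet> Jmap (prim v t)\<close> is Lipschitz and its derivative is the
difference of the two integrands. For velocities of closed curves the form is therefore
symmetric.\<close>
lemma area_swap:
  assumes u: "bounded_measurable u" and v: "bounded_measurable v"
  shows "area u v - area v u = prim u 1 \<bullet> Jmap (prim v 1)"
proof -
  define f where "f t = prim u t \<bullet> Jmap (prim v t)" for t
  obtain A where A: "0 < A" "\<And>t. norm (u t) \<le> A" using bounded_measurableD(2)[OF u] by blast
  obtain B where B: "0 < B" "\<And>t. norm (v t) \<le> B" using bounded_measurableD(2)[OF v] by blast
  have "f 1 = f 0 + integral {0..1} (\<lambda>t. u t \<bullet> Jmap (prim v t) - v t \<bullet> Jmap (prim u t))"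
  proof (rule Lipschitz_AE_derivative_prim)
    fix x y :: real assume x: "x \<in> {0..1}" and y: "y \<in> {0..1}"
    have "norm (prim v x) \<le> B * 1"
      using norm_prim_le[OF v B(2) x] by simp
    moreover have "norm (prim u y) \<le> A * 1"
      using norm_prim_le[OF u A(2) y] by simp
    moreover have "norm (prim u x - prim u y) \<le> A * \<bar>x - y\<bar>" "norm (prim v x - prim v y) \<le> B * \<bar>x - y\<bar>"
      using norm_prim_diff_le[OF u A(2), of y x] norm_prim_diff_le[OF v B(2), of y x] x y by auto
    moreover have "f x - f y = (prim u x - prim u y) \<bullet> Jmap (prim v x) + prim u y \<bullet> Jmap (prim v x - prim v y)"
      by (simp add: f_def Jmap_simps inner_diff_left inner_diff_right)
    moreover have "\<bar>(prim u x - prim u y) \<bullet> Jmap (prim v x)\<bar> \<le> norm (prim u x - prim u y) * norm (prim v x)"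
      using Cauchy_Schwarz_ineq2[of "prim u x - prim u y" "Jmap (prim v x)"] by simp
    moreover have "\<bar>prim u y \<bullet> Jmap (prim v x - prim v y)\<bar> \<le> norm (prim u y) * norm (prim v x - prim v y)"
      using Cauchy_Schwarz_ineq2[of "prim u y" "Jmap (prim v x - prim v y)"] by simp
    moreover have "norm (prim u x - prim u y) * norm (prim v x) \<le> (A * \<bar>x - y\<bar>) * (B * 1)"
      by (rule mult_mono) (use calculation A(1) in auto)
    moreover have "norm (prim u y) * norm (prim v x - prim v y) \<le> (A * 1) * (B * \<bar>x - y\<bar>)"
      by (rule mult_mono) (use calculation A(1) in auto)
    ultimately have "\<bar>f x - f y\<bar> \<le> (A * \<bar>x - y\<bar>) * (B * 1) + (A * 1) * (B * \<bar>x - y\<bar>)" by linarith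
    then show "norm (f x - f y) \<le> (2 * A * B) * \<bar>x - y\<bar>" by (simp add: algebra_simps)
  next
    show "AE t in lebesgue. t \<in> {0<..<1} \<longrightarrow>
        (f has_vector_derivative u t \<bullet> Jmap (prim v t) - v t \<bullet> Jmap (prim u t)) (at t)"
      using AE_prim_derivative[OF u] AE_prim_derivative[OF v]
    proof eventually_elim
      case (elim t)
      show ?case
      proof
        assume t: "t \<in> {0<..<1}"
        have du: "(prim u has_vector_derivative u t) (at t)" using elim(1) t by blast
        have dv: "((\<lambda>t. Jmap (prim v t)) has_vector_derivative Jmap (v t)) (at t)"
          using bounded_linear.has_vector_derivative[OF bounded_linear_Jmap elim(2)[rule_format, OF t]] .
        have "(f has_vector_derivative prim u t \<bullet> Jmap (v t) + u t \<bullet> Jmap (prim v t)) (at t)"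
          unfolding f_def
          by (rule bounded_bilinear.has_vector_derivative[OF bounded_bilinear_inner du dv])
        moreover have "prim u t \<bullet> Jmap (v t) = - (v t \<bullet> Jmap (prim u t))"
          by (simp add: Jmap_inner inner_commute[of _ "Jmap (v t)"])
        ultimately show "(f has_vector_derivative u t \<bullet> Jmap (prim v t) - v t \<bullet> Jmap (prim u t)) (at t)"
          by simp
      qed
    qed
  qed auto
  also have "integral {0..1} (\<lambda>t. u t \<bullet> Jmap (prim v t) - v t \<bullet> Jmap (prim u t)) = area u v - area v u"
    unfolding area_def by (intro Henstock_Kurzweil_Integration.integral_diff area_integrable u v)
  finally show ?thesis by (simp add: f_def)
qed

lemma abs_area_le:
  assumes u: "bounded_measurable u" and v: "bounded_measurable v"
    and E: "\<And>t. t \<in> {0..1} \<Longrightarrow> norm (prim v t) \<le> E"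
  shows "\<bar>area u v\<bar> \<le> integral {0..1} (\<lambda>t. norm (u t)) * E"
proof -
  have nu: "(\<lambda>t. norm (u t)) integrable_on {0..1}"
  proof -
    from bounded_measurable_norm[OF u] show ?thesis by (rule bounded_measurable_integrable_on)
  qed
  have "norm (area u v) \<le> integral {0..1} (\<lambda>t. norm (u t) * E)"
    unfolding area_def
  proof (rule integral_norm_bound_integral)
    show "(\<lambda>t. u t \<bullet> Jmap (prim v t)) integrable_on {0..1}" by (rule area_integrable[OF u v])
    show "(\<lambda>t. norm (u t) * E) integrable_on {0..1}" by (intro integrable_on_mult_left nu)
    fix t :: real assume t: "t \<in> {0..1}"
    have "norm (u t \<bullet> Jmap (prim v t)) \<le> norm (u t) * norm (prim v t)"
      using Cauchy_Schwarz_ineq2[of "u t" "Jmap (prim v t)"] by simp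
    also have "\<dots> \<le> norm (u t) * E" by (intro mult_left_mono E t) auto
    finally show "norm (u t \<bullet> Jmap (prim v t)) \<le> norm (u t) * E" .
  qed
  then show ?thesis by simp
qed

text \<open>Otherwise a hyperplane would separate the average from \<open>C\<close>, while the integrand stays on one
side of it.\<close>
lemma average_in_convex:
  assumes u: "bounded_measurable u" and C: "closed C" "convex C" and uC: "\<And>t. u t \<in> C" and st: "0 \<le> s" "s < t"
  shows "(1 / (t - s)) *\<^sub>R (prim u t - prim u s) \<in> C"
proof (rule ccontr)
  let ?a = "(1 / (t - s)) *\<^sub>R (prim u t - prim u s)"
  assume "?a \<notin> C"
  then obtain v b where vb: "v \<bullet> ?a < b" "\<forall>x\<in>C. b < v \<bullet> x"
    using separating_hyperplane_closed_point[OF C(2,1)] by blast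
  have i: "u integrable_on {s..t}" by (rule bounded_measurable_integrable_on[OF u])
  have "b * (t - s) \<le> integral {s..t} (\<lambda>x. u x \<bullet> v)"
  proof -
    have "integral {s..t} (\<lambda>x. b) \<le> integral {s..t} (\<lambda>x. u x \<bullet> v)"
    proof (rule integral_le)
      show "(\<lambda>x. u x \<bullet> v) integrable_on {s..t}"
        by (rule bounded_measurable_integrable_on[OF bounded_measurable_inner[OF u bounded_measurable_const]])
      show "\<And>x. x \<in> {s..t} \<Longrightarrow> b \<le> u x \<bullet> v" using vb(2) uC by (metis inner_commute less_imp_le)
    qed auto
    then show ?thesis using st by (simp add: mult.commute)
  qed
  also have "integral {s..t} (\<lambda>x. u x \<bullet> v) = integral {s..t} u \<bullet> v"
    using integral_linear[OF i bounded_linear_inner_left[of v]] by (simp add: o_def)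
  also have "\<dots> = (prim u t - prim u s) \<bullet> v" using prim_diff[OF u] st by simp
  finally have "b \<le> ((prim u t - prim u s) \<bullet> v) / (t - s)" using st by (simp add: pos_le_divide_eq)
  also have "\<dots> = v \<bullet> ?a" by (simp add: inner_commute)
  finally have "b \<le> v \<bullet> ?a" .
  then show False using vb(1) by simp
qed

text \<open>Velocities are limits of difference quotients, which are averages.\<close>
lemma AE_velocity_in_convex:
  assumes w: "bounded_measurable w" and C: "closed C" "convex C"
    and av: "\<And>s t. 0 \<le> s \<Longrightarrow> s < t \<Longrightarrow> t \<le> 1 \<Longrightarrow> (1 / (t - s)) *\<^sub>R (prim w t - prim w s) \<in> C"
  shows "AE t in lebesgue. t \<in> {0<..<1} \<longrightarrow> w t \<in> C"
  using AE_prim_derivative[OF w]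
proof eventually_elim
  case (elim t)
  show ?case
  proof
    assume t: "t \<in> {0<..<1}"
    show "w t \<in> C"
    proof (rule ccontr)
      assume "w t \<notin> C"
      then obtain v b where vb: "v \<bullet> w t < b" "\<forall>x\<in>C. b < v \<bullet> x"
        using separating_hyperplane_closed_point[OF C(2,1)] by blast
      have "((\<lambda>s. v \<bullet> prim w s) has_vector_derivative v \<bullet> w t) (at t)"
        by (rule bounded_linear.has_vector_derivative[OF bounded_linear_inner_right elim[rule_format, OF t]])
      then have "(\<lambda>h. (v \<bullet> prim w (t + h) - v \<bullet> prim w t) / h) \<midarrow>0\<rightarrow> v \<bullet> w t"
        unfolding has_real_derivative_iff_has_vector_derivative[symmetric] DERIV_def .
      then have lim: "((\<lambda>h. (v \<bullet> prim w (t + h) - v \<bullet> prim w t) / h) \<longlongrightarrow> v \<bullet> w t) (at_right 0)"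
        by (rule filterlim_mono) (simp_all add: at_le)
      have "eventually (\<lambda>h. h < 1 - t) (at_right (0::real))"
        using t by (intro order_tendstoD(2)[OF tendsto_ident_at]) auto
      then have "eventually (\<lambda>h. b \<le> (v \<bullet> prim w (t + h) - v \<bullet> prim w t) / h) (at_right 0)"
        using eventually_at_right_less[of "0::real"]
      proof eventually_elim
        case (elim h)
        have "(1 / (t + h - t)) *\<^sub>R (prim w (t + h) - prim w t) \<in> C"
          by (rule av) (use elim t in auto)
        from vb(2)[rule_format, OF this]
        show ?case by (simp add: inner_diff_right)
      qed
      then have "b \<le> v \<bullet> w t" by (rule tendsto_lowerbound[OF lim]) simp
      then show False using vb(1) by simp
    qed
  qed
qed

section \<open>Loops of maximal action\<close>

text \<open>The closed curves under consideration, represented by \<open>u = - Jmap z'\<close> for a curve \<open>z\<close>; the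
condition on \<open>prim u\<close> says that \<open>z\<close> closes up after time 1.\<close>
definition loop_velocity :: "'a::euclidean_space set \<Rightarrow> (real \<Rightarrow> 'a) \<Rightarrow> bool" where
  "loop_velocity C u \<longleftrightarrow> bounded_measurable u \<and> (\<forall>t. u t \<in> C) \<and> prim u 1 = 0"

lemma loop_velocityD:
  assumes "loop_velocity C u"
  shows "bounded_measurable u" "u t \<in> C" "prim u 1 = 0"
  using assms by (auto simp: loop_velocity_def)

text \<open>By symmetry the difference is \<open>area (u + v) (u - v)\<close>, in which \<open>u - v\<close> enters only through its
primitive. This makes the action continuous for uniform convergence of curves.\<close>
lemma area_self_diff_le:
  assumes u: "bounded_measurable u" "\<And>t. norm (u t) \<le> B" "prim u 1 = 0"
    and v: "bounded_measurable v" "\<And>t. norm (v t) \<le> B" "prim v 1 = 0"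
    and E: "\<And>t. t \<in> {0..1} \<Longrightarrow> norm (prim u t - prim v t) \<le> E"
  shows "\<bar>area u u - area v v\<bar> \<le> 2 * B * E"
proof -
  have bd: "bounded_measurable (\<lambda>t. u t - v t)" by (rule bounded_measurable_diff[OF u(1) v(1)])
  have bs: "bounded_measurable (\<lambda>t. u t + v t)" by (rule bounded_measurable_add[OF u(1) v(1)])
  have "area u v = area v u" using area_swap[OF u(1) v(1)] u(3) by simp
  then have "area u u - area v v = area (\<lambda>t. u t + v t) (\<lambda>t. u t - v t)"
    by (simp add: area_add_left[OF u(1) v(1) bd] area_diff_right[OF _ u(1) v(1)] u(1) v(1))
  moreover have "\<bar>area (\<lambda>t. u t + v t) (\<lambda>t. u t - v t)\<bar> \<le> integral {0..1} (\<lambda>t. norm (u t + v t)) * E"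
    by (rule abs_area_le[OF bs bd]) (simp add: prim_diff_fun[OF u(1) v(1)] E)
  moreover have "integral {0..1} (\<lambda>t. norm (u t + v t)) * E \<le> (2 * B) * E"
  proof (rule mult_right_mono)
    show "0 \<le> E" using order_trans[OF norm_ge_zero E[of 0]] by simp
    have "bounded_measurable (\<lambda>t. norm (u t + v t))"
      by (rule bounded_measurable_norm[OF bs])
    then have "integral {0..1} (\<lambda>t. norm (u t + v t)) \<le> integral {0..1} (\<lambda>t::real. 2 * B)"
    proof (intro integral_le bounded_measurable_integrable_on bounded_measurable_const)
      show "norm (u t + v t) \<le> 2 * B" for t
        using norm_triangle_ineq[of "u t" "v t"] u(2)[of t] v(2)[of t] by linarith
    qed
    then show "integral {0..1} (\<lambda>t. norm (u t + v t)) \<le> 2 * B" by simp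
  qed
  ultimately show ?thesis by linarith
qed

text \<open>The direct method. A maximizing sequence of loops is equi-Lipschitz, so a subsequence converges
uniformly; the limit is again a loop with velocities in \<open>C\<close>, because this is a closed condition
on difference quotients, and the action passes to the limit.\<close>
lemma area_maximizer_exists:
  fixes C :: "'n::finite phase set"
  assumes C: "compact C" "convex C" "0 \<in> C"
  obtains u where "loop_velocity C u" "\<And>v. loop_velocity C v \<Longrightarrow> area v v \<le> area u u"
proof -
  obtain B where B: "0 < B" "\<And>x. x \<in> C \<Longrightarrow> norm x \<le> B"
    using compact_imp_bounded[OF C(1)] unfolding bounded_pos by blast
  have clC: "closed C" using C(1) by (rule compact_imp_closed)
  define S where "S = (\<lambda>v. area v v) ` Collect (loop_velocity C)"
  have S_mem: "area v v \<in> S" if "loop_velocity C v" for v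
    unfolding S_def by (rule image_eqI[of _ _ v]) (simp_all add: that)
  have "area (\<lambda>t. 0 :: 'n phase) (\<lambda>t. 0) \<in> S"
    by (rule S_mem) (simp add: loop_velocity_def prim_def C(3))
  then have Sne: "S \<noteq> {}" by auto
  have zero_bm: "bounded_measurable (\<lambda>t. 0 :: 'n phase)" by simp
  have bdd: "bdd_above S"
    unfolding S_def
  proof (rule bdd_aboveI2)
    fix v assume "v \<in> Collect (loop_velocity C)"
    then have v: "loop_velocity C v" by simp
    have nv: "norm (v t) \<le> B" for t using B(2) loop_velocityD(2)[OF v] by blast
    have "\<bar>area v v - area (\<lambda>t. 0 :: 'n phase) (\<lambda>t. 0)\<bar> \<le> 2 * B * B"
      by (rule area_self_diff_le[OF loop_velocityD(1)[OF v] nv loop_velocityD(3)[OF v] zero_bm])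
        (use B(1) norm_prim_le[OF loop_velocityD(1)[OF v] nv] in \<open>auto simp: prim_def\<close>)
    then show "area v v \<le> 2 * B * B" by (simp add: area_def)
  qed
  have "\<exists>u. loop_velocity C u \<and> Sup S - 1 / real (Suc n) < area u u" for n
  proof -
    have "Sup S - 1 / real (Suc n) < Sup S" by simp
    then obtain s where s: "s \<in> S" "Sup S - 1 / real (Suc n) < s"
      using less_cSup_iff[OF Sne bdd] by blast
    from s(1) obtain v where "loop_velocity C v" "s = area v v" unfolding S_def by (elim imageE CollectE)
    with s(2) show ?thesis by blast
  qed
  then have "\<exists>un. \<forall>n. loop_velocity C (un n) \<and> Sup S - 1 / real (Suc n) < area (un n) (un n)"
    by (intro choice allI)
  then obtain un where un: "\<And>n. loop_velocity C (un n)" "\<And>n. Sup S - 1 / real (Suc n) < area (un n) (un n)"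
    by blast
  note unD = loop_velocityD[OF un(1)]
  have nB: "norm (un n t) \<le> B" for n t by (rule B(2)[OF unD(2)])
  have Lip: "norm (prim (un n) x - prim (un n) y) \<le> B * \<bar>x - y\<bar>" if "x \<in> {0..1}" "y \<in> {0..1}" for n x y
    using norm_prim_diff_le[OF unD(1) nB, of y x n] that by simp
  obtain g k where g: "continuous_on {0..1::real} g" "strict_mono (k :: nat \<Rightarrow> nat)"
    "\<And>e. 0 < e \<Longrightarrow> \<exists>N. \<forall>n x. n \<ge> N \<and> x \<in> {0..1} \<longrightarrow> norm (prim (un (k n)) x - g x) < e"
  proof (rule Arzela_Ascoli[of "{0..1::real}" "\<lambda>n. prim (un n)" B])
    show "norm (prim (un n) x) \<le> B" if "x \<in> {0..1}" for n x
      by (rule norm_prim_le[OF unD(1) nB that])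
    show "\<exists>d>0. \<forall>n y. y \<in> {0..1} \<and> norm (x - y) < d \<longrightarrow> norm (prim (un n) x - prim (un n) y) < e"
      if x: "x \<in> {0..1}" and e: "0 < e" for x e
    proof (intro exI[of _ "e / B"] conjI allI impI)
      fix n y assume y: "y \<in> {0..1} \<and> norm (x - y) < e / B"
      have "norm (prim (un n) x - prim (un n) y) \<le> B * \<bar>x - y\<bar>" using Lip x y by blast
      also have "\<dots> < e" using y B(1) by (simp add: pos_less_divide_eq mult.commute)
      finally show "norm (prim (un n) x - prim (un n) y) < e" .
    qed (use e B in simp)
  qed auto
  have lim: "(\<lambda>n. prim (un (k n)) x) \<longlonglongrightarrow> g x" if "x \<in> {0..1}" for x
    unfolding LIMSEQ_iff using g(3) that by blast
  have g0: "g 0 = 0" using LIMSEQ_unique[OF lim[of 0]] by simp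
  have g1: "g 1 = 0" using LIMSEQ_unique[OF lim[of 1]] unD(3) by simp
  have Lipg: "norm (g x - g y) \<le> B * \<bar>x - y\<bar>" if "x \<in> {0..1}" "y \<in> {0..1}" for x y
    by (rule tendsto_upperbound[OF tendsto_norm[OF tendsto_diff[OF lim[OF that(1)] lim[OF that(2)]]]])
      (auto intro!: always_eventually Lip that)
  obtain w where w: "bounded_measurable w" "\<And>t. t \<in> {0..1} \<Longrightarrow> g t = g 0 + prim w t"
    using Lipschitz_is_prim[OF Lipg] by blast
  have gw: "prim w t = g t" if "t \<in> {0..1}" for t using w(2)[OF that] g0 by simp
  have "AE t in lebesgue. t \<in> {0<..<1} \<longrightarrow> w t \<in> C"
  proof (rule AE_velocity_in_convex[OF w(1) clC C(2)])
    fix s t :: real assume st: "0 \<le> s" "s < t" "t \<le> 1"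
    have "(\<lambda>n. (1 / (t - s)) *\<^sub>R (prim (un (k n)) t - prim (un (k n)) s)) \<longlonglongrightarrow> (1 / (t - s)) *\<^sub>R (g t - g s)"
      by (intro tendsto_intros lim) (use st in auto)
    moreover have "(1 / (t - s)) *\<^sub>R (prim (un (k n)) t - prim (un (k n)) s) \<in> C" for n
      by (rule average_in_convex[OF unD(1) clC C(2) unD(2) st(1,2)])
    ultimately have "(1 / (t - s)) *\<^sub>R (g t - g s) \<in> C"
      by (rule closed_sequentially[OF clC, rotated])
    then show "(1 / (t - s)) *\<^sub>R (prim w t - prim w s) \<in> C" using st by (simp add: gw)
  qed
  then obtain N where N: "negligible N" "{t. \<not> (t \<in> {0<..<1} \<longrightarrow> w t \<in> C)} \<subseteq> N"
    unfolding eventually_ae_filter_negligible by (elim exE conjE)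
  define u where "u t = indicator (w -` C) t *\<^sub>R w t" for t
  have "w -` C \<inter> space lebesgue \<in> sets lebesgue"
    using bounded_measurableD(1)[OF w(1)] by (rule measurable_sets) (use clC in auto)
  then have bu: "bounded_measurable u"
    unfolding u_def by (intro bounded_measurable_indicator w(1)) simp
  have uC: "u t \<in> C" for t using C(3) by (simp add: u_def indicator_def)
  have pu: "prim u t = g t" if "t \<in> {0..1}" for t
  proof -
    have "prim u t = prim w t"
      unfolding prim_def
    proof (rule integral_spike[of "N \<union> {0, 1}"])
      show "negligible (N \<union> {0, 1})" using N(1) by (simp add: negligible_insert)
      fix x assume x: "x \<in> {0..t} - (N \<union> {0, 1})"
      then have "x \<in> {0<..<1}" "x \<notin> N" using that by auto
      then have "w x \<in> C" using N(2) by auto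
      then show "w x = u x" by (simp add: u_def)
    qed
    then show ?thesis using gw[OF that] by simp
  qed
  have lu: "loop_velocity C u" using bu uC pu[of 1] g1 by (simp add: loop_velocity_def)
  have l1: "(\<lambda>n. area (un (k n)) (un (k n))) \<longlonglongrightarrow> area u u"
    unfolding LIMSEQ_iff
  proof (intro allI impI)
    fix r :: real assume r: "0 < r"
    obtain M where M: "\<forall>n x. n \<ge> M \<and> x \<in> {0..1} \<longrightarrow> norm (prim (un (k n)) x - g x) < r / (4 * B)"
      using g(3)[of "r / (4 * B)"] r B(1) by auto
    show "\<exists>no. \<forall>n\<ge>no. norm (area (un (k n)) (un (k n)) - area u u) < r"
    proof (intro exI[of _ M] allI impI)
      fix n assume n: "M \<le> n"
      have "\<bar>area (un (k n)) (un (k n)) - area u u\<bar> \<le> 2 * B * (r / (4 * B))"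
      proof (rule area_self_diff_le[OF unD(1) nB unD(3) bu B(2)[OF uC] loop_velocityD(3)[OF lu]])
        fix t :: real assume t: "t \<in> {0..1}"
        then show "norm (prim (un (k n)) t - prim u t) \<le> r / (4 * B)"
          using M n pu[OF t] by (simp add: less_imp_le)
      qed
      also have "\<dots> < r" using r B(1) by simp
      finally show "norm (area (un (k n)) (un (k n)) - area u u) < r" by simp
    qed
  qed
  have "(\<lambda>n. 1 / real (Suc (k n))) \<longlonglongrightarrow> 0"
    using LIMSEQ_subseq_LIMSEQ[OF LIMSEQ_inverse_real_of_nat g(2)] by (simp add: o_def inverse_eq_divide)
  then have l2: "(\<lambda>n. Sup S - 1 / real (Suc (k n))) \<longlonglongrightarrow> Sup S - 0"
    by (rule tendsto_diff[OF tendsto_const])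
  have "Sup S - 0 \<le> area u u"
    by (rule LIMSEQ_le[OF l2 l1], intro exI allI impI less_imp_le un(2))
  moreover have "area v v \<le> Sup S" if "loop_velocity C v" for v
    by (rule cSup_upper[OF S_mem[OF that] bdd])
  ultimately have max: "area v v \<le> area u u" if "loop_velocity C v" for v
    using that by (metis diff_zero order_trans)
  show thesis using that[OF lu max] .
qed

section \<open>The Lagrange multiplier of a maximizer\<close>

text \<open>The action of \<open>u + e (v - u)\<close> is a quadratic polynomial in \<open>e\<close> whose linear coefficient is
twice \<open>area v u - area u u\<close>; a positive one would beat the maximum for small \<open>e\<close>.\<close>
lemma area_max_first_variation:
  assumes C: "convex C" and u: "loop_velocity C u" and max: "\<And>v. loop_velocity C v \<Longrightarrow> area v v \<le> area u u"
    and v: "loop_velocity C v"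
  shows "area v u \<le> area u u"
proof (rule ccontr)
  note bu = loop_velocityD(1)[OF u] and bv = loop_velocityD(1)[OF v]
  define d where "d t = v t - u t" for t
  have bd: "bounded_measurable d" unfolding d_def[abs_def] by (rule bounded_measurable_diff[OF bv bu])
  have pd: "prim d 1 = 0"
    unfolding d_def[abs_def] using prim_diff_fun[OF bv bu] loop_velocityD(3)[OF u] loop_velocityD(3)[OF v] by simp
  assume "\<not> area v u \<le> area u u"
  then have pos: "0 < area d u"
    unfolding d_def[abs_def] using area_diff_left[OF bv bu bu] by simp
  \<comment> \<open>So small that the quadratic term in \<open>e\<close> cannot compensate the linear one.\<close>
  define e where "e = min 1 (area d u / (\<bar>area d d\<bar> + 1))"
  have e: "0 < e" "e \<le> 1" using pos by (auto simp: e_def)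
  have eb: "bounded_measurable (\<lambda>t. e *\<^sub>R d t)" by (rule bounded_measurable_scaleR[OF bd])
  have bw: "bounded_measurable (\<lambda>t. u t + e *\<^sub>R d t)" by (rule bounded_measurable_add[OF bu eb])
  have "loop_velocity C (\<lambda>t. u t + e *\<^sub>R d t)"
    unfolding loop_velocity_def
  proof (intro conjI allI)
    fix t
    have "u t + e *\<^sub>R d t = (1 - e) *\<^sub>R u t + e *\<^sub>R v t" by (simp add: d_def algebra_simps)
    also have "\<dots> \<in> C" using C loop_velocityD(2)[OF u] loop_velocityD(2)[OF v] e by (intro convexD) auto
    finally show "u t + e *\<^sub>R d t \<in> C" .
    show "prim (\<lambda>t. u t + e *\<^sub>R d t) 1 = 0"
      using prim_add[OF bu eb] loop_velocityD(3)[OF u] pd by (simp add: prim_scaleR)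
  qed (rule bw)
  then have "area (\<lambda>t. u t + e *\<^sub>R d t) (\<lambda>t. u t + e *\<^sub>R d t) \<le> area u u" by (rule max)
  moreover have "area (\<lambda>t. u t + e *\<^sub>R d t) (\<lambda>t. u t + e *\<^sub>R d t) =
      area u u + e * area u d + e * area d u + e * (e * area d d)"
    by (simp add: area_add_left[OF bu eb bw] area_add_right[OF bu bu eb] area_add_right[OF eb bu eb]
        area_scaleR_left area_scaleR_right)
  moreover have "area u d = area d u" using area_swap[OF bu bd] pd by (simp add: Jmap_simps)
  ultimately have "e * (2 * area d u + e * area d d) \<le> 0" by (simp add: algebra_simps)
  then have 1: "2 * area d u + e * area d d \<le> 0" using e by (simp add: mult_le_0_iff)
  have "- (e * area d d) \<le> e * \<bar>area d d\<bar>" using e(1) by (metis abs_ge_minus_self abs_mult abs_of_pos)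
  also have "\<dots> \<le> e * (\<bar>area d d\<bar> + 1)" using e(1) by (intro mult_left_mono) auto
  also have "\<dots> \<le> area d u / (\<bar>area d d\<bar> + 1) * (\<bar>area d d\<bar> + 1)"
    by (intro mult_right_mono) (auto simp: e_def)
  also have "\<dots> = area d u" by simp
  finally show False using 1 pos by linarith
qed

lemma integral_inner_const:
  assumes "bounded_measurable u"
  shows "integral {0..1} (\<lambda>t. u t \<bullet> c) = prim u 1 \<bullet> c"
  using integral_linear[OF bounded_measurable_integrable_on[OF assms] bounded_linear_inner_left[of c]]
  by (simp add: o_def prim_def)

text \<open>The pairs \<open>(prim v 1, area v u)\<close>, for all \<open>v\<close> with values in \<open>C\<close>, form a convex set that misses
the open ray above \<open>(0, area u u)\<close>. A separating hyperplane is not vertical, since \<open>prim v 1\<close>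
covers a neighbourhood of 0, and its slope is the multiplier.\<close>
lemma area_max_multiplier:
  fixes C :: "'n::finite phase set"
  assumes C: "convex C" "0 \<in> interior C" and u: "loop_velocity C u"
    and max: "\<And>v. loop_velocity C v \<Longrightarrow> area v v \<le> area u u"
  obtains c where "\<And>v. bounded_measurable v \<Longrightarrow> (\<And>t. v t \<in> C) \<Longrightarrow> area v u + prim v 1 \<bullet> c \<le> area u u"
proof -
  note bu = loop_velocityD(1)[OF u]
  define S where "S = {(prim v 1, area v u) | v. bounded_measurable v \<and> (\<forall>t. v t \<in> C)}"
  define T where "T = {0 :: 'n phase} \<times> {area u u <..}"
  have "convex S"
  proof (rule convexI)
    fix x y and a b :: real assume xy: "x \<in> S" "y \<in> S" and ab: "0 \<le> a" "0 \<le> b" "a + b = 1"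
    from xy(1) obtain v where v: "x = (prim v 1, area v u)" "bounded_measurable v" "\<forall>t. v t \<in> C"
      unfolding S_def by blast
    from xy(2) obtain w where w: "y = (prim w 1, area w u)" "bounded_measurable w" "\<forall>t. w t \<in> C"
      unfolding S_def by blast
    note bs = bounded_measurable_scaleR[OF v(2), of a] bounded_measurable_scaleR[OF w(2), of b]
    have "\<forall>t. a *\<^sub>R v t + b *\<^sub>R w t \<in> C" using v(3) w(3) ab C(1) by (simp add: convexD)
    moreover have "a *\<^sub>R x + b *\<^sub>R y = (prim (\<lambda>t. a *\<^sub>R v t + b *\<^sub>R w t) 1, area (\<lambda>t. a *\<^sub>R v t + b *\<^sub>R w t) u)"
      by (simp add: v(1) w(1) prim_add[OF bs] prim_scaleR area_add_left[OF bs bu] area_scaleR_left)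
    ultimately show "a *\<^sub>R x + b *\<^sub>R y \<in> S"
      unfolding S_def using bounded_measurable_add[OF bs] by blast
  qed
  moreover have "convex T" unfolding T_def by (intro convex_Times) auto
  moreover have "S \<noteq> {}" unfolding S_def using bu loop_velocityD(2)[OF u] by blast
  moreover have "T \<noteq> {}" unfolding T_def using gt_ex[of "area u u"] by auto
  moreover have "S \<inter> T = {}"
  proof (rule ccontr)
    assume "S \<inter> T \<noteq> {}"
    then obtain v where v: "bounded_measurable v" "\<forall>t. v t \<in> C" "prim v 1 = 0" "area u u < area v u"
      unfolding S_def T_def by auto
    then have "loop_velocity C v" by (simp add: loop_velocity_def)
    then show False using area_max_first_variation[OF C(1) u max] v(4) by force
  qed
  ultimately obtain a b where ab: "a \<noteq> 0" "\<forall>x\<in>S. a \<bullet> x \<le> b" "\<forall>x\<in>T. b \<le> a \<bullet> x"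
    using separating_hyperplane_sets[of S T] by auto
  obtain c m where a: "a = (c, m)" by (cases a)
  have T: "b \<le> m * r" if "area u u < r" for r
    using ab(3) that by (force simp: T_def a)
  have S: "prim v 1 \<bullet> c + m * area v u \<le> b" if "bounded_measurable v" "\<forall>t. v t \<in> C" for v
  proof -
    have "(prim v 1, area v u) \<in> S" unfolding S_def using that by blast
    from ab(2)[rule_format, OF this] show ?thesis by (simp add: a inner_commute)
  qed
  have bM: "b \<le> m * area u u"
  proof (rule tendsto_lowerbound)
    show "((\<lambda>r. m * r) \<longlongrightarrow> m * area u u) (at_right (area u u))" by (intro tendsto_intros)
    show "\<forall>\<^sub>F r in at_right (area u u). b \<le> m * r"
      using eventually_at_right_less[of "area u u"] by (rule eventually_mono) (rule T)
  qed simp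
  have m0: "0 \<le> m"
  proof (rule ccontr)
    assume m: "\<not> 0 \<le> m"
    \<comment> \<open>Far up the ray a negative slope would violate the separation.\<close>
    define r where "r = max (area u u + 1) (b / m + 1)"
    have "b \<le> m * r" by (rule T) (simp add: r_def)
    moreover have "m * r \<le> m * (b / m + 1)" using m by (intro mult_left_mono_neg) (auto simp: r_def)
    ultimately show False using m by (simp add: distrib_left)
  qed
  have m: "0 < m"
  proof (rule ccontr)
    assume "\<not> 0 < m"
    then have mz: "m = 0" using m0 by simp
    then have cn: "c \<noteq> 0" using ab(1) a by (auto simp: zero_prod_def)
    obtain \<delta> where d: "0 < \<delta>" "cball 0 \<delta> \<subseteq> C" using C(2) by (auto simp: mem_interior_cball)
    define x where "x = (\<delta> / norm c) *\<^sub>R c"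
    have "norm x = \<delta>" using cn d by (simp add: x_def)
    then have "x \<in> C" using d by auto
    then have "prim (\<lambda>t. x) 1 \<bullet> c + m * area (\<lambda>t. x) u \<le> b" by (intro S) auto
    then have "x \<bullet> c \<le> 0" using mz bM by (simp add: prim_def)
    moreover have "x \<bullet> c = \<delta> * norm c" using cn by (simp add: x_def power2_norm_eq_inner[symmetric] power2_eq_square)
    ultimately show False using d cn by (simp add: mult_le_0_iff)
  qed
  show thesis
  proof (rule that[of "(1 / m) *\<^sub>R c"])
    fix v :: "real \<Rightarrow> 'n phase" assume v: "bounded_measurable v" "\<And>t. v t \<in> C"
    have "prim v 1 \<bullet> c + m * area v u \<le> m * area u u" using S[OF v(1)] v(2) bM by force
    then have "(prim v 1 \<bullet> c + m * area v u) / m \<le> area u u" using m by (simp add: divide_le_eq mult.commute)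
    then show "area v u + prim v 1 \<bullet> ((1 / m) *\<^sub>R c) \<le> area u u" using m by (simp add: add_divide_distrib)
  qed
qed

lemma AE_eq_0_of_integral_le_0:
  fixes f :: "real \<Rightarrow> real"
  assumes f: "bounded_measurable f" and nn: "\<And>t. t \<in> {0..1} \<Longrightarrow> 0 \<le> f t" and le: "integral {0..1} f \<le> 0"
  shows "AE t in lebesgue. t \<in> {0..1} \<longrightarrow> f t = 0"
proof -
  have i: "set_integrable lebesgue {0..1} f" by (rule bounded_measurable_set_integrable[OF f])
  have nn': "AE t in lebesgue. 0 \<le> indicat_real {0..1} t *\<^sub>R f t" using nn by (auto simp: indicator_def)
  have "(LINT t|lebesgue. indicat_real {0..1} t *\<^sub>R f t) = integral {0..1} f"
    using set_lebesgue_integral_eq_integral(2)[OF i] by (simp add: set_lebesgue_integral_def)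
  then have "(LINT t|lebesgue. indicat_real {0..1} t *\<^sub>R f t) = 0"
    using le integral_nonneg_AE[OF nn'] by simp
  then have "AE t in lebesgue. indicat_real {0..1} t *\<^sub>R f t = 0"
    using integral_nonneg_eq_0_iff_AE[OF i[unfolded set_integrable_def] nn'] by simp
  then show ?thesis by (rule eventually_mono) (auto simp: indicator_def)
qed

text \<open>A competitor that follows a fixed \<open>x\<close> where \<open>x\<close> is better than \<open>u\<close>, and \<open>u\<close> elsewhere, shows
that \<open>x\<close> is better only on a null set; a countable dense set of \<open>x\<close> suffices.\<close>
lemma AE_pointwise_maximal:
  fixes C :: "'a::euclidean_space set"
  assumes u: "bounded_measurable u" "\<And>t. u t \<in> C" and y: "continuous_on {0..1} y"
    and max: "\<And>v. bounded_measurable v \<Longrightarrow> (\<And>t. v t \<in> C) \<Longrightarrow>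
      integral {0..1} (\<lambda>t. v t \<bullet> y t) \<le> integral {0..1} (\<lambda>t. u t \<bullet> y t)"
  shows "AE t in lebesgue. t \<in> {0..1} \<longrightarrow> (\<forall>x\<in>C. x \<bullet> y t \<le> u t \<bullet> y t)"
proof -
  define Y where "Y t = indicat_real {0..1} t *\<^sub>R y t" for t
  have bY: "bounded_measurable Y" unfolding Y_def by (rule bounded_measurable_continuous_on[OF y])
  have one: "AE t in lebesgue. t \<in> {0..1} \<longrightarrow> x \<bullet> y t \<le> u t \<bullet> y t" if x: "x \<in> C" for x
  proof -
    define f where "f t = (x - u t) \<bullet> Y t" for t
    have bxu: "bounded_measurable (\<lambda>t. x - u t)" by (rule bounded_measurable_diff[OF bounded_measurable_const u(1)])
    have bf: "bounded_measurable f" unfolding f_def by (rule bounded_measurable_inner[OF bxu bY])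
    define A where "A = {t. 0 < f t}"
    have "f -` {0<..} \<inter> space lebesgue \<in> sets lebesgue"
      using bounded_measurableD(1)[OF bf] by (rule measurable_sets) simp
    then have A: "A \<in> sets lebesgue" by (simp add: A_def vimage_def)
    define v where "v t = u t + indicator A t *\<^sub>R (x - u t)" for t
    have bA: "bounded_measurable (\<lambda>t. indicator A t *\<^sub>R (x - u t))" by (rule bounded_measurable_indicator[OF bxu A])
    have bv: "bounded_measurable v" unfolding v_def by (rule bounded_measurable_add[OF u(1) bA])
    have vC: "v t \<in> C" for t using u(2) x by (simp add: v_def indicator_def)
    have bg: "bounded_measurable (\<lambda>t. indicator A t *\<^sub>R f t)" by (rule bounded_measurable_indicator[OF bf A])
    have "integral {0..1} (\<lambda>t. indicator A t *\<^sub>R f t) = integral {0..1} (\<lambda>t. v t \<bullet> y t - u t \<bullet> y t)"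
      by (rule Henstock_Kurzweil_Integration.integral_cong) (simp add: v_def f_def Y_def inner_add_left)
    also have "\<dots> = integral {0..1} (\<lambda>t. v t \<bullet> y t) - integral {0..1} (\<lambda>t. u t \<bullet> y t)"
      by (intro Henstock_Kurzweil_Integration.integral_diff integrable_inner_continuous bv u(1) y)
    also have "\<dots> \<le> 0" using max[OF bv vC] by simp
    finally have "AE t in lebesgue. t \<in> {0..1} \<longrightarrow> indicator A t *\<^sub>R f t = 0"
      by (intro AE_eq_0_of_integral_le_0 bg) (auto simp: A_def indicator_def)
    then show ?thesis
    proof (rule eventually_mono)
      fix t assume t: "t \<in> {0..1} \<longrightarrow> indicator A t *\<^sub>R f t = 0"
      show "t \<in> {0..1} \<longrightarrow> x \<bullet> y t \<le> u t \<bullet> y t"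
      proof
        assume t1: "t \<in> {0..1}"
        then have "f t \<le> 0" using t by (auto simp: A_def indicator_def split: if_splits)
        then show "x \<bullet> y t \<le> u t \<bullet> y t" using t1 by (simp add: f_def Y_def inner_diff_left)
      qed
    qed
  qed
  obtain D where D: "countable D" "D \<subseteq> C" "C \<subseteq> closure D" using separable[of C] by blast
  have "AE t in lebesgue. \<forall>x\<in>D. t \<in> {0..1} \<longrightarrow> x \<bullet> y t \<le> u t \<bullet> y t"
    using D(1) one D(2) by (subst AE_ball_countable) auto
  then show ?thesis
  proof (rule eventually_mono, intro impI ballI)
    fix t x assume t: "\<forall>x\<in>D. t \<in> {0..1} \<longrightarrow> x \<bullet> y t \<le> u t \<bullet> y t" "t \<in> {0..1}" and x: "x \<in> C"
    have "closed {x. x \<bullet> y t \<le> u t \<bullet> y t}"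
      by (simp add: closed_halfspace_le inner_commute[of _ "y t"])
    moreover have "D \<subseteq> {x. x \<bullet> y t \<le> u t \<bullet> y t}" using t by auto
    ultimately have "closure D \<subseteq> {x. x \<bullet> y t \<le> u t \<bullet> y t}" by (rule closure_minimal[rotated])
    then show "x \<bullet> y t \<le> u t \<bullet> y t" using x D(3) by auto
  qed
qed

section \<open>Support functions, energy and polarity\<close>

lemma AE_Ioo_imp_Icc:
  fixes a b :: real
  assumes "AE t in lebesgue. t \<in> {a<..<b} \<longrightarrow> P t"
  shows "AE t in lebesgue. t \<in> {a..b} \<longrightarrow> P t"
proof -
  have "negligible {a, b}" by (simp add: negligible_insert)
  then have "AE t in lebesgue. t \<notin> {a, b}"
    unfolding negligible_iff_null_sets by (rule AE_not_in)
  with assms show ?thesis by eventually_elim auto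
qed

lemma support_function_Lipschitz:
  fixes C :: "'a::euclidean_space set"
  assumes B: "\<And>x. x \<in> C \<Longrightarrow> norm x \<le> B" and ne: "C \<noteq> {}"
  shows "\<bar>support_function C y - support_function C z\<bar> \<le> B * norm (y - z)"
proof -
  have bdd: "bdd_above ((\<lambda>x. x \<bullet> y) ` C)" for y
  proof (rule bdd_aboveI2)
    fix x assume "x \<in> C"
    then have "norm x * norm y \<le> B * norm y" using B by (intro mult_right_mono) auto
    then show "x \<bullet> y \<le> B * norm y" using norm_cauchy_schwarz[of x y] by linarith
  qed
  have *: "support_function C y \<le> support_function C z + B * norm (y - z)" for y z
    unfolding support_function_def
  proof (rule cSUP_least[OF ne])
    fix x assume x: "x \<in> C"
    have "x \<bullet> y = x \<bullet> z + x \<bullet> (y - z)" by (simp add: inner_diff_right)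
    also have "x \<bullet> z \<le> (SUP x\<in>C. x \<bullet> z)" by (rule cSUP_upper[OF x bdd])
    also have "x \<bullet> (y - z) \<le> norm x * norm (y - z)" by (rule norm_cauchy_schwarz)
    also have "norm x * norm (y - z) \<le> B * norm (y - z)" using B[OF x] by (intro mult_right_mono) auto
    finally show "x \<bullet> y \<le> (SUP x\<in>C. x \<bullet> z) + B * norm (y - z)" by simp
  qed
  show ?thesis using *[of y z] *[of z y] by (simp add: abs_le_iff norm_minus_commute algebra_simps)
qed

lemma support_function_upper:
  assumes "bounded C" "x \<in> C"
  shows "x \<bullet> y \<le> support_function C y"
  unfolding support_function_def
proof (rule cSUP_upper[OF assms(2)])
  obtain B where B: "\<And>x. x \<in> C \<Longrightarrow> norm x \<le> B" using assms(1) unfolding bounded_iff by blast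
  show "bdd_above ((\<lambda>x. x \<bullet> y) ` C)"
  proof (rule bdd_aboveI2)
    fix x assume "x \<in> C"
    then have "norm x * norm y \<le> B * norm y" using B by (intro mult_right_mono) auto
    then show "x \<bullet> y \<le> B * norm y" using norm_cauchy_schwarz[of x y] by linarith
  qed
qed

lemma support_function_eqI:
  assumes "x \<in> C" "\<And>z. z \<in> C \<Longrightarrow> z \<bullet> y \<le> x \<bullet> y"
  shows "support_function C y = x \<bullet> y"
  unfolding support_function_def
proof (rule cSup_eq_maximum)
  show "x \<bullet> y \<in> (\<lambda>x. x \<bullet> y) ` C" using assms(1) by blast
qed (use assms(2) in blast)

text \<open>Conservation of energy. For fixed \<open>s\<close> the linear function \<open>u s\<close> bounds the support function
from below along the curve and touches it at time \<open>s\<close>. Where both are differentiable the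
derivatives agree, and that of \<open>u s\<close> is \<open>u s \<bullet> Jmap (u s) = 0\<close>.\<close>
lemma support_function_constant_along:
  fixes C :: "'n::finite phase set"
  assumes C: "bounded C" and u: "bounded_measurable u" "\<And>t. u t \<in> C"
    and ext: "AE t in lebesgue. t \<in> {0..1} \<longrightarrow>
      (\<forall>x\<in>C. x \<bullet> (Jmap (prim u t) + c) \<le> u t \<bullet> (Jmap (prim u t) + c))"
    and t: "t \<in> {0..1}"
  shows "support_function C (Jmap (prim u t) + c) = support_function C c"
proof -
  define y where "y t = Jmap (prim u t) + c" for t
  define m where "m t = support_function C (y t)" for t
  obtain B where B: "0 < B" "\<And>x. x \<in> C \<Longrightarrow> norm x \<le> B" using C unfolding bounded_pos by blast
  have ne: "C \<noteq> {}" using u(2) by blast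
  have lip: "norm (m s - m t) \<le> (B * B) * \<bar>s - t\<bar>" if "s \<in> {0..1}" "t \<in> {0..1}" for s t
  proof -
    have "norm (m s - m t) \<le> B * norm (y s - y t)"
      unfolding m_def real_norm_def by (rule support_function_Lipschitz[OF B(2) ne])
    also have "norm (y s - y t) = norm (prim u s - prim u t)"
      by (simp add: y_def Jmap_simps(2)[symmetric])
    also have "B * \<dots> \<le> B * (B * \<bar>s - t\<bar>)"
      using norm_prim_diff_le[OF u(1) B(2)[OF u(2)], of t s] that B(1) by (intro mult_left_mono) auto
    finally show ?thesis by (simp add: mult.assoc)
  qed
  obtain g where g: "bounded_measurable g" "\<And>t. t \<in> {0..1} \<Longrightarrow> m t = m 0 + prim g t"
    using Lipschitz_is_prim[OF lip] by blast
  have "AE s in lebesgue. s \<in> {0<..<1} \<longrightarrow> g s = 0"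
    using ext AE_prim_derivative[OF u(1)] AE_prim_derivative[OF g(1)]
  proof eventually_elim
    case (elim s)
    show ?case
    proof
      assume s: "s \<in> {0<..<1}"
      have d1: "((\<lambda>t. u s \<bullet> Jmap (prim u t)) has_vector_derivative u s \<bullet> Jmap (u s)) (at s)"
        by (rule bounded_linear.has_vector_derivative[OF bounded_linear_inner_right
              bounded_linear.has_vector_derivative[OF bounded_linear_Jmap elim(2)[rule_format, OF s]]])
      have "((\<lambda>t. prim g t - u s \<bullet> Jmap (prim u t)) has_vector_derivative g s - u s \<bullet> Jmap (u s)) (at s)"
        by (rule has_vector_derivative_diff[OF elim(3)[rule_format, OF s] d1])
      then have d: "((\<lambda>t. prim g t - u s \<bullet> Jmap (prim u t)) has_real_derivative g s) (at s)"
        unfolding has_real_derivative_iff_has_vector_derivative by simp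
      have ms: "m s = u s \<bullet> y s"
        unfolding m_def y_def using elim(1) s by (intro support_function_eqI u(2)) auto
      have "prim g s - u s \<bullet> Jmap (prim u s) \<le> prim g r - u s \<bullet> Jmap (prim u r)"
        if r: "\<bar>s - r\<bar> < min s (1 - s)" for r
      proof -
        have r1: "r \<in> {0..1}" using r by auto
        have "u s \<bullet> y r \<le> m r" unfolding m_def by (rule support_function_upper[OF C u(2)])
        then have "u s \<bullet> y r - u s \<bullet> y s \<le> prim g r - prim g s" using ms g(2)[OF r1] g(2)[of s] s by auto
        then show ?thesis by (simp add: y_def inner_add_right)
      qed
      then show "g s = 0" using s by (intro DERIV_local_min[OF d, of "min s (1 - s)"]) auto
    qed
  qed
  then obtain N where N: "negligible N" "{t. \<not> (t \<in> {0<..<1} \<longrightarrow> g t = 0)} \<subseteq> N"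
    unfolding eventually_ae_filter_negligible by (elim exE conjE)
  have "prim g t = integral {0..t} (\<lambda>t. 0)"
    unfolding prim_def
  proof (rule integral_spike[of "N \<union> {0, 1}"])
    show "negligible (N \<union> {0, 1})" using N(1) by (simp add: negligible_insert)
    fix x assume x: "x \<in> {0..t} - (N \<union> {0, 1})"
    then have "x \<in> {0<..<1}" "x \<notin> N" using t by auto
    then show "0 = g x" using N(2) by auto
  qed
  then have "m t = m 0" using g(2)[OF t] by simp
  then show ?thesis by (simp add: m_def y_def Jmap_simps)
qed

text \<open>Twice the polar body; for a convex body it is \<open>{v. support_function K v \<le> 2}\<close>. The factor
matches the normalization of \<open>Sys\<close>.\<close>
definition polar2 :: "'a::euclidean_space set \<Rightarrow> 'a set" where
  "polar2 K = {v. \<forall>x\<in>K. x \<bullet> v \<le> 2}"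

lemma convex_polar2: "convex (polar2 K)"
proof -
  have "polar2 K = (\<Inter>x\<in>K. {v. x \<bullet> v \<le> 2})" by (auto simp: polar2_def)
  then show ?thesis by (auto intro!: convex_INT convex_halfspace_le)
qed

lemma closed_polar2: "closed (polar2 K)"
proof -
  have "polar2 K = (\<Inter>x\<in>K. {v. x \<bullet> v \<le> 2})" by (auto simp: polar2_def)
  then show ?thesis by (auto intro!: closed_INT closed_halfspace_le)
qed

lemma bounded_polar2:
  assumes "0 \<in> interior K" shows "bounded (polar2 K)"
proof -
  obtain r where r: "0 < r" "cball 0 r \<subseteq> K" using assms by (auto simp: mem_interior_cball)
  show ?thesis unfolding bounded_iff
  proof (intro exI[of _ "2 / r"] ballI)
    fix v assume v: "v \<in> polar2 K"
    show "norm v \<le> 2 / r"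
    proof (cases "v = 0")
      case False
      define x where "x = (r / norm v) *\<^sub>R v"
      have "norm x = r" using False r by (simp add: x_def)
      then have "x \<in> K" using r by auto
      then have "x \<bullet> v \<le> 2" using v by (simp add: polar2_def)
      moreover have "x \<bullet> v = r * norm v" using False by (simp add: x_def power2_norm_eq_inner[symmetric] power2_eq_square)
      ultimately show ?thesis using r by (simp add: pos_le_divide_eq mult.commute)
    qed (use r in simp)
  qed
qed

lemma interior_polar2:
  assumes "bounded K" shows "0 \<in> interior (polar2 K)"
proof -
  obtain B where B: "0 < B" "\<And>x. x \<in> K \<Longrightarrow> norm x \<le> B" using assms unfolding bounded_pos by blast
  have "cball 0 (2 / B) \<subseteq> polar2 K"
  proof
    fix v :: 'a assume v: "v \<in> cball 0 (2 / B)"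
    show "v \<in> polar2 K" unfolding polar2_def
    proof (intro CollectI ballI)
      fix x assume x: "x \<in> K"
      have "x \<bullet> v \<le> norm x * norm v" by (rule norm_cauchy_schwarz)
      also have "\<dots> \<le> B * (2 / B)" using B(2)[OF x] v B(1) by (intro mult_mono) auto
      finally show "x \<bullet> v \<le> 2" using B(1) by simp
    qed
  qed
  then show ?thesis unfolding mem_interior_cball using B(1) by (intro exI[of _ "2 / B"]) auto
qed

text \<open>Bipolarity: a point outside \<open>K\<close> is cut off by some normal that, rescaled, lies in \<open>polar2 K\<close>
and has pairing greater than 2 with the point; an interior point can be enlarged inside \<open>K\<close>, so
that its pairings stay below 2 by a definite factor.\<close>
lemma frontier_of_support_polar2:
  assumes K: "convex_body K" "0 \<in> interior K" and x: "support_function (polar2 K) x = 2"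
  shows "x \<in> frontier K"
proof -
  have cK: "compact K" "convex K" using K(1) by (auto simp: convex_body_def)
  note bP = bounded_polar2[OF K(2)]
  have le: "v \<bullet> x \<le> 2" if "v \<in> polar2 K" for v
    using support_function_upper[OF bP that, of x] x by simp
  have "x \<in> K"
  proof (rule ccontr)
    assume "x \<notin> K"
    then obtain a b where ab: "a \<bullet> x < b" "\<forall>y\<in>K. b < a \<bullet> y"
      using separating_hyperplane_closed_point[OF cK(2) compact_imp_closed[OF cK(1)]] by blast
    have b0: "b < 0" using ab(2) K(2) interior_subset by force
    define v where "v = (2 / b) *\<^sub>R a"
    have "v \<in> polar2 K" unfolding polar2_def
    proof (intro CollectI ballI)
      fix y assume "y \<in> K"
      then have "(2 / b) * (a \<bullet> y) \<le> (2 / b) * b" using ab(2) b0 by (intro mult_left_mono_neg) (auto simp: less_imp_le divide_nonneg_neg)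
      then show "y \<bullet> v \<le> 2" using b0 by (simp add: v_def inner_commute)
    qed
    then have "(2 / b) * (a \<bullet> x) \<le> 2" using le[of v] by (simp add: v_def)
    moreover have "(2 / b) * b < (2 / b) * (a \<bullet> x)" using ab(1) b0 by (intro mult_strict_left_mono_neg) (auto simp: divide_pos_neg)
    ultimately show False using b0 by simp
  qed
  moreover have "x \<notin> interior K"
  proof
    assume "x \<in> interior K"
    then obtain r where r: "0 < r" "cball x r \<subseteq> K" by (auto simp: mem_interior_cball)
    define e where "e = r / (norm x + 1)"
    have nx: "0 < norm x + 1" by (simp add: add_nonneg_pos)
    have e: "0 < e" using r nx by (simp add: e_def)
    have "norm (e *\<^sub>R x) \<le> r"
    proof -
      have "norm (e *\<^sub>R x) = e * norm x" using e by simp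
      also have "\<dots> \<le> e * (norm x + 1)" using e by simp
      also have "\<dots> = r" using nx by (simp add: e_def)
      finally show ?thesis .
    qed
    then have "x + e *\<^sub>R x \<in> K" using r(2) by (auto simp: dist_norm)
    then have xK: "(1 + e) *\<^sub>R x \<in> K" by (simp add: scaleR_add_left)
    have "support_function (polar2 K) x \<le> 2 / (1 + e)"
      unfolding support_function_def
    proof (rule cSUP_least)
      show "polar2 K \<noteq> {}" using interior_polar2[OF compact_imp_bounded[OF cK(1)]] interior_subset by blast
      fix v assume "v \<in> polar2 K"
      then have "((1 + e) *\<^sub>R x) \<bullet> v \<le> 2" using xK unfolding polar2_def by blast
      then show "v \<bullet> x \<le> 2 / (1 + e)" using e by (simp add: inner_commute pos_le_divide_eq mult.commute)
    qed
    also have "\<dots> < 2" using e by (subst pos_divide_less_eq) auto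
    finally show False using x by simp
  qed
  ultimately show ?thesis using compact_imp_closed[OF cK(1)] by (simp add: frontier_def)
qed

section \<open>Clarke's dual action principle\<close>

lemma action_nonneg:
  assumes K: "0 \<in> K" and cc: "closed_characteristic K T \<gamma>"
  shows "0 \<le> action T \<gamma>"
proof -
  have "AE t in lebesgue. t \<in> {0..T} \<longrightarrow> - Jmap (velocity \<gamma> t) \<in> normal_cone K (\<gamma> t)"
    using cc by (simp add: closed_characteristic_def)
  then have "AE t in lebesgue. 0 \<le> indicat_real {0..T} t *\<^sub>R ((- Jmap (velocity \<gamma> t)) \<bullet> \<gamma> t)"
  proof (rule eventually_mono)
    fix t assume t: "t \<in> {0..T} \<longrightarrow> - Jmap (velocity \<gamma> t) \<in> normal_cone K (\<gamma> t)"
    show "0 \<le> indicat_real {0..T} t *\<^sub>R ((- Jmap (velocity \<gamma> t)) \<bullet> \<gamma> t)"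
    proof (cases "t \<in> {0..T}")
      case True
      then have "(- Jmap (velocity \<gamma> t)) \<bullet> (\<gamma> t - 0) \<ge> 0"
        using t K unfolding normal_cone_def by blast
      then show ?thesis using True by simp
    qed simp
  qed
  from integral_nonneg_AE[OF this] show ?thesis
    by (simp add: action_def set_lebesgue_integral_def)
qed

lemma c_EHZ_le_action:
  assumes "0 \<in> K" "closed_characteristic K T \<gamma>"
  shows "c_EHZ K \<le> action T \<gamma>"
  unfolding c_EHZ_def
proof (rule cInf_lower)
  show "bdd_below {action T \<gamma> |T \<gamma>. closed_characteristic K T \<gamma>}"
    using action_nonneg[OF assms(1)] by (intro bdd_belowI[of _ 0]) blast
qed (use assms in blast)

lemma normal_cone_of_polar2_extremal:
  assumes u: "u \<in> polar2 K" and l: "0 < l" and e: "u \<bullet> x = 2"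
  shows "(l::real) *\<^sub>R u \<in> normal_cone K x"
  unfolding normal_cone_def
proof (intro CollectI ballI)
  fix y assume "y \<in> K"
  then have "y \<bullet> u \<le> 2" using u by (simp add: polar2_def)
  then have "u \<bullet> y \<le> 2" by (simp add: inner_commute)
  then show "0 \<le> (l *\<^sub>R u) \<bullet> (x - y)" using e l by (simp add: inner_diff_right)
qed

lemma W12_on_prim:
  assumes g: "bounded_measurable g" and f: "\<And>t. t \<in> {0..1} \<Longrightarrow> f t = f 0 + prim g t"
  shows "W12_on 0 1 f"
  unfolding W12_on_def
proof (intro exI[of _ g] conjI ballI)
  show "set_integrable lebesgue {0..1} g" by (rule bounded_measurable_set_integrable[OF g])
  show "set_integrable lebesgue {0..1} (\<lambda>t. (norm (g t))\<^sup>2)"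
    unfolding power2_norm_eq_inner
    by (rule bounded_measurable_set_integrable[OF bounded_measurable_inner[OF g g]])
  show "f t = f 0 + (LINT s:{0..t}|lebesgue. g s)" if "t \<in> {0..1}" for t
    using f[OF that] set_lebesgue_integral_eq_integral(2)[OF bounded_measurable_set_integrable[OF g]]
    by (simp add: prim_def)
qed

text \<open>Clarke's dual principle as an isoperimetric inequality: if the maximal action exceeded 1, the
maximizer, translated by the multiplier and divided by its energy, would be a closed
characteristic of action less than 1.\<close>
theorem Clarke_inequality:
  fixes K :: "'n::finite phase set"
  assumes K: "convex_body K" "0 \<in> interior K" and c1: "c_EHZ K = 1"
    and v: "loop_velocity (polar2 K) v"
  shows "area v v \<le> 2"
proof -
  define C where "C = polar2 K"
  have bK: "bounded K" using K(1) by (simp add: convex_body_def compact_imp_bounded)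
  have bC: "bounded C" unfolding C_def by (rule bounded_polar2[OF K(2)])
  have cC: "compact C" using bC closed_polar2[of K] by (simp add: C_def compact_eq_bounded_closed)
  have vC: "convex C" unfolding C_def by (rule convex_polar2)
  have iC: "0 \<in> interior C" unfolding C_def by (rule interior_polar2[OF bK])
  have zC: "0 \<in> C" using iC interior_subset by blast
  obtain u where u: "loop_velocity C u" and max: "\<And>v. loop_velocity C v \<Longrightarrow> area v v \<le> area u u"
    using area_maximizer_exists[OF cC vC zC] by blast
  note bu = loop_velocityD(1)[OF u] and uC = loop_velocityD(2)[OF u] and pu = loop_velocityD(3)[OF u]
  have "area u u \<le> 2"
  proof (rule ccontr)
    assume "\<not> area u u \<le> 2"
    then have M2: "2 < area u u" by simp
    \<comment> \<open>The action of the maximizer.  It turns out to be the energy of the translated curve \<open>y\<close> as well,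
      and is therefore the factor by which \<open>y\<close> is to be divided.\<close>
    define l where "l = area u u / 2"
    have l: "1 < l" using M2 by (simp add: l_def)
    obtain c where c: "\<And>v. bounded_measurable v \<Longrightarrow> (\<And>t. v t \<in> C) \<Longrightarrow> area v u + prim v 1 \<bullet> c \<le> area u u"
      using area_max_multiplier[OF vC iC u max] by blast
    define y where "y t = Jmap (prim u t) + c" for t
    have cy: "continuous_on {0..1} y"
      unfolding y_def by (intro continuous_on_add continuous_on_const continuous_on_Jmap_prim bu)
    have iy: "integral {0..1} (\<lambda>t. v t \<bullet> y t) = area v u + prim v 1 \<bullet> c" if bv: "bounded_measurable v" for v
    proof -
      have "integral {0..1} (\<lambda>t. v t \<bullet> y t) = integral {0..1} (\<lambda>t. v t \<bullet> Jmap (prim u t)) + integral {0..1} (\<lambda>t. v t \<bullet> c)"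
        unfolding y_def inner_add_right
        by (intro Henstock_Kurzweil_Integration.integral_add area_integrable bv bu integrable_inner_continuous continuous_on_const)
      then show ?thesis using integral_inner_const[OF bv] by (simp add: area_def)
    qed
    have ext: "AE t in lebesgue. t \<in> {0..1} \<longrightarrow> (\<forall>x\<in>C. x \<bullet> y t \<le> u t \<bullet> y t)"
    proof (rule AE_pointwise_maximal[OF bu uC cy])
      fix v :: "real \<Rightarrow> 'n phase" assume "bounded_measurable v" "\<And>t. v t \<in> C"
      then show "integral {0..1} (\<lambda>t. v t \<bullet> y t) \<le> integral {0..1} (\<lambda>t. u t \<bullet> y t)"
        using c[of v] by (simp add: iy bu pu)
    qed
    have const: "support_function C (y t) = support_function C c" if "t \<in> {0..1}" for t
      unfolding y_def by (rule support_function_constant_along[OF bC bu uC _ that]) (use ext in \<open>simp add: y_def\<close>)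
    have uy: "AE t in lebesgue. t \<in> {0..1} \<longrightarrow> u t \<bullet> y t = support_function C c"
      using ext
    proof (rule eventually_mono, intro impI)
      fix t assume e: "t \<in> {0..1} \<longrightarrow> (\<forall>x\<in>C. x \<bullet> y t \<le> u t \<bullet> y t)" and t: "t \<in> {0..1}"
      have "support_function C (y t) = u t \<bullet> y t"
        by (rule support_function_eqI[OF uC]) (use e t in blast)
      then show "u t \<bullet> y t = support_function C c" using const[OF t] by simp
    qed
    have sc: "support_function C c = 2 * l"
    proof -
      obtain N where N: "negligible N" "{t. \<not> (t \<in> {0..1} \<longrightarrow> u t \<bullet> y t = support_function C c)} \<subseteq> N"
        using uy unfolding eventually_ae_filter_negligible by (elim exE conjE)
      have "integral {0..1} (\<lambda>t. u t \<bullet> y t) = integral {0..1} (\<lambda>t::real. support_function C c)"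
        by (rule integral_spike[OF N(1)]) (use N(2) in auto)
      then show ?thesis using iy[OF bu] pu by (simp add: l_def)
    qed
    define \<gamma> where "\<gamma> t = (1 / l) *\<^sub>R y t" for t
    define g where "g t = (1 / l) *\<^sub>R Jmap (u t)" for t
    have bg: "bounded_measurable g"
      unfolding g_def by (intro bounded_measurable_scaleR bounded_measurable_linear[OF bu bounded_linear_Jmap])
    have vel: "AE t in lebesgue. t \<in> {0..1} \<longrightarrow> velocity \<gamma> t = g t"
    proof (rule AE_Ioo_imp_Icc)
      show "AE t in lebesgue. t \<in> {0<..<1} \<longrightarrow> velocity \<gamma> t = g t"
        using AE_prim_derivative[OF bu]
      proof (rule eventually_mono, intro impI)
        fix t :: real assume e: "t \<in> {0<..<1} \<longrightarrow> (prim u has_vector_derivative u t) (at t)" and t: "t \<in> {0<..<1}"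
        have "((\<lambda>t. Jmap (prim u t) + c) has_vector_derivative Jmap (u t) + 0) (at t)"
          by (intro has_vector_derivative_add has_vector_derivative_const
              bounded_linear.has_vector_derivative[OF bounded_linear_Jmap e[rule_format, OF t]])
        from bounded_linear.has_vector_derivative[OF bounded_linear_scaleR_right this, of "1 / l"]
        have "(\<gamma> has_vector_derivative g t) (at t)" by (simp add: \<gamma>_def[abs_def] y_def g_def)
        then show "velocity \<gamma> t = g t" unfolding velocity_def by (rule vector_derivative_at)
      qed
    qed
    have w: "AE t in lebesgue. t \<in> {0..1} \<longrightarrow> - Jmap (velocity \<gamma> t) = (1 / l) *\<^sub>R u t \<and> u t \<bullet> \<gamma> t = 2"
      using vel uy
    proof eventually_elim
      case (elim t)
      show ?case
      proof
        assume t: "t \<in> {0..1}"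
        have "- Jmap (velocity \<gamma> t) = (1 / l) *\<^sub>R u t" using elim(1) t by (simp add: g_def Jmap_simps)
        moreover have "u t \<bullet> \<gamma> t = 2" using elim(2) t l sc by (simp add: \<gamma>_def)
        ultimately show "- Jmap (velocity \<gamma> t) = (1 / l) *\<^sub>R u t \<and> u t \<bullet> \<gamma> t = 2" by blast
      qed
    qed
    have sg: "support_function C (\<gamma> t) = 2" if t: "t \<in> {0..1}" for t
    proof -
      have "support_function C (\<gamma> t) = (SUP x\<in>C. (1 / l) * (x \<bullet> y t))"
        unfolding support_function_def \<gamma>_def by simp
      also have "\<dots> = (1 / l) * (SUP x\<in>C. x \<bullet> y t)"
      proof -
        have ne: "(\<lambda>x. x \<bullet> y t) ` C \<noteq> {}" using zC by auto
        have bdd: "bdd_above ((\<lambda>x. x \<bullet> y t) ` C)"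
          using support_function_upper[OF bC] by (intro bdd_aboveI2)
        have "(1 / l) * Sup ((\<lambda>x. x \<bullet> y t) ` C) = (SUP z\<in>(\<lambda>x. x \<bullet> y t) ` C. (1 / l) * z)"
          by (rule continuous_at_Sup_mono[OF _ _ ne bdd])
            (use l in \<open>auto intro!: monoI divide_right_mono continuous_intros\<close>)
        then show ?thesis by (simp add: image_image)
      qed
      also have "\<dots> = 2" using const[OF t] sc l by (simp add: support_function_def)
      finally show ?thesis .
    qed
    have cc: "closed_characteristic K 1 \<gamma>"
      unfolding closed_characteristic_def
    proof (intro conjI)
      have "\<gamma> t = \<gamma> 0 + prim g t" if "t \<in> {0..1}" for t
      proof -
        have "prim g t = (1 / l) *\<^sub>R Jmap (prim u t)"
          unfolding g_def prim_scaleR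
          using integral_linear[OF bounded_measurable_integrable_on[OF bu] bounded_linear_Jmap]
          by (simp add: prim_def o_def)
        then show ?thesis by (simp add: \<gamma>_def y_def scaleR_add_right Jmap_simps)
      qed
      then show "W12_on 0 1 \<gamma>" by (rule W12_on_prim[OF bg])
      show "\<gamma> 0 = \<gamma> 1" by (simp add: \<gamma>_def y_def pu)
      show "\<gamma> ` {0..1} \<subseteq> frontier K"
        by (intro image_subsetI frontier_of_support_polar2[OF K]) (use sg in \<open>simp add: C_def\<close>)
      show "AE t in lebesgue. t \<in> {0..1} \<longrightarrow> velocity \<gamma> t \<noteq> 0"
        using w
      proof (rule eventually_mono, intro impI notI)
        fix t assume e: "t \<in> {0..1} \<longrightarrow> - Jmap (velocity \<gamma> t) = (1 / l) *\<^sub>R u t \<and> u t \<bullet> \<gamma> t = 2"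
          and t: "t \<in> {0..1}" and z: "velocity \<gamma> t = 0"
        have "(1 / l) *\<^sub>R u t = 0" using e t z by (simp add: Jmap_simps)
        then have "u t = 0" using l by simp
        then show False using e t by simp
      qed
      show "AE t in lebesgue. t \<in> {0..1} \<longrightarrow> - Jmap (velocity \<gamma> t) \<in> normal_cone K (\<gamma> t)"
        using w
      proof (rule eventually_mono, intro impI)
        fix t assume e: "t \<in> {0..1} \<longrightarrow> - Jmap (velocity \<gamma> t) = (1 / l) *\<^sub>R u t \<and> u t \<bullet> \<gamma> t = 2"
          and t: "t \<in> {0..1}"
        have "(1 / l) *\<^sub>R u t \<in> normal_cone K (\<gamma> t)"
          by (rule normal_cone_of_polar2_extremal) (use uC l e t in \<open>auto simp: C_def\<close>)
        then show "- Jmap (velocity \<gamma> t) \<in> normal_cone K (\<gamma> t)" using e t by simp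
      qed
    qed simp
    have "action 1 \<gamma> = 1 / l"
    proof -
      have "(LINT t|lebesgue. indicat_real {0..1::real} t *\<^sub>R (2 / l)) =
          (LINT t|lebesgue. indicat_real {0..1} t *\<^sub>R ((- Jmap (velocity \<gamma> t)) \<bullet> \<gamma> t))"
      proof (rule Bochner_Integration.integral_cong_AE)
        show ae: "AE t in lebesgue. indicat_real {0..1} t *\<^sub>R (2 / l) =
           indicat_real {0..1} t *\<^sub>R ((- Jmap (velocity \<gamma> t)) \<bullet> \<gamma> t)"
          using w
        proof (rule eventually_mono)
          fix t assume "t \<in> {0..1} \<longrightarrow> - Jmap (velocity \<gamma> t) = (1 / l) *\<^sub>R u t \<and> u t \<bullet> \<gamma> t = 2"
          then show "indicat_real {0..1} t *\<^sub>R (2 / l) =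
              indicat_real {0..1} t *\<^sub>R ((- Jmap (velocity \<gamma> t)) \<bullet> \<gamma> t)"
            by (cases "t \<in> {0..1}") (simp_all del: inner_minus_left)
        qed
        show m: "(\<lambda>t. indicat_real {0..1::real} t *\<^sub>R (2 / l)) \<in> borel_measurable lebesgue"
          using bounded_measurable_set_integrable[OF bounded_measurable_const[of "2 / l"], of 0 1]
          unfolding set_integrable_def by (rule borel_measurable_integrable)
        show "(\<lambda>t. indicat_real {0..1} t *\<^sub>R ((- Jmap (velocity \<gamma> t)) \<bullet> \<gamma> t)) \<in> borel_measurable lebesgue"
          by (rule borel_measurable_AE[OF m ae])
      qed
      moreover have "(LINT t|lebesgue. indicat_real {0..1::real} t *\<^sub>R (2 / l)) = 2 / l"
        using set_lebesgue_integral_eq_integral(2)[OF bounded_measurable_set_integrable[OF bounded_measurable_const[of "2 / l"]], of 0 1]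
        by (simp add: set_lebesgue_integral_def)
      ultimately show ?thesis by (simp add: action_def set_lebesgue_integral_def)
    qed
    then have "1 \<le> 1 / l" using c_EHZ_le_action[OF _ cc] K(2) interior_subset c1 by force
    then show False using l by (simp add: pos_le_divide_eq)
  qed
  moreover have "area v v \<le> area u u" by (rule max) (use v in \<open>simp add: C_def\<close>)
  ultimately show ?thesis by simp
qed

section \<open>Variations of positive action\<close>

lemma prim_indicator_scaleR:
  assumes A: "A \<in> sets lebesgue" and t: "0 \<le> t"
  shows "prim (\<lambda>s. indicator A s *\<^sub>R x) t = measure lebesgue (A \<inter> {0..t}) *\<^sub>R x"
proof -
  have bm: "bounded_measurable (\<lambda>s. indicator A s *\<^sub>R x)"
    by (rule bounded_measurable_indicator[OF bounded_measurable_const A])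
  have fin: "emeasure lebesgue (A \<inter> {0..t}) < \<infinity>"
  proof -
    have "emeasure lebesgue (A \<inter> {0..t}) \<le> emeasure lebesgue {0..t}" by (rule emeasure_mono) auto
    also have "\<dots> < \<infinity>" using t by simp
    finally show ?thesis .
  qed
  have "prim (\<lambda>s. indicator A s *\<^sub>R x) t = (LINT s:{0..t}|lebesgue. indicat_real A s *\<^sub>R x)"
    unfolding prim_def by (rule set_lebesgue_integral_eq_integral(2)[symmetric, OF bounded_measurable_set_integrable[OF bm]])
  also have "\<dots> = (LINT s|lebesgue. indicat_real (A \<inter> {0..t}) s *\<^sub>R x)"
    unfolding set_lebesgue_integral_def by (intro Bochner_Integration.integral_cong) (auto simp: indicator_def)
  also have "\<dots> = measure lebesgue (A \<inter> {0..t}) *\<^sub>R x"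
  proof -
    have "A \<inter> {0..t} \<in> sets lebesgue" using A by auto
    then show ?thesis by (rule has_bochner_integral_integral_eq[OF has_bochner_integral_indicator[OF _ fin]])
  qed
  finally show ?thesis .
qed

lemma prim_sum:
  assumes "finite I" "\<And>i. i \<in> I \<Longrightarrow> bounded_measurable (u i)"
  shows "prim (\<lambda>t. \<Sum>i\<in>I. u i t) s = (\<Sum>i\<in>I. prim (u i) s)"
  unfolding prim_def using assms by (intro Henstock_Kurzweil_Integration.integral_sum bounded_measurable_integrable_on)

lemma sum_indicator_disjoint:
  fixes z :: "nat \<Rightarrow> 'a::real_vector"
  assumes Q: "disjoint_family_on Q {..<N}" and j: "j < N" "t \<in> Q j"
  shows "(\<Sum>i<N. indicat_real (Q i) t *\<^sub>R z i) = z j"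
proof -
  have "(\<Sum>i<N. indicat_real (Q i) t *\<^sub>R z i) = (\<Sum>i<N. if i = j then z j else 0)"
  proof (rule sum.cong)
    fix i assume i: "i \<in> {..<N}"
    then have "t \<notin> Q i" if "i \<noteq> j" using Q j that unfolding disjoint_family_on_def by blast
    then show "indicat_real (Q i) t *\<^sub>R z i = (if i = j then z j else 0)" using j(2) by auto
  qed simp
  then show ?thesis using j(1) by simp
qed

text \<open>The measure of \<open>P \<inter> {0..t}\<close> is continuous in \<open>t\<close>, so it takes every intermediate value.\<close>
lemma split_into_consecutive_pieces:
  assumes P: "P \<in> sets lebesgue" "P \<subseteq> {0..1}" and N: "0 < N"
  obtains s :: "nat \<Rightarrow> real" where "\<And>j. j \<le> N \<Longrightarrow> s j \<in> {0..1}"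
    "\<And>j. j \<le> N \<Longrightarrow> measure lebesgue (P \<inter> {0..s j}) = real j * measure lebesgue P / real N"
proof -
  define \<tau> where "\<tau> t = prim (\<lambda>s. indicat_real P s *\<^sub>R (1::real)) t" for t
  have bm: "bounded_measurable (\<lambda>s. indicat_real P s *\<^sub>R (1::real))"
    by (rule bounded_measurable_indicator[OF bounded_measurable_const P(1)])
  have \<tau>: "\<tau> t = measure lebesgue (P \<inter> {0..t})" if "0 \<le> t" for t
    unfolding \<tau>_def using prim_indicator_scaleR[OF P(1) that, of "1::real"] by simp
  have "\<exists>t. t \<in> {0..1} \<and> measure lebesgue (P \<inter> {0..t}) = real j * measure lebesgue P / real N" if j: "j \<le> N" for j
  proof -
    have P1: "P \<inter> {0..1} = P" using P(2) by blast
    have "\<exists>t\<ge>0. t \<le> 1 \<and> \<tau> t = real j * measure lebesgue P / real N"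
    proof (rule IVT')
      show "\<tau> 0 \<le> real j * measure lebesgue P / real N" by (simp add: \<tau>_def)
      have "real j * measure lebesgue P \<le> real N * measure lebesgue P"
        using j by (intro mult_right_mono) auto
      then show "real j * measure lebesgue P / real N \<le> \<tau> 1"
        using N \<tau>[of 1] P1 by (simp add: pos_divide_le_eq mult.commute)
      show "continuous_on {0..1} \<tau>" unfolding \<tau>_def by (rule continuous_on_prim[OF bm])
    qed simp
    then obtain t where t: "0 \<le> t" "t \<le> 1" "\<tau> t = real j * measure lebesgue P / real N" by blast
    then show ?thesis using \<tau>[OF t(1)] by (intro exI[of _ t]) simp
  qed
  then have "\<forall>j\<in>{..N}. \<exists>t. t \<in> {0..1} \<and> measure lebesgue (P \<inter> {0..t}) = real j * measure lebesgue P / real N"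
    by simp
  then have "\<exists>s. \<forall>j\<in>{..N}. s j \<in> {0..1} \<and> measure lebesgue (P \<inter> {0..s j}) = real j * measure lebesgue P / real N"
    by (rule bchoice)
  then obtain s where "\<forall>j\<in>{..N}. s j \<in> {0..1} \<and> measure lebesgue (P \<inter> {0..s j}) = real j * measure lebesgue P / real N"
    by (elim exE)
  then show thesis by (intro that[of s]) simp_all
qed

text \<open>Consecutive pieces of equal measure behave like consecutive intervals: while \<open>t\<close> runs through
the \<open>j\<close>-th piece, each earlier piece has contributed in full to the primitive and each later one
not at all; the contribution of the \<open>j\<close>-th piece itself is a multiple of \<open>x j\<close> and is
annihilated by pairing with \<open>x j\<close>.\<close>
lemma area_step_function:
  assumes P: "P \<in> sets lebesgue" "P \<subseteq> {0..1}" "0 < measure lebesgue P" and N: "0 < N"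
  shows "\<exists>Q :: nat \<Rightarrow> real set. (\<forall>j<N. Q j \<in> sets lebesgue \<and> Q j \<subseteq> P) \<and> disjoint_family_on Q {..<N} \<and>
    (\<forall>x :: nat \<Rightarrow> 'n::finite phase.
       area (\<lambda>t. \<Sum>j<N. indicator (Q j) t *\<^sub>R x j) (\<lambda>t. \<Sum>j<N. indicator (Q j) t *\<^sub>R x j) =
       (measure lebesgue P / real N)\<^sup>2 * (\<Sum>j<N. x j \<bullet> Jmap (\<Sum>k<j. x k)))"
proof -
  define m where "m = measure lebesgue P / real N"
  have m0: "0 < m" using P N by (simp add: m_def)
  obtain s where s: "\<And>j. j \<le> N \<Longrightarrow> s j \<in> {0..1}"
    "\<And>j. j \<le> N \<Longrightarrow> measure lebesgue (P \<inter> {0..s j}) = real j * measure lebesgue P / real N"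
    using split_into_consecutive_pieces[OF P(1,2) N] by blast
  have sm: "measure lebesgue (P \<inter> {0..s j}) = real j * m" if "j \<le> N" for j
    using s(2)[OF that] by (simp add: m_def)
  have lm: "P \<inter> {a..b} \<in> lmeasurable" for a b
    using P(1) by (intro bounded_set_imp_lmeasurable bounded_Int) auto
  have mono: "s j \<le> s k" if "j \<le> k" "k \<le> N" for j k
  proof (cases "j = k")
    case False
    show ?thesis
    proof (rule ccontr)
      assume "\<not> s j \<le> s k"
      then have "measure lebesgue (P \<inter> {0..s k}) \<le> measure lebesgue (P \<inter> {0..s j})"
        by (intro measure_mono_fmeasurable lm fmeasurableD) auto
      then have "real k * m \<le> real j * m" using sm[of j] sm[of k] that by simp
      then show False using m0 False that by simp
    qed
  qed simp
  define Q where "Q j = P \<inter> {s j<..s (Suc j)}" for j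
  have Qm: "Q j \<in> sets lebesgue" for j unfolding Q_def by (intro sets.Int P(1) sets_completionI_sets) simp
  have QP: "Q j \<subseteq> P" for j by (auto simp: Q_def)
  have lt: "t \<in> Q j \<Longrightarrow> t \<in> Q k \<Longrightarrow> j < k \<Longrightarrow> j < N \<Longrightarrow> k < N \<Longrightarrow> False" for t j k
    using mono[of "Suc j" k] by (auto simp: Q_def)
  have disj: "disjoint_family_on Q {..<N}"
    unfolding disjoint_family_on_def
  proof (intro ballI impI equals0I)
    fix j k t assume jk: "j \<in> {..<N}" "k \<in> {..<N}" "j \<noteq> k" and t: "t \<in> Q j \<inter> Q k"
    show False using lt[of t j k] lt[of t k j] jk t by (cases "j < k") auto
  qed
  have mQ: "measure lebesgue (Q j) = m" if j: "j < N" for j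
  proof -
    have "Q j = P \<inter> {0..s (Suc j)} - P \<inter> {0..s j}"
      using P(2) s(1)[of j] j by (auto simp: Q_def)
    moreover have "P \<inter> {0..s j} \<subseteq> P \<inter> {0..s (Suc j)}" using mono[of j "Suc j"] j by auto
    ultimately have "measure lebesgue (Q j) = measure lebesgue (P \<inter> {0..s (Suc j)}) - measure lebesgue (P \<inter> {0..s j})"
      using lm by (simp add: measurable_measure_Diff fmeasurableD)
    then show ?thesis using sm[of j] sm[of "Suc j"] j by (simp add: algebra_simps)
  qed
  have before: "measure lebesgue (Q k \<inter> {0..t}) = (if k < j then m else 0)"
    if k: "k < N" "k \<noteq> j" and j: "j < N" and t: "t \<in> Q j" for k j t
  proof (cases "k < j")
    case True
    have "Q k \<inter> {0..t} = Q k"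
    proof -
      have "s (Suc k) \<le> s j" using True j by (intro mono) auto
      then show ?thesis using t P(2) by (auto simp: Q_def)
    qed
    then show ?thesis using mQ k True by simp
  next
    case False
    have "Q k \<inter> {0..t} = {}"
    proof -
      have "s (Suc j) \<le> s k" using False k by (intro mono) auto
      then show ?thesis using t by (auto simp: Q_def)
    qed
    then show ?thesis using False by simp
  qed
  show ?thesis
  proof (intro exI[of _ Q] conjI allI impI Qm QP disj)
    fix x :: "nat \<Rightarrow> 'n phase"
    define \<phi> where "\<phi> t = (\<Sum>j<N. indicator (Q j) t *\<^sub>R x j)" for t
    have bmj: "bounded_measurable (\<lambda>t. indicator (Q j) t *\<^sub>R z)" for j and z :: "'n phase"
      by (rule bounded_measurable_indicator[OF bounded_measurable_const Qm])
    note ind = sum_indicator_disjoint[OF disj]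
    have ind0: "(\<Sum>j<N. indicat_real (Q j) t *\<^sub>R z j) = 0" if "\<And>j. j < N \<Longrightarrow> t \<notin> Q j" for t and z :: "nat \<Rightarrow> 'b::real_vector"
      by (rule sum.neutral) (use that in simp)
    have pr: "x j \<bullet> Jmap (prim \<phi> t) = m * (x j \<bullet> Jmap (\<Sum>k<j. x k))" if j: "j < N" and t: "t \<in> Q j" for j t
    proof -
      have t0: "0 \<le> t" using t P(2) by (auto simp: Q_def)
      have "prim \<phi> t = (\<Sum>k<N. measure lebesgue (Q k \<inter> {0..t}) *\<^sub>R x k)"
        unfolding \<phi>_def by (subst prim_sum) (simp_all add: bmj prim_indicator_scaleR[OF Qm t0])
      then have "x j \<bullet> Jmap (prim \<phi> t) = (\<Sum>k<N. measure lebesgue (Q k \<inter> {0..t}) * (x j \<bullet> Jmap (x k)))"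
        by (simp add: linear_sum[OF linear_Jmap] Jmap_simps inner_sum_right)
      also have "\<dots> = (\<Sum>k<N. if k < j then m * (x j \<bullet> Jmap (x k)) else 0)"
      proof (rule sum.cong)
        fix k assume "k \<in> {..<N}"
        then show "measure lebesgue (Q k \<inter> {0..t}) * (x j \<bullet> Jmap (x k)) = (if k < j then m * (x j \<bullet> Jmap (x k)) else 0)"
          using before[of k j t] j t by (cases "k = j") auto
      qed simp
      also have "\<dots> = (\<Sum>k<j. m * (x j \<bullet> Jmap (x k)))"
        using j by (intro sum.mono_neutral_cong_right) auto
      also have "\<dots> = m * (x j \<bullet> Jmap (\<Sum>k<j. x k))"
        by (simp add: linear_sum[OF linear_Jmap] inner_sum_right sum_distrib_left)
      finally show ?thesis .
    qed
    define y where "y j = m * (x j \<bullet> Jmap (\<Sum>k<j. x k))" for j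
    have eq: "\<phi> t \<bullet> Jmap (prim \<phi> t) = (\<Sum>j<N. indicat_real (Q j) t *\<^sub>R y j)" for t
    proof (cases "\<exists>j<N. t \<in> Q j")
      case True
      then obtain j where j: "j < N" "t \<in> Q j" by blast
      have "\<phi> t = x j" unfolding \<phi>_def by (rule ind[OF j])
      then show ?thesis using pr[OF j] ind[OF j, of y] by (simp add: y_def)
    next
      case False
      have "\<phi> t = 0" unfolding \<phi>_def by (rule ind0) (use False in blast)
      moreover have "(\<Sum>j<N. indicat_real (Q j) t *\<^sub>R y j) = 0" by (rule ind0) (use False in blast)
      ultimately show ?thesis by simp
    qed
    have "area \<phi> \<phi> = prim (\<lambda>t. \<Sum>j<N. indicat_real (Q j) t *\<^sub>R y j) 1"
      unfolding area_def eq by (simp only: prim_def)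
    also have "\<dots> = (\<Sum>j<N. measure lebesgue (Q j \<inter> {0..1}) *\<^sub>R y j)"
      by (subst prim_sum)
        (simp_all only: prim_indicator_scaleR[OF Qm zero_le_one] bounded_measurable_indicator[OF bounded_measurable_const Qm] finite_lessThan)
    also have "\<dots> = (\<Sum>j<N. m * y j)"
    proof (rule sum.cong)
      fix j assume j: "j \<in> {..<N}"
      have "Q j \<inter> {0..1} = Q j" using QP[of j] P(2) by blast
      then show "measure lebesgue (Q j \<inter> {0..1}) *\<^sub>R y j = m * y j" using mQ j by simp
    qed simp
    also have "\<dots> = m\<^sup>2 * (\<Sum>j<N. x j \<bullet> Jmap (\<Sum>k<j. x k))"
      by (simp add: y_def sum_distrib_left power2_eq_square mult.assoc)
    finally show "area (\<lambda>t. \<Sum>j<N. indicator (Q j) t *\<^sub>R x j) (\<lambda>t. \<Sum>j<N. indicator (Q j) t *\<^sub>R x j) =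
       (measure lebesgue P / real N)\<^sup>2 * (\<Sum>j<N. x j \<bullet> Jmap (\<Sum>k<j. x k))"
      by (simp add: \<phi>_def[abs_def] m_def)
  qed
qed

text \<open>Step velocities for a chain of parallelograms: the \<open>i\<close>-th one is traversed in the steps \<open>4 i\<close>
to \<open>4 i + 3\<close> and scaled by \<open>c i\<close>.\<close>
definition square_loop :: "(nat \<Rightarrow> real) \<Rightarrow> 'a::real_vector \<Rightarrow> 'a \<Rightarrow> nat \<Rightarrow> 'a" where
  "square_loop c a b j = c (j div 4) *\<^sub>R
     (if j mod 4 = 0 then a else if j mod 4 = 1 then b else if j mod 4 = 2 then - a else - b)"

text \<open>Each parallelogram closes up, so it contributes twice its own area and does not interact with
the others.\<close>
lemma square_loop_area:
  "(\<Sum>j<4*M. square_loop c a b j \<bullet> Jmap (\<Sum>k<j. square_loop c a b k)) = 2 * (b \<bullet> Jmap a) * (\<Sum>i<M. (c i)\<^sup>2) \<and>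
   (\<Sum>k<4*M. square_loop c a b k) = 0"
proof (induction M)
  case (Suc M)
  have 4: "4 * Suc M = Suc (Suc (Suc (Suc (4 * M))))" by simp
  have q: "square_loop c a b (4 * M) = c M *\<^sub>R a" "square_loop c a b (Suc (4 * M)) = c M *\<^sub>R b"
    "square_loop c a b (Suc (Suc (4 * M))) = - (c M *\<^sub>R a)" "square_loop c a b (Suc (Suc (Suc (4 * M)))) = - (c M *\<^sub>R b)"
  proof -
    have d: "(4 * M) div 4 = M" "Suc (4 * M) div 4 = M" "Suc (Suc (4 * M)) div 4 = M" "Suc (Suc (Suc (4 * M))) div 4 = M"
      "(4 * M) mod 4 = 0" "Suc (4 * M) mod 4 = 1" "Suc (Suc (4 * M)) mod 4 = 2" "Suc (Suc (Suc (4 * M))) mod 4 = 3"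
      by presburger+
    show "square_loop c a b (4 * M) = c M *\<^sub>R a" "square_loop c a b (Suc (4 * M)) = c M *\<^sub>R b"
      "square_loop c a b (Suc (Suc (4 * M))) = - (c M *\<^sub>R a)" "square_loop c a b (Suc (Suc (Suc (4 * M)))) = - (c M *\<^sub>R b)"
      unfolding square_loop_def d by simp_all
  qed
  have ab: "a \<bullet> Jmap b = - (b \<bullet> Jmap a)" by (metis Jmap_inner inner_commute)
  show ?case
    unfolding 4 sum.lessThan_Suc q using Suc.IH
    by (simp add: Jmap_simps inner_add_right ab power2_eq_square algebra_simps)
qed simp

text \<open>The relation is divided by its largest coefficient, which leaves no coefficient above 1 in
absolute value and one that is 1 in absolute value.\<close>
lemma exists_linear_relation:
  fixes e :: "nat \<Rightarrow> 'a::euclidean_space"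
  assumes M: "DIM('a) < M"
  obtains c where "(\<Sum>i<M. c i *\<^sub>R e i) = 0" "\<And>i. i < M \<Longrightarrow> \<bar>c i\<bar> \<le> 1" "1 \<le> (\<Sum>i<M. (c i)\<^sup>2)"
proof -
  have "\<exists>c. (\<Sum>i<M. c i *\<^sub>R e i) = 0 \<and> (\<exists>i<M. c i \<noteq> 0)"
  proof (cases "inj_on e {..<M}")
    case True
    then have "card (e ` {..<M}) = M" by (simp add: card_image)
    then have "dependent (e ` {..<M})" using M dependent_biggerset[of "e ` {..<M}"] by simp
    then obtain u where u: "\<exists>v\<in>e ` {..<M}. u v \<noteq> 0" "(\<Sum>v\<in>e ` {..<M}. u v *\<^sub>R v) = 0"
      using dependent_finite[of "e ` {..<M}"] by auto
    have "(\<Sum>i<M. u (e i) *\<^sub>R e i) = 0" using u(2) by (simp add: sum.reindex[OF True])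
    then show ?thesis using u(1) by (intro exI[of _ "\<lambda>i. u (e i)"]) auto
  next
    case False
    then obtain i j where ij: "i < M" "j < M" "i \<noteq> j" "e i = e j" unfolding inj_on_def by auto
    define c where "c k = (if k = i then 1 else if k = j then -1 else 0 :: real)" for k
    have "(\<Sum>k<M. c k *\<^sub>R e k) = (\<Sum>k\<in>{i, j}. c k *\<^sub>R e k)"
      by (rule sum.mono_neutral_right) (use ij in \<open>auto simp: c_def\<close>)
    also have "\<dots> = 0" using ij by (simp add: c_def)
    finally show ?thesis using ij by (intro exI[of _ c] conjI exI[of _ i]) (auto simp: c_def)
  qed
  then obtain c i where c: "(\<Sum>i<M. c i *\<^sub>R e i) = 0" and i: "i < M" "c i \<noteq> 0" by blast
  define m where "m = Max ((\<lambda>i. \<bar>c i\<bar>) ` {..<M})"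
  have mge: "\<bar>c j\<bar> \<le> m" if "j < M" for j unfolding m_def using that by (intro Max_ge) auto
  have m0: "0 < m" using mge[OF i(1)] i(2) by simp
  have "m \<in> (\<lambda>i. \<bar>c i\<bar>) ` {..<M}" unfolding m_def using i by (intro Max_in) auto
  then obtain k where k: "k < M" "\<bar>c k\<bar> = m" by auto
  show thesis
  proof (rule that[of "\<lambda>i. c i / m"])
    have "(\<Sum>i<M. (c i / m) *\<^sub>R e i) = (1 / m) *\<^sub>R (\<Sum>i<M. c i *\<^sub>R e i)"
      by (simp add: scaleR_sum_right)
    then show "(\<Sum>i<M. (c i / m) *\<^sub>R e i) = 0" using c by simp
    show "\<bar>c i / m\<bar> \<le> 1" if "i < M" for i using mge[OF that] m0 by simp
    have "(c k / m)\<^sup>2 = 1" using k(2) m0 by (metis abs_divide abs_of_pos divide_self less_numeral_extra(3) power2_abs power_one)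
    moreover have "(c k / m)\<^sup>2 \<le> (\<Sum>i<M. (c i / m)\<^sup>2)" using k(1) by (intro member_le_sum) auto
    ultimately show "1 \<le> (\<Sum>i<M. (c i / m)\<^sup>2)" by simp
  qed
qed

text \<open>On \<open>P\<close> the fields are nearly constant. With the constant vectors \<open>a\<close> and \<open>b\<close> in their place,
any combination \<open>c\<close> of \<open>DIM + 1\<close> consecutive parallelograms is closed and has action
proportional to \<open>\<Sum>c i\<^sup>2\<close> and to the square of the measure of \<open>P\<close>. With the true fields, the
combination \<open>c\<close> is chosen such that the total displacement vanishes. The error in the action is
of order \<open>\<delta>\<close> times the square of the measure of \<open>P\<close>, so that the bound on \<open>\<delta>\<close> needed to keep the
action positive does not depend on the measure of \<open>P\<close>.\<close>
lemma exists_positive_variation: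
  fixes \<alpha> \<beta> :: "real \<Rightarrow> 'n::finite phase"
  assumes P: "P \<in> sets lebesgue" "P \<subseteq> {0..1}" "0 < measure lebesgue P"
    and bm: "bounded_measurable \<alpha>" "bounded_measurable \<beta>"
    and near: "\<And>t. t \<in> P \<Longrightarrow> norm (\<alpha> t - a) \<le> \<delta>" "\<And>t. t \<in> P \<Longrightarrow> norm (\<beta> t - b) \<le> \<delta>"
    and R: "norm a \<le> R" "norm b \<le> R" "0 \<le> \<delta>"
    and small: "8 * (real (DIM('n phase) + 1))\<^sup>2 * (\<delta> * (2 * R + \<delta>)) < b \<bullet> Jmap a"
  shows "\<exists>\<phi>. bounded_measurable \<phi> \<and> prim \<phi> 1 = 0 \<and> 0 < area \<phi> \<phi> \<and> (\<forall>t. t \<notin> P \<longrightarrow> \<phi> t = 0) \<and>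
    (\<forall>t. \<exists>\<sigma>. \<bar>\<sigma>\<bar> \<le> 1 \<and> (\<phi> t = \<sigma> *\<^sub>R \<alpha> t \<or> \<phi> t = \<sigma> *\<^sub>R \<beta> t))"
proof -
  \<comment> \<open>One parallelogram more than there are conditions for closing up; each one takes four pieces.\<close>
  define M where "M = DIM('n phase) + 1"
  define N where "N = 4 * M"
  have N0: "0 < N" by (simp add: N_def M_def)
  obtain Q where Q': "\<forall>j<N. Q j \<in> sets lebesgue \<and> Q j \<subseteq> P" "disjoint_family_on Q {..<N}"
    "\<forall>x :: nat \<Rightarrow> 'n phase.
       area (\<lambda>t. \<Sum>j<N. indicator (Q j) t *\<^sub>R x j) (\<lambda>t. \<Sum>j<N. indicator (Q j) t *\<^sub>R x j) =
       (measure lebesgue P / real N)\<^sup>2 * (\<Sum>j<N. x j \<bullet> Jmap (\<Sum>k<j. x k))"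
    using area_step_function[OF P N0, where 'n = 'n] by (elim exE conjE)
  have Q1: "Q j \<in> sets lebesgue" and Q2: "Q j \<subseteq> P" if "j < N" for j using Q'(1) that by blast+
  note Q = Q1 Q2 Q'(2) Q'(3)[rule_format]
  define \<psi> where "\<psi> c t = (\<Sum>j<N. indicator (Q j) t *\<^sub>R square_loop c (\<alpha> t) (\<beta> t) j)" for c :: "nat \<Rightarrow> real" and t
  define \<psi>0 where "\<psi>0 c t = (\<Sum>j<N. indicator (Q j) t *\<^sub>R square_loop c a b j)" for c :: "nat \<Rightarrow> real" and t
  have bsq: "bounded_measurable (\<lambda>t. square_loop c (f t) (g t) j)"
    if f: "bounded_measurable f" and g: "bounded_measurable g" for c j and f g :: "real \<Rightarrow> 'n phase"
  proof -
    have "bounded_measurable (\<lambda>t. - f t)" "bounded_measurable (\<lambda>t. - g t)"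
      using bounded_measurable_scaleR[OF f, of "-1"] bounded_measurable_scaleR[OF g, of "-1"] by simp_all
    with f g have "bounded_measurable (\<lambda>t. if j mod 4 = 0 then f t else if j mod 4 = 1 then g t
        else if j mod 4 = 2 then - f t else - g t)"
      by (cases "j mod 4 = 0"; cases "j mod 4 = 1"; cases "j mod 4 = 2") simp_all
    then show ?thesis unfolding square_loop_def by (rule bounded_measurable_scaleR)
  qed
  have b\<psi>: "bounded_measurable (\<psi> c)" for c
    unfolding \<psi>_def by (intro bounded_measurable_sum bounded_measurable_indicator bsq bm Q(1)) simp
  have b\<psi>0: "bounded_measurable (\<psi>0 c)" for c
    unfolding \<psi>0_def by (intro bounded_measurable_sum bounded_measurable_indicator bsq bounded_measurable_const Q(1)) simp
  note pick = sum_indicator_disjoint[OF Q(3)]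
  have pick0: "(\<Sum>j<N. indicat_real (Q j) t *\<^sub>R z j) = 0" if "\<And>j. j < N \<Longrightarrow> t \<notin> Q j" for t and z :: "nat \<Rightarrow> 'n phase"
    by (rule sum.neutral) (use that in simp)
  define e where "e i = prim (\<psi> (\<lambda>k. if k = i then 1 else 0)) 1" for i
  obtain c where c: "(\<Sum>i<M. c i *\<^sub>R e i) = 0" "\<And>i. i < M \<Longrightarrow> \<bar>c i\<bar> \<le> 1" "1 \<le> (\<Sum>i<M. (c i)\<^sup>2)"
    using exists_linear_relation[of M e] by (auto simp: M_def)
  have lin: "\<psi> c t = (\<Sum>i<M. c i *\<^sub>R \<psi> (\<lambda>k. if k = i then 1 else 0) t)" for t
  proof (cases "\<exists>j<N. t \<in> Q j")
    case True
    then obtain j where j: "j < N" "t \<in> Q j" by blast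
    define v where "v = square_loop (\<lambda>_. 1) (\<alpha> t) (\<beta> t) j"
    have sq: "square_loop d (\<alpha> t) (\<beta> t) j = d (j div 4) *\<^sub>R v" for d
      by (simp add: square_loop_def v_def)
    have jd: "j div 4 < M" using j(1) by (simp add: N_def)
    have "(\<Sum>i<M. c i *\<^sub>R \<psi> (\<lambda>k. if k = i then 1 else 0) t) = (\<Sum>i<M. if i = j div 4 then c (j div 4) *\<^sub>R v else 0)"
      unfolding \<psi>_def pick[OF j] sq by (intro sum.cong) auto
    also have "\<dots> = c (j div 4) *\<^sub>R v" using jd by simp
    finally show ?thesis unfolding \<psi>_def pick[OF j] sq by simp
  next
    case False
    then have "\<And>j. j < N \<Longrightarrow> t \<notin> Q j" by blast
    then show ?thesis unfolding \<psi>_def by (simp add: pick0)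
  qed
  have p0: "prim (\<psi> c) 1 = 0"
  proof -
    have "\<psi> c = (\<lambda>t. \<Sum>i<M. c i *\<^sub>R \<psi> (\<lambda>k. if k = i then 1 else 0) t)" using lin by blast
    then have "prim (\<psi> c) 1 = (\<Sum>i<M. prim (\<lambda>t. c i *\<^sub>R \<psi> (\<lambda>k. if k = i then 1 else 0) t) 1)"
      by (simp only: prim_sum[OF finite_lessThan bounded_measurable_scaleR[OF b\<psi>]])
    then show ?thesis using c(1) by (simp add: prim_scaleR e_def)
  qed
  define T where "T = measure lebesgue P"
  have T0: "0 < T" using P(3) by (simp add: T_def)
  define \<kappa> where "\<kappa> = b \<bullet> Jmap a"
  have a0: "area (\<psi>0 c) (\<psi>0 c) \<ge> (T / real N)\<^sup>2 * (2 * \<kappa>)"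
  proof -
    have "0 \<le> R" using R(1) norm_ge_zero order_trans by blast
    then have "0 \<le> \<delta> * (2 * R + \<delta>)" using R(3) by simp
    then have "0 \<le> 8 * (real (DIM('n phase) + 1))\<^sup>2 * (\<delta> * (2 * R + \<delta>))"
      by (intro mult_nonneg_nonneg[of "8 * _"]) auto
    then have "0 < \<kappa>" using small unfolding \<kappa>_def by linarith
    then have "2 * \<kappa> * 1 \<le> 2 * \<kappa> * (\<Sum>i<M. (c i)\<^sup>2)" using c(3) by (intro mult_left_mono) auto
    moreover have "area (\<psi>0 c) (\<psi>0 c) = (T / real N)\<^sup>2 * (2 * \<kappa> * (\<Sum>i<M. (c i)\<^sup>2))"
      unfolding \<psi>0_def[abs_def] Q(4) using square_loop_area[of c a b M] by (simp add: N_def T_def \<kappa>_def)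
    ultimately show ?thesis by (simp add: mult_left_mono)
  qed
  define r where "r t = \<psi> c t - \<psi>0 c t" for t
  have br: "bounded_measurable r" unfolding r_def[abs_def] by (rule bounded_measurable_diff[OF b\<psi> b\<psi>0])
  have cj: "\<bar>c (j div 4)\<bar> \<le> 1" if "j < N" for j using c(2) that by (simp add: N_def)
  have pw: "norm (r t) \<le> indicator P t * \<delta>" "norm (\<psi>0 c t) \<le> indicator P t * R" "norm (\<psi> c t) \<le> indicator P t * (R + \<delta>)" for t
  proof -
    have "norm (r t) \<le> indicator P t * \<delta> \<and> norm (\<psi>0 c t) \<le> indicator P t * R"
    proof (cases "\<exists>j<N. t \<in> Q j")
      case True
      then obtain j where j: "j < N" "t \<in> Q j" by blast
      have t: "t \<in> P" using Q(2) j by blast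
      have "r t = c (j div 4) *\<^sub>R square_loop (\<lambda>_. 1) (\<alpha> t - a) (\<beta> t - b) j"
        unfolding r_def \<psi>_def \<psi>0_def pick[OF j] by (simp add: square_loop_def algebra_simps)
      moreover have "norm (square_loop (\<lambda>_. 1) (\<alpha> t - a) (\<beta> t - b) j) \<le> \<delta>"
        using near[OF t] by (simp add: square_loop_def norm_minus_commute)
      moreover have "\<psi>0 c t = c (j div 4) *\<^sub>R square_loop (\<lambda>_. 1) a b j"
        unfolding \<psi>0_def pick[OF j] by (simp add: square_loop_def)
      moreover have "norm (square_loop (\<lambda>_. 1) a b j) \<le> R"
        using R by (simp add: square_loop_def)
      moreover have "\<bar>c (j div 4)\<bar> * x \<le> 1 * y" if "0 \<le> x" "x \<le> y" for x y :: real
        by (rule mult_mono) (use cj[OF j(1)] that in auto)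
      ultimately show ?thesis using t by simp
    next
      case False
      then have F: "\<And>j. j < N \<Longrightarrow> t \<notin> Q j" by blast
      have R0: "0 \<le> R" using R(1) norm_ge_zero order_trans by blast
      have 1: "\<psi> c t = 0" unfolding \<psi>_def by (rule pick0[OF F])
      have 2: "\<psi>0 c t = 0" unfolding \<psi>0_def by (rule pick0[OF F])
      have "r t = 0" "\<psi>0 c t = 0" by (simp_all add: r_def 1 2)
      then show ?thesis using R(3) R0 by simp
    qed
    moreover have "\<psi> c t = r t + \<psi>0 c t" by (simp add: r_def)
    moreover have "norm (r t + \<psi>0 c t) \<le> norm (r t) + norm (\<psi>0 c t)" by (rule norm_triangle_ineq)
    ultimately show "norm (r t) \<le> indicator P t * \<delta>" "norm (\<psi>0 c t) \<le> indicator P t * R" "norm (\<psi> c t) \<le> indicator P t * (R + \<delta>)"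
      by (auto simp: algebra_simps)
  qed
  have L1: "integral {0..t} (\<lambda>t. norm (f t)) \<le> T * E"
    if f: "bounded_measurable f" and le: "\<And>t. norm (f t) \<le> indicator P t * E" and t: "t \<in> {0..1}" and E: "0 \<le> E"
    for f :: "real \<Rightarrow> 'n phase" and E t
  proof -
    have bi: "bounded_measurable (\<lambda>t. indicat_real P t *\<^sub>R E)"
      by (rule bounded_measurable_indicator[OF bounded_measurable_const P(1)])
    have "integral {0..t} (\<lambda>t. norm (f t)) \<le> prim (\<lambda>t. indicat_real P t *\<^sub>R E) t"
      unfolding prim_def
      by (intro integral_le bounded_measurable_integrable_on bounded_measurable_norm f bi) (use le in simp)
    also have "\<dots> = measure lebesgue (P \<inter> {0..t}) * E"
      using prim_indicator_scaleR[OF P(1), of t E] t by simp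
    also have "\<dots> \<le> T * E"
    proof (rule mult_right_mono[OF _ E])
      have "P \<in> lmeasurable" using P(1,2) by (intro bounded_set_imp_lmeasurable) (auto intro: bounded_subset[OF bounded_closed_interval])
      then show "measure lebesgue (P \<inter> {0..t}) \<le> T"
        unfolding T_def by (intro measure_mono_fmeasurable) (auto simp: P(1))
    qed
    finally show ?thesis .
  qed
  have prim_le: "norm (prim f t) \<le> T * E"
    if f: "bounded_measurable f" and le: "\<And>t. norm (f t) \<le> indicator P t * E" and t: "t \<in> {0..1}" and E: "0 \<le> E"
    for f :: "real \<Rightarrow> 'n phase" and E t
  proof -
    have "norm (prim f t) \<le> integral {0..t} (\<lambda>t. norm (f t))"
      unfolding prim_def
      by (intro integral_norm_bound_integral bounded_measurable_integrable_on bounded_measurable_norm f) simp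
    also have "\<dots> \<le> T * E" by (rule L1[OF f le t E])
    finally show ?thesis .
  qed
  have area_le: "\<bar>area f g\<bar> \<le> (T * E) * (T * F)"
    if "bounded_measurable f" "\<And>t. norm (f t) \<le> indicator P t * E" "0 \<le> E"
      "bounded_measurable g" "\<And>t. norm (g t) \<le> indicator P t * F" "0 \<le> F"
    for f g :: "real \<Rightarrow> 'n phase" and E F
  proof -
    have "\<bar>area f g\<bar> \<le> integral {0..1} (\<lambda>t. norm (f t)) * (T * F)"
      by (rule abs_area_le[OF that(1,4)]) (rule prim_le[OF that(4,5) _ that(6)])
    also have "\<dots> \<le> (T * E) * (T * F)"
      using L1[OF that(1,2) _ that(3), of 1] that(6) T0 by (intro mult_right_mono) auto
    finally show ?thesis .
  qed
  have R0: "0 \<le> R" using R(1) norm_ge_zero order_trans by blast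
  have "area (\<psi> c) (\<psi> c) = area r (\<psi> c) + area (\<psi>0 c) r + area (\<psi>0 c) (\<psi>0 c)"
    using area_diff_left[OF b\<psi> b\<psi>0 b\<psi>, of c c c] area_diff_right[OF b\<psi>0 b\<psi> b\<psi>0, of c c c]
    by (simp add: r_def[abs_def])
  moreover have "\<bar>area r (\<psi> c)\<bar> \<le> (T * \<delta>) * (T * (R + \<delta>))"
    by (rule area_le[OF br pw(1) R(3) b\<psi> pw(3)]) (use R0 R(3) in simp)
  moreover have "\<bar>area (\<psi>0 c) r\<bar> \<le> (T * R) * (T * \<delta>)"
    by (rule area_le[OF b\<psi>0 pw(2) R0 br pw(1) R(3)])
  moreover have "(T * \<delta>) * (T * (R + \<delta>)) + (T * R) * (T * \<delta>) < (T / real N)\<^sup>2 * (2 * \<kappa>)"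
  proof -
    have "(T * \<delta>) * (T * (R + \<delta>)) + (T * R) * (T * \<delta>) = (T / real N)\<^sup>2 * (2 * (8 * (real M)\<^sup>2 * (\<delta> * (2 * R + \<delta>))))"
      using N0 by (simp add: N_def power2_eq_square field_simps)
    also have "\<dots> < (T / real N)\<^sup>2 * (2 * \<kappa>)"
      using small T0 N0 by (intro mult_strict_left_mono) (simp_all add: M_def \<kappa>_def)
    finally show ?thesis .
  qed
  ultimately have pos: "0 < area (\<psi> c) (\<psi> c)" using a0 by linarith
  show ?thesis
  proof (intro exI[of _ "\<psi> c"] conjI allI impI b\<psi> p0 pos)
    show "\<psi> c t = 0" if "t \<notin> P" for t
      unfolding \<psi>_def by (rule pick0) (use Q(2) that in blast)
    show "\<exists>\<sigma>. \<bar>\<sigma>\<bar> \<le> 1 \<and> (\<psi> c t = \<sigma> *\<^sub>R \<alpha> t \<or> \<psi> c t = \<sigma> *\<^sub>R \<beta> t)" for t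
    proof (cases "\<exists>j<N. t \<in> Q j")
      case True
      then obtain j where j: "j < N" "t \<in> Q j" by blast
      have *: "\<psi> c t = square_loop c (\<alpha> t) (\<beta> t) j" unfolding \<psi>_def by (rule pick[OF j])
      consider "j mod 4 = 0" | "j mod 4 = 1" | "j mod 4 = 2" | "j mod 4 = 3" by linarith
      then show ?thesis
      proof cases
        case 1 then show ?thesis using * cj[OF j(1)] by (intro exI[of _ "c (j div 4)"]) (simp add: square_loop_def)
      next
        case 2 then show ?thesis using * cj[OF j(1)] by (intro exI[of _ "c (j div 4)"]) (simp add: square_loop_def)
      next
        case 3 then show ?thesis using * cj[OF j(1)] by (intro exI[of _ "- c (j div 4)"]) (simp add: square_loop_def)
      next
        case 4 then show ?thesis using * cj[OF j(1)] by (intro exI[of _ "- c (j div 4)"]) (simp add: square_loop_def)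
      qed
    next
      case False
      then have "\<psi> c t = 0" unfolding \<psi>_def by (intro pick0) blast
      then show ?thesis by (intro exI[of _ 0]) simp
    qed
  qed
qed

section \<open>Measurable selection of directions in the normal cone\<close>

text \<open>The squared distance to a convex set is differentiable; its gradient at \<open>c\<close> is twice the vector
from the nearest point to \<open>c\<close>.\<close>
lemma closest_point_dist_sq_expansion:
  fixes S :: "'a::euclidean_space set"
  assumes S: "closed S" "convex S" "S \<noteq> {}"
  shows "\<bar>(dist (c + h) (closest_point S (c + h)))\<^sup>2 - (dist c (closest_point S c))\<^sup>2
      - 2 * ((c - closest_point S c) \<bullet> h)\<bar> \<le> (norm h)\<^sup>2"
proof -
  let ?p = "closest_point S c" and ?q = "closest_point S (c + h)"
  have pS: "?p \<in> S" "?q \<in> S" using closest_point_in_set[OF S(1,3)] by auto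
  have "(dist (c + h) ?q)\<^sup>2 \<le> (dist (c + h) ?p)\<^sup>2"
    by (intro power_mono closest_point_le S(1) pS) simp
  moreover have "(dist (c + h) ?p)\<^sup>2 = (dist c ?p)\<^sup>2 + 2 * ((c - ?p) \<bullet> h) + (norm h)\<^sup>2"
    by (simp add: dist_norm power2_norm_eq_inner inner_simps inner_commute algebra_simps)
  moreover have "(dist c ?p)\<^sup>2 \<le> (dist c ?q)\<^sup>2"
    by (intro power_mono closest_point_le S(1) pS) simp
  moreover have "(dist c ?q)\<^sup>2 = (dist (c + h) ?q)\<^sup>2 - 2 * ((c - ?p) \<bullet> h) - (norm h)\<^sup>2 + 2 * ((?q - ?p) \<bullet> h)"
    by (simp add: dist_norm power2_norm_eq_inner inner_simps inner_commute algebra_simps)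
  moreover have "(?q - ?p) \<bullet> h \<le> (norm h)\<^sup>2"
  proof -
    have "(?q - ?p) \<bullet> h \<le> norm (?q - ?p) * norm h" by (rule norm_cauchy_schwarz)
    also have "\<dots> \<le> norm h * norm h"
    proof (rule mult_right_mono)
      have "dist ?q ?p \<le> dist (c + h) c" by (rule closest_point_lipschitz[OF S(2,1,3)])
      then show "norm (?q - ?p) \<le> norm h" by (simp add: dist_norm)
    qed simp
    finally show ?thesis by (simp add: power2_eq_square)
  qed
  ultimately show ?thesis by (simp add: abs_le_iff)
qed

text \<open>The distance to \<open>D z\<close> is lower semicontinuous in \<open>z\<close> because the graph is closed and balls are
compact. The nearest point is then measurable, being determined by the gradient of the squared
distance.\<close>
lemma closest_point_measurable:
  fixes D :: "'b::euclidean_space \<Rightarrow> 'a::euclidean_space set"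
  assumes graph: "closed {(z, a). a \<in> D z}" and D: "\<And>z. convex (D z)" "\<And>z. D z \<noteq> {}"
  shows "(\<lambda>z. closest_point (D z) c) \<in> borel_measurable borel"
proof -
  have cl: "closed (D z)" for z
  proof -
    have "D z = Pair z -` {(z, a). a \<in> D z}" by auto
    also have "closed \<dots>" by (intro continuous_closed_vimage graph continuous_intros)
    finally show ?thesis .
  qed
  define d where "d c z = dist c (closest_point (D z) c)" for c z
  have dm: "d c \<in> borel_measurable borel" for c
    unfolding borel_measurable_iff_le
  proof (intro allI)
    fix r
    have "{z. d c z \<le> r} = {z. \<exists>a. a \<in> cball c r \<and> (z, a) \<in> {(z, a). a \<in> D z}}"
    proof (intro set_eqI iffI)
      fix z assume "z \<in> {z. d c z \<le> r}"
      then show "z \<in> {z. \<exists>a. a \<in> cball c r \<and> (z, a) \<in> {(z, a). a \<in> D z}}"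
        using closest_point_in_set[OF cl D(2), of z c] by (auto simp: d_def)
    next
      fix z assume "z \<in> {z. \<exists>a. a \<in> cball c r \<and> (z, a) \<in> {(z, a). a \<in> D z}}"
      then obtain a where a: "dist c a \<le> r" "a \<in> D z" by auto
      then show "z \<in> {z. d c z \<le> r}" using closest_point_le[OF cl a(2), of c] by (simp add: d_def)
    qed
    also have "closed \<dots>"
    proof -
      have "{(a, z). a \<in> D z} = (\<lambda>p. (snd p, fst p)) -` {(z, a). a \<in> D z}" by auto
      then have "closed {(a, z). a \<in> D z}"
        using continuous_closed_vimage[OF graph, of "\<lambda>p. (snd p, fst p)"] by (simp add: continuous_intros)
      from closed_compact_projection[OF compact_cball[of c r] this]
      show ?thesis by simp
    qed
    finally show "{w \<in> space borel. d c w \<le> r} \<in> sets borel" by simp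
  qed
  have "(\<lambda>z. closest_point (D z) c \<bullet> i) \<in> borel_measurable borel" if i: "i \<in> Basis" for i
  proof (rule borel_measurable_LIMSEQ_real)
    define q where "q n z = c \<bullet> i - (real (Suc n) / 2) * ((d (c + (1 / real (Suc n)) *\<^sub>R i) z)\<^sup>2 - (d c z)\<^sup>2)" for n z
    show "q n \<in> borel_measurable borel" for n unfolding q_def using dm by measurable
    show "(\<lambda>n. q n z) \<longlonglongrightarrow> closest_point (D z) c \<bullet> i" for z
    proof (rule LIMSEQ_I)
      fix e :: real assume e: "0 < e"
      obtain N where N: "1 / real (Suc N) < e" using nat_approx_posE[OF e] by blast
      show "\<exists>no. \<forall>n\<ge>no. norm (q n z - closest_point (D z) c \<bullet> i) < e"
      proof (intro exI[of _ N] allI impI)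
        fix n assume n: "N \<le> n"
        define s where "s = real (Suc n)"
        have s0: "0 < s" by (simp add: s_def)
        define X where "X = (d (c + (1 / s) *\<^sub>R i) z)\<^sup>2 - (d c z)\<^sup>2"
        have "\<bar>X - 2 * ((c - closest_point (D z) c) \<bullet> ((1 / s) *\<^sub>R i))\<bar> \<le> (norm ((1 / s) *\<^sub>R i))\<^sup>2"
          using closest_point_dist_sq_expansion[OF cl D(1) D(2), of c "(1 / s) *\<^sub>R i" z] by (simp add: d_def X_def)
        then have 1: "\<bar>X - 2 * ((c - closest_point (D z) c) \<bullet> i) / s\<bar> \<le> (1 / s)\<^sup>2"
          using i s0 by simp
        have "q n z - closest_point (D z) c \<bullet> i = (c - closest_point (D z) c) \<bullet> i - (s / 2) * X"
          by (simp add: q_def X_def s_def inner_diff_left)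
        also have "\<dots> = - (s / 2) * (X - 2 * ((c - closest_point (D z) c) \<bullet> i) / s)"
          using s0 by (simp add: right_diff_distrib)
        finally have "q n z - closest_point (D z) c \<bullet> i = - (s / 2) * (X - 2 * ((c - closest_point (D z) c) \<bullet> i) / s)" .
        then have "\<bar>q n z - closest_point (D z) c \<bullet> i\<bar> = (s / 2) * \<bar>X - 2 * ((c - closest_point (D z) c) \<bullet> i) / s\<bar>"
          using s0 by (simp add: abs_mult)
        also have "\<dots> \<le> (s / 2) * (1 / s)\<^sup>2" using 1 s0 by (intro mult_left_mono) auto
        also have "\<dots> \<le> 1 / s" using s0 by (simp add: power2_eq_square divide_simps)
        also have "\<dots> \<le> 1 / real (Suc N)" using n by (simp add: s_def frac_le)
        also have "\<dots> < e" by (rule N)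
        finally show "norm (q n z - closest_point (D z) c \<bullet> i) < e" by simp
      qed
    qed
  qed
  then show ?thesis by (subst borel_measurable_euclidean_space) blast
qed

text \<open>The directions in which a normal \<open>w\<close> at \<open>x\<close> can be moved by a full unit both ways inside the
normal cone without changing its pairing with \<open>x\<close>; here \<open>z = (x, w)\<close>. Inserting 0 keeps the set
nonempty when \<open>w\<close> is not a normal at \<open>x\<close>, and it changes nothing when it is.\<close>
definition swing :: "'a::euclidean_space set \<Rightarrow> 'a \<times> 'a \<Rightarrow> 'a set" where
  "swing K z = insert 0 {a. snd z + a \<in> normal_cone K (fst z) \<and> snd z - a \<in> normal_cone K (fst z) \<and> a \<bullet> fst z = 0}"

lemma normal_cone_add: "v \<in> normal_cone K x \<Longrightarrow> w \<in> normal_cone K x \<Longrightarrow> v + w \<in> normal_cone K x"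
  by (simp add: normal_cone_def inner_add_left)

lemma normal_cone_scale: "v \<in> normal_cone K x \<Longrightarrow> 0 \<le> c \<Longrightarrow> c *\<^sub>R v \<in> normal_cone K x"
  by (simp add: normal_cone_def)

lemma zero_in_normal_cone[simp]: "0 \<in> normal_cone K x"
  by (simp add: normal_cone_def)

lemma convex_normal_cone: "convex (normal_cone K x)"
  by (rule convexI) (simp add: normal_cone_add normal_cone_scale)

lemma swing_iff:
  assumes "w \<in> normal_cone K x"
  shows "a \<in> swing K (x, w) \<longleftrightarrow> w + a \<in> normal_cone K x \<and> w - a \<in> normal_cone K x \<and> a \<bullet> x = 0"
  using assms by (auto simp: swing_def)

lemma swing_scale:
  assumes "w \<in> normal_cone K x" "a \<in> swing K (x, w)" "\<bar>s\<bar> \<le> 1"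
  shows "s *\<^sub>R a \<in> swing K (x, w)"
proof -
  have a: "w + a \<in> normal_cone K x" "w - a \<in> normal_cone K x" "a \<bullet> x = 0"
    using assms(2) swing_iff[OF assms(1)] by blast+
  have 1: "w + s *\<^sub>R a = ((1 + s) / 2) *\<^sub>R (w + a) + ((1 - s) / 2) *\<^sub>R (w - a)"
    by (simp add: algebra_simps flip: scaleR_add_left) (simp add: scaleR_add_left[symmetric] field_simps)
  have 2: "w - s *\<^sub>R a = ((1 - s) / 2) *\<^sub>R (w + a) + ((1 + s) / 2) *\<^sub>R (w - a)"
    by (simp add: algebra_simps flip: scaleR_add_left) (simp add: scaleR_add_left[symmetric] field_simps)
  have "w + s *\<^sub>R a \<in> normal_cone K x" "w - s *\<^sub>R a \<in> normal_cone K x"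
    unfolding 1 2 using assms(3) by (intro normal_cone_add normal_cone_scale a; simp)+
  then show ?thesis using swing_iff[OF assms(1)] a(3) by simp
qed

lemma swing_convex: "convex (swing K z)"
proof (cases "snd z \<in> normal_cone K (fst z)")
  case True
  show ?thesis
  proof (rule convexI)
    fix a b and u v :: real assume ab: "a \<in> swing K z" "b \<in> swing K z" and uv: "0 \<le> u" "0 \<le> v" "u + v = 1"
    have i: "c \<in> swing K z \<longleftrightarrow> snd z + c \<in> normal_cone K (fst z) \<and> snd z - c \<in> normal_cone K (fst z) \<and> c \<bullet> fst z = 0" for c
      using swing_iff[OF True, of c] by simp
    have w: "snd z = u *\<^sub>R snd z + v *\<^sub>R snd z" using uv(3) by (metis scaleR_add_left scaleR_one)
    have "snd z + (u *\<^sub>R a + v *\<^sub>R b) = u *\<^sub>R (snd z + a) + v *\<^sub>R (snd z + b)"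
      by (subst w) (simp add: scaleR_add_right)
    moreover have "snd z - (u *\<^sub>R a + v *\<^sub>R b) = u *\<^sub>R (snd z - a) + v *\<^sub>R (snd z - b)"
      by (subst w) (simp add: scaleR_diff_right)
    ultimately show "u *\<^sub>R a + v *\<^sub>R b \<in> swing K z"
      using ab uv unfolding i by (simp add: normal_cone_add normal_cone_scale inner_add_left)
  qed
next
  case False
  have "swing K z = {0}"
  proof -
    have "a = 0" if "a \<in> swing K z" for a
    proof (rule ccontr)
      assume "a \<noteq> 0"
      then have "snd z + a \<in> normal_cone K (fst z)" "snd z - a \<in> normal_cone K (fst z)" using that by (auto simp: swing_def)
      from normal_cone_scale[OF normal_cone_add[OF this], of "1/2"]
      have "(1/2) *\<^sub>R ((snd z + a) + (snd z - a)) \<in> normal_cone K (fst z)" by simp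
      then show False using False by (simp flip: scaleR_2)
    qed
    then show ?thesis by (auto simp: swing_def)
  qed
  then show ?thesis by simp
qed

lemma swing_graph_closed: "closed {(z, a). a \<in> swing K z}"
proof -
  have "{(z, a). a \<in> swing K z} = {p. snd p = 0} \<union>
      ((\<Inter>y\<in>K. {p. 0 \<le> (snd (fst p) + snd p) \<bullet> (fst (fst p) - y)}) \<inter>
       (\<Inter>y\<in>K. {p. 0 \<le> (snd (fst p) - snd p) \<bullet> (fst (fst p) - y)}) \<inter> {p. snd p \<bullet> fst (fst p) = 0})"
    by (auto simp: swing_def normal_cone_def)
  then show ?thesis
    by (simp only:) (intro closed_Un closed_Int closed_INT ballI closed_Collect_le closed_Collect_eq continuous_intros)
qed

lemma swing_nonempty: "swing K z \<noteq> {}"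
  by (auto simp: swing_def)

lemma swing_closed: "closed (swing K z)"
proof -
  have "swing K z = Pair z -` {(z, a). a \<in> swing K z}" by auto
  also have "closed \<dots>" by (intro continuous_closed_vimage swing_graph_closed continuous_intros)
  finally show ?thesis .
qed

lemma nearest_swing_measurable: "(\<lambda>z. closest_point (swing K z) c) \<in> borel_measurable borel"
  for K :: "'a::euclidean_space set"
  by (rule closest_point_measurable[OF swing_graph_closed swing_convex swing_nonempty])

lemma nearest_swing_in: "closest_point (swing K z) c \<in> swing K z"
  by (rule closest_point_in_set[OF swing_closed swing_nonempty])

lemma dist_nearest_swing_le: "a \<in> swing K z \<Longrightarrow> dist (closest_point (swing K z) c) c \<le> dist a c"
  using closest_point_le[OF swing_closed, of a K z c] by (simp add: dist_commute)

section \<open>Isotropy from the second variation\<close>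

text \<open>The perturbation keeps \<open>w\<close> in the class to which Clarke's inequality applies and has no
first-order effect on the action, so its second-order effect cannot be positive.\<close>
lemma no_positive_variation:
  fixes K :: "'n::finite phase set"
  assumes K: "convex_body K" "0 \<in> interior K" "c_EHZ K = 1"
    and w: "loop_velocity (polar2 K) w" "area w w = 2"
    and \<phi>: "bounded_measurable \<phi>" "prim \<phi> 1 = 0" "\<And>t. w t + \<phi> t \<in> polar2 K"
    and orth: "\<And>t. t \<in> {0..1} \<Longrightarrow> \<phi> t \<bullet> (Jmap (prim w t) + c) = 0"
  shows "area \<phi> \<phi> \<le> 0"
proof -
  note bw = loop_velocityD(1)[OF w(1)] and pw = loop_velocityD(3)[OF w(1)]
  have bs: "bounded_measurable (\<lambda>t. w t + \<phi> t)" by (rule bounded_measurable_add[OF bw \<phi>(1)])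
  have "loop_velocity (polar2 K) (\<lambda>t. w t + \<phi> t)"
    unfolding loop_velocity_def using bs \<phi>(3) prim_add[OF bw \<phi>(1)] pw \<phi>(2) by simp
  then have "area (\<lambda>t. w t + \<phi> t) (\<lambda>t. w t + \<phi> t) \<le> 2" by (rule Clarke_inequality[OF K])
  moreover have "area (\<lambda>t. w t + \<phi> t) (\<lambda>t. w t + \<phi> t) = area w w + area w \<phi> + area \<phi> w + area \<phi> \<phi>"
    by (simp add: area_add_left[OF bw \<phi>(1) bs] area_add_right[OF bw bw \<phi>(1)] area_add_right[OF \<phi>(1) bw \<phi>(1)])
  moreover have "area w \<phi> = area \<phi> w" using area_swap[OF bw \<phi>(1)] pw by simp
  moreover have "area \<phi> w = 0"
  proof -
    have "area \<phi> w + prim \<phi> 1 \<bullet> c = integral {0..1} (\<lambda>t. \<phi> t \<bullet> Jmap (prim w t)) + integral {0..1} (\<lambda>t. \<phi> t \<bullet> c)"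
      using integral_inner_const[OF \<phi>(1)] by (simp add: area_def)
    also have "\<dots> = integral {0..1} (\<lambda>t. \<phi> t \<bullet> (Jmap (prim w t) + c))"
      unfolding inner_add_right
      by (intro Henstock_Kurzweil_Integration.integral_add[symmetric] area_integrable bw \<phi>(1)
          integrable_inner_continuous continuous_on_const)
    also have "\<dots> = integral {0..1} (\<lambda>t::real. 0)"
      by (rule Henstock_Kurzweil_Integration.integral_cong) (rule orth)
    finally show ?thesis using \<phi>(2) by simp
  qed
  ultimately show ?thesis using w(2) by simp
qed

lemma swing_in_polar2:
  assumes w: "w \<in> normal_cone K x" and x: "w \<bullet> x = 2" and a: "a \<in> swing K (x, w)"
  shows "w + a \<in> polar2 K"
  unfolding polar2_def
proof (intro CollectI ballI)
  fix y assume y: "y \<in> K"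
  have A: "w + a \<in> normal_cone K x" "a \<bullet> x = 0" using a swing_iff[OF w] by blast+
  have "0 \<le> (w + a) \<bullet> (x - y)" using A(1) y unfolding normal_cone_def by blast
  then show "y \<bullet> (w + a) \<le> 2" using A(2) x by (simp add: inner_simps inner_commute)
qed

text \<open>The estimate in \<open>exists_positive_variation\<close> asks for a symplectic product that is large
compared to the distance from the centre; since that product is continuous, centres from a dense
set can be chosen so close that it holds.\<close>
lemma approximate_pair:
  fixes a b :: "'n::finite phase"
  assumes pos: "0 < b \<bullet> Jmap a" and D: "closure D = UNIV" and m: "0 < m"
  obtains a0 b0 n where "a0 \<in> D" "b0 \<in> D" "norm (a - a0) \<le> 1 / real (Suc n)" "norm (b - b0) \<le> 1 / real (Suc n)"
    "m * ((1 / real (Suc n)) * (2 * max (norm a0) (norm b0) + 1 / real (Suc n))) < b0 \<bullet> Jmap a0"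
proof -
  define R where "R = norm a + norm b + 1"
  have R: "1 \<le> R" by (simp add: R_def)
  \<comment> \<open>At distance at most \<open>d\<close> from the given pair, the product changes by at most \<open>2 * R * d\<close>, while
    the bound to be met is at most \<open>m * (2 * R + 1) * d\<close>.\<close>
  define c where "c = m * (2 * R + 1) + 2 * R"
  have c0: "0 < c" using m R by (simp add: c_def add_pos_pos)
  obtain n where n: "1 / real (Suc n) < (b \<bullet> Jmap a) / c"
    using nat_approx_posE[of "(b \<bullet> Jmap a) / c"] pos c0 by auto
  define d where "d = 1 / real (Suc n)"
  have d: "0 < d" "d \<le> 1" by (simp_all add: d_def)
  have "a \<in> closure D" "b \<in> closure D" using D by simp_all
  then obtain a0 b0 where ab: "a0 \<in> D" "b0 \<in> D" "dist a0 a < d" "dist b0 b < d"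
    using d(1) closure_approachable by metis
  have na: "norm (a - a0) \<le> d" and nb: "norm (b - b0) \<le> d"
    using ab by (simp_all add: dist_norm norm_minus_commute)
  have R0: "norm a0 \<le> R" "norm b0 \<le> R"
    using norm_triangle_ineq4[of a "a - a0"] norm_triangle_ineq4[of b "b - b0"] na nb d(2)
      norm_ge_zero[of a] norm_ge_zero[of b] by (simp_all add: R_def del: norm_ge_zero)
  have "b \<bullet> Jmap a - b0 \<bullet> Jmap a0 = (b - b0) \<bullet> Jmap a0 + b \<bullet> Jmap (a - a0)"
    by (simp add: Jmap_simps inner_simps)
  also have "(b - b0) \<bullet> Jmap a0 \<le> norm (b - b0) * norm a0" using norm_cauchy_schwarz[of "b - b0" "Jmap a0"] by simp
  also have "norm (b - b0) * norm a0 \<le> d * R" using nb R0 d by (intro mult_mono) auto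
  also have "b \<bullet> Jmap (a - a0) \<le> norm b * norm (a - a0)" using norm_cauchy_schwarz[of b "Jmap (a - a0)"] by simp
  also have "norm b * norm (a - a0) \<le> R * d" using na d R by (intro mult_mono) (auto simp: R_def)
  finally have 1: "b \<bullet> Jmap a - 2 * R * d \<le> b0 \<bullet> Jmap a0" by simp
  have "m * (d * (2 * max (norm a0) (norm b0) + d)) \<le> m * (d * (2 * R + 1))"
    using m d R0 by (intro mult_left_mono add_mono) auto
  moreover have "m * (d * (2 * R + 1)) + 2 * R * d = d * c" by (simp add: c_def algebra_simps)
  moreover have "d * c < b \<bullet> Jmap a" using n c0 by (simp add: d_def pos_less_divide_eq)
  ultimately have 2: "m * (d * (2 * max (norm a0) (norm b0) + d)) < b0 \<bullet> Jmap a0" using 1 by linarith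
  show thesis by (rule that[of a0 b0 n]) (use ab na nb 2 in \<open>simp_all add: d_def\<close>)
qed

text \<open>Times with a pair of directions of nonzero symplectic product are covered by countably many
sets on which the directions nearest to two fixed centres stay close to these centres. On such a
set of positive measure there would be a variation that increases the action.\<close>
lemma AE_swing_isotropic:
  fixes K :: "'n::finite phase set"
  assumes K: "convex_body K" "0 \<in> interior K" "c_EHZ K = 1"
    and w: "loop_velocity (polar2 K) w" "area w w = 2"
    and \<gamma>: "\<gamma> \<in> borel_measurable lebesgue" "\<And>t. t \<in> {0..1} \<Longrightarrow> \<gamma> t = Jmap (prim w t) + c"
    and G: "G \<in> sets lebesgue" "G \<subseteq> {0..1}"
      "\<And>t. t \<in> G \<Longrightarrow> w t \<in> normal_cone K (\<gamma> t)" "\<And>t. t \<in> G \<Longrightarrow> w t \<bullet> \<gamma> t = 2"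
  shows "AE t in lebesgue. t \<in> G \<longrightarrow>
    (\<forall>a\<in>swing K (\<gamma> t, w t). \<forall>b\<in>swing K (\<gamma> t, w t). b \<bullet> Jmap a = 0)"
proof -
  define near where "near a t = closest_point (swing K (\<gamma> t, w t)) a" for a t
  have "(\<lambda>t. (\<gamma> t, w t)) \<in> borel_measurable lebesgue"
    by (rule borel_measurable_Pair[OF \<gamma>(1) bounded_measurableD(1)[OF loop_velocityD(1)[OF w(1)]]])
  then have nearm: "near a \<in> borel_measurable lebesgue" for a
    unfolding near_def by (rule measurable_compose[OF _ nearest_swing_measurable])
  define m where "m = 8 * (real (DIM('n phase) + 1))\<^sup>2"
  have m0: "0 < m" unfolding m_def by simp
  define P where "P a b n = {t \<in> G. norm (near a t - a) \<le> 1 / real (Suc n) \<and> norm (near b t - b) \<le> 1 / real (Suc n)}"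
    for a b :: "'n phase" and n :: nat
  have Pm: "P a b n \<in> sets lebesgue" for a b n
  proof -
    have S: "{t. norm (near a t - a) \<le> r} \<in> sets lebesgue" for a r
    proof -
      have "near a -` cball a r \<inter> space lebesgue \<in> sets lebesgue" using nearm by (rule measurable_sets) simp
      moreover have "near a -` cball a r \<inter> space lebesgue = {t. norm (near a t - a) \<le> r}"
        by (auto simp: dist_norm norm_minus_commute)
      ultimately show ?thesis by simp
    qed
    have "P a b n = G \<inter> {t. norm (near a t - a) \<le> 1 / real (Suc n)} \<inter> {t. norm (near b t - b) \<le> 1 / real (Suc n)}"
      by (auto simp: P_def)
    then show ?thesis using S G(1) by simp
  qed
  have null: "measure lebesgue (P a b n) = 0"
    if small: "m * ((1 / real (Suc n)) * (2 * max (norm a) (norm b) + 1 / real (Suc n))) < b \<bullet> Jmap a" for a b n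
  proof (rule ccontr)
    assume "measure lebesgue (P a b n) \<noteq> 0"
    then have pos: "0 < measure lebesgue (P a b n)" using measure_nonneg[of lebesgue "P a b n"] by linarith
    define \<delta> where "\<delta> = 1 / real (Suc n)"
    define \<alpha> where "\<alpha> t = indicator (P a b n) t *\<^sub>R near a t" for t
    define \<beta> where "\<beta> t = indicator (P a b n) t *\<^sub>R near b t" for t
    have bm: "bounded_measurable (\<lambda>t. indicator (P a b n) t *\<^sub>R near d t)"
      if "\<And>t. t \<in> P a b n \<Longrightarrow> norm (near d t - d) \<le> \<delta>" for d
    proof (rule bounded_measurableI[of _ "norm d + \<delta>"])
      show "(\<lambda>t. indicator (P a b n) t *\<^sub>R near d t) \<in> borel_measurable lebesgue"
        using nearm Pm by simp
      show "norm (indicator (P a b n) t *\<^sub>R near d t) \<le> norm d + \<delta>" for t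
      proof (cases "t \<in> P a b n")
        case True
        then show ?thesis using that[OF True] norm_triangle_ineq2[of "near d t" d] by simp
      qed (simp add: \<delta>_def)
    qed
    have near: "norm (\<alpha> t - a) \<le> \<delta>" "norm (\<beta> t - b) \<le> \<delta>" if "t \<in> P a b n" for t
      using that by (simp_all add: \<alpha>_def \<beta>_def P_def \<delta>_def)
    have b\<alpha>: "bounded_measurable \<alpha>" unfolding \<alpha>_def by (rule bm) (simp add: P_def \<delta>_def)
    have b\<beta>: "bounded_measurable \<beta>" unfolding \<beta>_def by (rule bm) (simp add: P_def \<delta>_def)
    have PG: "P a b n \<subseteq> {0..1}" using G(2) by (auto simp: P_def)
    have "\<exists>\<phi>. bounded_measurable \<phi> \<and> prim \<phi> 1 = 0 \<and> 0 < area \<phi> \<phi> \<and> (\<forall>t. t \<notin> P a b n \<longrightarrow> \<phi> t = 0) \<and>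
        (\<forall>t. \<exists>\<sigma>. \<bar>\<sigma>\<bar> \<le> 1 \<and> (\<phi> t = \<sigma> *\<^sub>R \<alpha> t \<or> \<phi> t = \<sigma> *\<^sub>R \<beta> t))"
      by (rule exists_positive_variation[OF Pm PG pos b\<alpha> b\<beta> near, of "max (norm a) (norm b)"])
        (use small in \<open>simp_all add: \<delta>_def m_def\<close>)
    then obtain \<phi> where \<phi>: "bounded_measurable \<phi>" "prim \<phi> 1 = 0" "0 < area \<phi> \<phi>"
      "\<forall>t. t \<notin> P a b n \<longrightarrow> \<phi> t = 0"
      "\<forall>t. \<exists>\<sigma>. \<bar>\<sigma>\<bar> \<le> 1 \<and> (\<phi> t = \<sigma> *\<^sub>R \<alpha> t \<or> \<phi> t = \<sigma> *\<^sub>R \<beta> t)"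
      by (elim exE conjE)
    have sw: "\<phi> t \<in> swing K (\<gamma> t, w t)" if t: "t \<in> G" for t
    proof (cases "t \<in> P a b n")
      case True
      obtain \<sigma> where s: "\<bar>\<sigma>\<bar> \<le> 1" "\<phi> t = \<sigma> *\<^sub>R \<alpha> t \<or> \<phi> t = \<sigma> *\<^sub>R \<beta> t" using \<phi>(5) by blast
      have "\<alpha> t \<in> swing K (\<gamma> t, w t)" "\<beta> t \<in> swing K (\<gamma> t, w t)"
        using True by (simp_all add: \<alpha>_def \<beta>_def near_def nearest_swing_in)
      then show ?thesis using s swing_scale[OF G(3)[OF t]] by metis
    next
      case False
      then show ?thesis using \<phi>(4) by (simp add: swing_def)
    qed
    have "area \<phi> \<phi> \<le> 0"
    proof (rule no_positive_variation[OF K w \<phi>(1,2), of c])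
      show "w t + \<phi> t \<in> polar2 K" for t
      proof (cases "t \<in> G")
        case True
        then show ?thesis by (intro swing_in_polar2[of _ _ "\<gamma> t"] G sw)
      next
        case False
        then have "\<phi> t = 0" using \<phi>(4) by (auto simp: P_def)
        then show ?thesis using loop_velocityD(2)[OF w(1)] by simp
      qed
      show "\<phi> t \<bullet> (Jmap (prim w t) + c) = 0" if t: "t \<in> {0..1}" for t
      proof (cases "t \<in> G")
        case True
        then show ?thesis using sw[OF True] swing_iff[OF G(3)[OF True]] \<gamma>(2)[OF t] by simp
      next
        case False
        then have "\<phi> t = 0" using \<phi>(4) by (auto simp: P_def)
        then show ?thesis by simp
      qed
    qed
    then show False using \<phi>(3) by simp
  qed
  obtain D :: "'n phase set" where D: "countable D" "closure D = UNIV"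
    using separable[of "UNIV :: 'n phase set"] by (metis top.extremum_uniqueI)
  define I where "I = {(a, b, n). a \<in> D \<and> b \<in> D \<and>
      m * ((1 / real (Suc n)) * (2 * max (norm a) (norm b) + 1 / real (Suc n))) < b \<bullet> Jmap a}"
  have "countable I"
    by (rule countable_subset[of _ "D \<times> D \<times> UNIV"]) (use D(1) in \<open>auto simp: I_def\<close>)
  moreover have "negligible (P a b n)" if "(a, b, n) \<in> I" for a b n
  proof -
    have "P a b n \<in> lmeasurable"
      using Pm G(2) by (intro bounded_set_imp_lmeasurable) (auto intro: bounded_subset[OF bounded_closed_interval] simp: P_def)
    then show ?thesis using null[of n a b] that by (simp add: negligible_iff_measure I_def)
  qed
  ultimately have "negligible (\<Union>i\<in>I. case i of (a, b, n) \<Rightarrow> P a b n)"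
    by (intro negligible_countable_Union countable_image) auto
  then have "AE t in lebesgue. t \<notin> (\<Union>i\<in>I. case i of (a, b, n) \<Rightarrow> P a b n)"
    unfolding negligible_iff_null_sets by (rule AE_not_in)
  then show ?thesis
  proof (rule eventually_mono, intro impI ballI)
    fix t a b assume t: "t \<notin> (\<Union>i\<in>I. case i of (a, b, n) \<Rightarrow> P a b n)" "t \<in> G"
      and ab: "a \<in> swing K (\<gamma> t, w t)" "b \<in> swing K (\<gamma> t, w t)"
    have no: "\<not> 0 < b \<bullet> Jmap a" if ab: "a \<in> swing K (\<gamma> t, w t)" "b \<in> swing K (\<gamma> t, w t)" for a b
    proof
      assume "0 < b \<bullet> Jmap a"
      then obtain a0 b0 n where o: "a0 \<in> D" "b0 \<in> D" "norm (a - a0) \<le> 1 / real (Suc n)" "norm (b - b0) \<le> 1 / real (Suc n)"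
        "m * ((1 / real (Suc n)) * (2 * max (norm a0) (norm b0) + 1 / real (Suc n))) < b0 \<bullet> Jmap a0"
        using approximate_pair[OF _ D(2) m0] by blast
      have "norm (near a0 t - a0) \<le> 1 / real (Suc n)"
        using dist_nearest_swing_le[OF ab(1), of a0] o(3) by (simp add: near_def dist_norm)
      moreover have "norm (near b0 t - b0) \<le> 1 / real (Suc n)"
        using dist_nearest_swing_le[OF ab(2), of b0] o(4) by (simp add: near_def dist_norm)
      ultimately have "t \<in> P a0 b0 n" using t(2) by (simp add: P_def)
      moreover have "(a0, b0, n) \<in> I" using o by (simp add: I_def)
      ultimately show False using t(1) by blast
    qed
    have "(-1) *\<^sub>R a \<in> swing K (\<gamma> t, w t)" by (rule swing_scale[OF G(3)[OF t(2)] ab(1)]) simp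
    from no[OF this ab(2)] no[OF ab] show "b \<bullet> Jmap a = 0" by (simp add: Jmap_simps)
  qed
qed

section \<open>Minimal faces of the normal cone\<close>

text \<open>The function \<open>v \<bullet> \<gamma> s\<close> of \<open>s\<close> is maximal at \<open>s = t\<close>.\<close>
lemma normal_cone_orthogonal_derivative:
  assumes d: "(\<gamma> has_vector_derivative d) (at t)" and K: "\<And>s. \<bar>t - s\<bar> < e \<Longrightarrow> \<gamma> s \<in> K" and e: "0 < e"
    and v: "v \<in> normal_cone K (\<gamma> t)"
  shows "v \<bullet> d = 0"
proof -
  have "((\<lambda>s. v \<bullet> \<gamma> s) has_vector_derivative v \<bullet> d) (at t)"
    by (rule bounded_linear.has_vector_derivative[OF bounded_linear_inner_right d])
  then have "((\<lambda>s. v \<bullet> \<gamma> s) has_real_derivative v \<bullet> d) (at t)"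
    unfolding has_real_derivative_iff_has_vector_derivative .
  moreover have "v \<bullet> \<gamma> s \<le> v \<bullet> \<gamma> t" if "\<bar>t - s\<bar> < e" for s
  proof -
    have "0 \<le> v \<bullet> (\<gamma> t - \<gamma> s)" using v K[OF that] unfolding normal_cone_def by blast
    then show ?thesis by (simp add: inner_diff_right)
  qed
  ultimately show ?thesis by (intro DERIV_local_max[OF _ e]) auto
qed

text \<open>The span of the minimal face of the normal cone that contains \<open>w\<close>.\<close>
definition face_directions :: "'a::euclidean_space set \<Rightarrow> 'a \<Rightarrow> 'a \<Rightarrow> 'a set" where
  "face_directions K x w = {a. \<exists>e>0. w + e *\<^sub>R a \<in> normal_cone K x \<and> w - e *\<^sub>R a \<in> normal_cone K x}"

lemma normal_cone_segment:
  assumes "w + e *\<^sub>R a \<in> normal_cone K x" "w - e *\<^sub>R a \<in> normal_cone K x" "0 < e" "\<bar>s\<bar> \<le> e"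
  shows "w + s *\<^sub>R a \<in> normal_cone K x"
  unfolding normal_cone_def
proof (intro CollectI ballI)
  fix y assume y: "y \<in> K"
  define p where "p = w \<bullet> (x - y)"
  define q where "q = a \<bullet> (x - y)"
  have 1: "0 \<le> p + e * q" "0 \<le> p - e * q"
    using assms(1,2) y unfolding normal_cone_def p_def q_def by (auto simp: inner_add_left inner_diff_left)
  have "\<bar>s * q\<bar> \<le> e * \<bar>q\<bar>" using assms(4) by (simp add: abs_mult mult_right_mono)
  also have "\<dots> = \<bar>e * q\<bar>" using assms(3) by (simp add: abs_mult)
  also have "\<dots> \<le> p" using 1 by (simp add: abs_le_iff)
  finally have "0 \<le> p + s * q" by (simp add: abs_le_iff)
  then show "0 \<le> (w + s *\<^sub>R a) \<bullet> (x - y)" by (simp add: inner_add_left p_def q_def)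
qed

lemma subspace_face_directions:
  assumes w: "w \<in> normal_cone K x" shows "subspace (face_directions K x w)"
  unfolding subspace_def
proof (intro conjI allI ballI)
  show "0 \<in> face_directions K x w" using w unfolding face_directions_def by (auto intro: exI[of _ 1])
next
  fix a b assume "a \<in> face_directions K x w" "b \<in> face_directions K x w"
  then obtain e f where e: "0 < e" "w + e *\<^sub>R a \<in> normal_cone K x" "w - e *\<^sub>R a \<in> normal_cone K x"
    and f: "0 < f" "w + f *\<^sub>R b \<in> normal_cone K x" "w - f *\<^sub>R b \<in> normal_cone K x"
    unfolding face_directions_def by blast
  define m where "m = min e f"
  have m: "0 < m" "m \<le> e" "m \<le> f" using e(1) f(1) by (auto simp: m_def)
  have N: "w + m *\<^sub>R a \<in> normal_cone K x" "w + (- m) *\<^sub>R a \<in> normal_cone K x"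
     "w + m *\<^sub>R b \<in> normal_cone K x" "w + (- m) *\<^sub>R b \<in> normal_cone K x"
    using normal_cone_segment[OF e(2,3,1), of m] normal_cone_segment[OF e(2,3,1), of "- m"]
      normal_cone_segment[OF f(2,3,1), of m] normal_cone_segment[OF f(2,3,1), of "- m"] m by simp_all
  have "(1/2) *\<^sub>R ((w + m *\<^sub>R a) + (w + m *\<^sub>R b)) \<in> normal_cone K x"
    "(1/2) *\<^sub>R ((w + (- m) *\<^sub>R a) + (w + (- m) *\<^sub>R b)) \<in> normal_cone K x"
    by (intro normal_cone_scale[OF normal_cone_add] N; simp)+
  moreover have half: "(1/2) *\<^sub>R ((w + c *\<^sub>R a) + (w + c *\<^sub>R b)) = w + (c / 2) *\<^sub>R (a + b)" for c
    using scaleR_half_double[of w] by (simp add: scaleR_add_right)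
  ultimately show "a + b \<in> face_directions K x w"
    unfolding face_directions_def half using m(1) by (intro CollectI exI[of _ "m / 2"]) simp
next
  fix c :: real and a assume "a \<in> face_directions K x w"
  then obtain e where e: "0 < e" "w + e *\<^sub>R a \<in> normal_cone K x" "w - e *\<^sub>R a \<in> normal_cone K x"
    unfolding face_directions_def by blast
  define f where "f = e / (\<bar>c\<bar> + 1)"
  have f: "0 < f" using e(1) by (simp add: f_def add_nonneg_pos)
  have "\<bar>f * c\<bar> \<le> e"
  proof -
    have "\<bar>f * c\<bar> = f * \<bar>c\<bar>" using f by (simp add: abs_mult)
    also have "\<dots> \<le> f * (\<bar>c\<bar> + 1)" using f by simp
    also have "\<dots> = e" by (simp add: f_def)
    finally show ?thesis .
  qed
  then have "w + (f * c) *\<^sub>R a \<in> normal_cone K x" "w + (- (f * c)) *\<^sub>R a \<in> normal_cone K x"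
    by (intro normal_cone_segment[OF e(2,3,1)]; simp)+
  then show "c *\<^sub>R a \<in> face_directions K x w"
    unfolding face_directions_def using f by (intro CollectI exI[of _ f]) simp
qed

lemma self_in_face_directions:
  assumes w: "w \<in> normal_cone K x" shows "w \<in> face_directions K x w"
  unfolding face_directions_def
proof (intro CollectI exI[of _ "1/2"] conjI)
  show "w + (1/2) *\<^sub>R w \<in> normal_cone K x" by (intro normal_cone_add normal_cone_scale w) simp
  have "w - (1/2) *\<^sub>R w = (1/2) *\<^sub>R w" by (metis add_diff_cancel scaleR_half_double scaleR_add_right)
  then show "w - (1/2) *\<^sub>R w \<in> normal_cone K x" using normal_cone_scale[OF w, of "1/2"] by simp
qed simp

text \<open>Subtracting a multiple of \<open>w\<close> makes the pairing with \<open>x\<close> vanish.\<close>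
lemma face_directions_split:
  assumes w: "w \<in> normal_cone K x" "w \<bullet> x = 2" and a: "a \<in> face_directions K x w"
  obtains c e where "0 < e" "e *\<^sub>R (a - c *\<^sub>R w) \<in> swing K (x, w)"
proof -
  define c where "c = (a \<bullet> x) / 2"
  have "a - c *\<^sub>R w \<in> face_directions K x w"
    using subspace_face_directions[OF w(1)] self_in_face_directions[OF w(1)] a by (simp add: subspace_diff subspace_scale)
  then obtain e where e: "0 < e" "w + e *\<^sub>R (a - c *\<^sub>R w) \<in> normal_cone K x" "w - e *\<^sub>R (a - c *\<^sub>R w) \<in> normal_cone K x"
    unfolding face_directions_def by blast
  moreover have "(e *\<^sub>R (a - c *\<^sub>R w)) \<bullet> x = 0" using w(2) by (simp add: c_def inner_diff_left)
  ultimately show thesis using that[of e c] swing_iff[OF w(1)] by blast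
qed

text \<open>Up to multiples of \<open>w\<close>, which is symplectically orthogonal to the whole face, every face
direction is a multiple of an element of \<open>swing\<close>.\<close>
lemma face_directions_isotropic:
  fixes w :: "'n::finite phase"
  assumes w: "w \<in> normal_cone K x" "w \<bullet> x = 2"
    and iso: "\<And>a b. a \<in> swing K (x, w) \<Longrightarrow> b \<in> swing K (x, w) \<Longrightarrow> b \<bullet> Jmap a = 0"
    and orth: "\<And>v. v \<in> normal_cone K x \<Longrightarrow> v \<bullet> Jmap w = 0"
    and ab: "a \<in> face_directions K x w" "b \<in> face_directions K x w"
  shows "b \<bullet> Jmap a = 0"
proof -
  have o: "v \<bullet> Jmap w = 0" if "v \<in> face_directions K x w" for v
  proof -
    from that obtain e where e: "0 < e" "w + e *\<^sub>R v \<in> normal_cone K x" unfolding face_directions_def by blast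
    from orth[OF e(2)] e(1) show ?thesis by (simp add: inner_add_left)
  qed
  obtain c e where ce: "0 < e" "e *\<^sub>R (a - c *\<^sub>R w) \<in> swing K (x, w)" using face_directions_split[OF w ab(1)] by blast
  obtain d f where df: "0 < f" "f *\<^sub>R (b - d *\<^sub>R w) \<in> swing K (x, w)" using face_directions_split[OF w ab(2)] by blast
  have "(f *\<^sub>R (b - d *\<^sub>R w)) \<bullet> Jmap (e *\<^sub>R (a - c *\<^sub>R w)) = 0" by (rule iso[OF ce(2) df(2)])
  then have "(b - d *\<^sub>R w) \<bullet> Jmap (a - c *\<^sub>R w) = 0" using ce(1) df(1) by (simp add: Jmap_simps)
  moreover have "w \<bullet> Jmap a = 0" using o[OF ab(1)] Jmap_inner[of w a] by (simp add: inner_commute)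
  ultimately show ?thesis using o[OF ab(2)] by (simp add: Jmap_simps inner_diff_left inner_diff_right)
qed

text \<open>The pairing with \<open>v\<close> is constant on \<open>K\<close>, which contains a ball around 0.\<close>
lemma normal_cone_pointed:
  assumes K: "0 \<in> interior K" and v: "v \<in> normal_cone K x" "- v \<in> normal_cone K x"
  shows "v = 0"
proof (rule ccontr)
  assume v0: "v \<noteq> 0"
  obtain r where r: "0 < r" "cball 0 r \<subseteq> K" using K by (auto simp: mem_interior_cball)
  have e: "v \<bullet> (x - y) = 0" if "y \<in> K" for y
    using v that unfolding normal_cone_def by (metis (mono_tags, lifting) dual_order.antisym inner_minus_left mem_Collect_eq neg_0_le_iff_le)
  define y where "y = (r / norm v) *\<^sub>R v"
  have "norm y = r" using v0 r by (simp add: y_def)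
  then have "y \<in> K" "0 \<in> K" using r by auto
  then have "v \<bullet> y = 0" using e[of y] e[of 0] by (simp add: inner_diff_right)
  then show False using v0 r by (simp add: y_def)
qed

text \<open>The minimal face is then spanned by \<open>w\<close>. A point of that line in the cone is a nonnegative
multiple of \<open>w\<close>; if it is positive, any summand of it is a face direction, and if it is 0,
pointedness of the cone forces the summands to vanish.\<close>
lemma extreme_ray_of_trivial_swing:
  assumes K: "0 \<in> interior K" and w: "w \<in> normal_cone K x" "w \<bullet> x = 2" and triv: "swing K (x, w) = {0}"
  shows "\<exists>E. extreme_ray (normal_cone K x) E \<and> w \<in> E"
proof -
  let ?S = "face_directions K x w"
  have w0: "w \<noteq> 0" using w(2) by auto
  have sub: "subspace ?S" by (rule subspace_face_directions[OF w(1)])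
  have "?S = span {w}"
  proof
    show "?S \<subseteq> span {w}"
    proof
      fix a assume "a \<in> ?S"
      then obtain c e where "0 < e" "e *\<^sub>R (a - c *\<^sub>R w) \<in> swing K (x, w)" using face_directions_split[OF w] by blast
      then have "a = c *\<^sub>R w" using triv by simp
      then show "a \<in> span {w}" by (simp add: span_base span_scale)
    qed
    show "span {w} \<subseteq> ?S" by (rule span_minimal) (use sub self_in_face_directions[OF w(1)] in auto)
  qed
  then have dim: "dim ?S = 1" using w0 by (simp add: dim_span dim_singleton)
  have out: False if c: "0 < c" "c < 1" and l: "u = l *\<^sub>R w" and u: "u = c *\<^sub>R v1 + (1 - c) *\<^sub>R v2" "u \<in> normal_cone K x"
     and v: "v1 \<in> normal_cone K x" "v2 \<in> normal_cone K x" "v1 \<notin> ?S" for u v1 v2 c l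
  proof -
    have "v1 \<in> ?S"
    proof (cases "0 < l")
      case True
      have "w - (c / l) *\<^sub>R v1 = ((1 - c) / l) *\<^sub>R v2"
      proof -
        have "w = (1 / l) *\<^sub>R u" using l True by simp
        also have "\<dots> = (c / l) *\<^sub>R v1 + ((1 - c) / l) *\<^sub>R v2" by (simp add: u(1) scaleR_add_right)
        finally show ?thesis by simp
      qed
      then have "w - (c / l) *\<^sub>R v1 \<in> normal_cone K x" using normal_cone_scale[OF v(2), of "(1 - c) / l"] c True by simp
      moreover have "w + (c / l) *\<^sub>R v1 \<in> normal_cone K x" using c True by (intro normal_cone_add normal_cone_scale w(1) v(1)) simp
      ultimately show ?thesis unfolding face_directions_def using c True by (intro CollectI exI[of _ "c / l"]) simp
    next
      case False
      have "- u \<in> normal_cone K x" using normal_cone_scale[OF w(1), of "- l"] False l by simp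
      then have "u = 0" using normal_cone_pointed[OF K u(2)] by simp
      then have "- (c *\<^sub>R v1) = (1 - c) *\<^sub>R v2" using u(1) by (simp add: add_eq_0_iff)
      then have "- (c *\<^sub>R v1) \<in> normal_cone K x" using normal_cone_scale[OF v(2), of "1 - c"] c by simp
      then have "c *\<^sub>R v1 = 0" using normal_cone_pointed[OF K normal_cone_scale[OF v(1), of c]] c by simp
      then have "v1 = 0" using c by simp
      then show ?thesis using subspace_0[OF sub] by simp
    qed
    then show False using v(3) by blast
  qed
  have "extreme_section (normal_cone K x) ?S"
    unfolding extreme_section_def
  proof (intro conjI sub notI, elim bexE exE conjE)
    fix u v1 v2 and c :: real
    assume u: "u \<in> ?S \<inter> normal_cone K x" and v: "v1 \<in> normal_cone K x - ?S \<inter> normal_cone K x" "v2 \<in> normal_cone K x - ?S \<inter> normal_cone K x"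
      and c: "0 < c" "c < 1" "u = c *\<^sub>R v1 + (1 - c) *\<^sub>R v2"
    obtain l where l: "u = l *\<^sub>R w" using u \<open>?S = span {w}\<close> by (auto simp: span_singleton)
    show False by (rule out[OF c(1,2) l c(3)]) (use u v in auto)
  qed
  then have "extreme_ray (normal_cone K x) (?S \<inter> normal_cone K x)"
    unfolding extreme_ray_def using dim by blast
  then show ?thesis using w(1) self_in_face_directions[OF w(1)] by blast
qed

text \<open>The isotropic subspace is the image under \<open>Jmap\<close> of the span of the minimal face. It contains
the images of the independent normals \<open>w\<close> and \<open>w + a\<close>.\<close>
lemma isotropic_section_of_nontrivial_swing:
  fixes w :: "'n::finite phase"
  assumes w: "w \<in> normal_cone K x" "w \<bullet> x = 2"
    and iso: "\<And>a b. a \<in> face_directions K x w \<Longrightarrow> b \<in> face_directions K x w \<Longrightarrow> b \<bullet> Jmap a = 0"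
    and a: "a \<in> swing K (x, w)" "a \<noteq> 0"
  shows "\<exists>L. isotropic L \<and> 1 < aff_dim (L \<inter> Jmap ` normal_cone K x) \<and>
    Jmap w \<in> rel_interior (L \<inter> Jmap ` normal_cone K x)"
proof -
  let ?S = "face_directions K x w" and ?N = "normal_cone K x"
  have sub: "subspace ?S" by (rule subspace_face_directions[OF w(1)])
  have inj: "inj (Jmap :: 'n phase \<Rightarrow> _)"
    by (rule injI) (metis Jmap_Jmap neg_equal_iff_equal)
  have im: "Jmap ` ?S \<inter> Jmap ` ?N = Jmap ` (?S \<inter> ?N)" by (rule image_Int[OF inj, symmetric])
  have "isotropic (Jmap ` ?S)"
    unfolding isotropic_def
  proof (intro conjI subsetI)
    show "subspace (Jmap ` ?S)" by (rule linear_subspace_image[OF linear_Jmap sub])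
    fix u assume "u \<in> Jmap ` ?S"
    then obtain a where a: "a \<in> ?S" "u = Jmap a" by blast
    show "u \<in> symp_complement (Jmap ` ?S)"
      unfolding symp_complement_def
    proof (intro CollectI ballI)
      fix v assume "v \<in> Jmap ` ?S"
      then obtain b where b: "b \<in> ?S" "v = Jmap b" by blast
      show "symp u v = 0" using iso[OF b(1) a(1)] by (simp add: symp_eq_inner_Jmap a(2) b(2))
    qed
  qed
  moreover have "1 < aff_dim (?S \<inter> ?N)"
  proof -
    have wa: "w + a \<in> ?N" "w - a \<in> ?N" "a \<bullet> x = 0" using a(1) swing_iff[OF w(1)] by blast+
    have aS: "a \<in> ?S" unfolding face_directions_def using wa by (intro CollectI exI[of _ 1]) simp
    have wS: "w \<in> ?S" by (rule self_in_face_directions[OF w(1)])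
    have ne: "w \<noteq> w + a" using a(2) by simp
    have "independent {w, w + a}"
    proof -
      have "w \<notin> span {w + a}"
      proof
        assume "w \<in> span {w + a}"
        then obtain k where k: "w = k *\<^sub>R (w + a)" by (auto simp: span_singleton)
        have "w \<bullet> x = k * ((w + a) \<bullet> x)" using k by (metis inner_scaleR_left)
        then have "k = 1" using w(2) wa(3) by (simp add: inner_add_left)
        then show False using k a(2) by simp
      qed
      moreover have "w + a \<noteq> 0" using w(2) wa(3) by (metis inner_add_left inner_zero_left add.right_neutral zero_neq_numeral)
      ultimately show ?thesis using ne by (simp add: independent_insert)
    qed
    moreover have "{w, w + a} \<subseteq> ?S \<inter> ?N" using wS aS wa(1) w(1) sub by (simp add: subspace_add)
    ultimately have "card {w, w + a} \<le> dim (?S \<inter> ?N)" by (intro independent_card_le_dim)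
    then have "2 \<le> dim (?S \<inter> ?N)" using ne by simp
    moreover have "0 \<in> ?S \<inter> ?N" using subspace_0[OF sub] by simp
    ultimately show ?thesis by (simp add: aff_dim_zero hull_inc)
  qed
  then have "1 < aff_dim (Jmap ` ?S \<inter> Jmap ` ?N)"
    unfolding im by (simp add: aff_dim_injective_linear_image[OF linear_Jmap inj])
  moreover have "w \<in> rel_interior (?S \<inter> ?N)"
  proof -
    have "convex (?S \<inter> ?N)" by (intro convex_Int subspace_imp_convex sub convex_normal_cone)
    moreover have "?S \<inter> ?N \<noteq> {}" using subspace_0[OF sub] zero_in_normal_cone[of K x] by blast
    moreover have "\<exists>e>1. (1 - e) *\<^sub>R y + e *\<^sub>R w \<in> ?S \<inter> ?N" if y: "y \<in> ?S \<inter> ?N" for y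
    proof -
      have "w - y \<in> ?S" using y self_in_face_directions[OF w(1)] sub by (simp add: subspace_diff)
      then obtain e where e: "0 < e" "w + e *\<^sub>R (w - y) \<in> ?N" unfolding face_directions_def by blast
      have "(1 - (1 + e)) *\<^sub>R y + (1 + e) *\<^sub>R w = w + e *\<^sub>R (w - y)" by (simp add: algebra_simps)
      moreover have "w + e *\<^sub>R (w - y) \<in> ?S"
        using \<open>w - y \<in> ?S\<close> self_in_face_directions[OF w(1)] sub by (simp add: subspace_add subspace_scale)
      ultimately show ?thesis using e by (intro exI[of _ "1 + e"]) simp
    qed
    ultimately show ?thesis by (simp add: convex_rel_interior_iff)
  qed
  then have "Jmap w \<in> rel_interior (Jmap ` ?S \<inter> Jmap ` ?N)"
    unfolding im by (simp add: rel_interior_injective_linear_image[OF bounded_linear_Jmap inj])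
  ultimately show ?thesis by blast
qed

text \<open>An interval that witnesses motion along a face serves for all of its points.\<close>
lemma open_moves_along: "open {t. \<exists>E. coisotropic_face K E \<and> moves_along K \<gamma> E t}"
proof (rule openI)
  fix t assume "t \<in> {t. \<exists>E. coisotropic_face K E \<and> moves_along K \<gamma> E t}"
  then obtain E t0 t1 where E: "coisotropic_face K E" "t0 < t" "t < t1"
    "AE s\<in>{t0<..<t1} in lebesgue. \<gamma> s \<in> E \<and> velocity \<gamma> s \<in> Jmap ` face_normal_cone K E"
    unfolding moves_along_def by blast
  have "{t0<..<t1} \<subseteq> {t. \<exists>E. coisotropic_face K E \<and> moves_along K \<gamma> E t}"
  proof
    fix s assume "s \<in> {t0<..<t1}"
    then have "t0 < s \<and> s < t1" by simp
    then have "moves_along K \<gamma> E s" unfolding moves_along_def using E(4) by blast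
    then show "s \<in> {t. \<exists>E. coisotropic_face K E \<and> moves_along K \<gamma> E t}" using E(1) by blast
  qed
  moreover have "\<exists>e>0. ball t e \<subseteq> {t0<..<t1}"
    using E(2,3) open_greaterThanLessThan[of t0 t1] by (simp add: open_contains_ball)
  ultimately show "\<exists>e>0. ball t e \<subseteq> {t. \<exists>E. coisotropic_face K E \<and> moves_along K \<gamma> E t}" by blast
qed

section \<open>The three alternatives along a minimizer\<close>

lemma support_function_normal_cone:
  assumes x: "x \<in> K" and v: "v \<in> normal_cone K x"
  shows "support_function K v = v \<bullet> x"
proof -
  have "support_function K v = x \<bullet> v"
  proof (rule support_function_eqI[OF x])
    fix y assume "y \<in> K"
    then have "0 \<le> v \<bullet> (x - y)" using v unfolding normal_cone_def by blast
    then show "y \<bullet> v \<le> x \<bullet> v" by (simp add: inner_diff_right inner_commute)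
  qed
  then show ?thesis by (simp add: inner_commute)
qed

theorem theorem3:
  fixes K :: "'n::finite phase set" and \<gamma> :: "real \<Rightarrow> 'n phase"
  assumes "convex_body K"
    and "0 \<in> interior K"
    and "c_EHZ K = 1"
    and "\<gamma> \<in> Sys K"
  shows "AE t\<in>{0..<1} in lebesgue.
      (\<exists>E. extreme_ray (normal_cone K (\<gamma> t)) E \<and> - Jmap (velocity \<gamma> t) \<in> E)
    \<or> (\<exists>E. coisotropic_face K E \<and> moves_along K \<gamma> E t)
    \<or> (\<exists>A. isotropic_gliding_set K \<gamma> A \<and> t \<in> A)"
proof -
  note K = assms(1-3)
  have cK: "compact K" using K(1) by (simp add: convex_body_def)
  have cc: "closed_characteristic K 1 \<gamma>"
    and h2: "AE t in lebesgue. t \<in> {0..1} \<longrightarrow> support_function K (- Jmap (velocity \<gamma> t)) = 2"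
    using assms(4) by (simp_all add: Sys_def)
  have per: "\<gamma> 0 = \<gamma> 1" and bd: "\<gamma> ` {0..1} \<subseteq> frontier K"
    and nc: "AE t in lebesgue. t \<in> {0..1} \<longrightarrow> - Jmap (velocity \<gamma> t) \<in> normal_cone K (\<gamma> t)"
    and W: "W12_on 0 1 \<gamma>"
    using cc by (simp_all add: closed_characteristic_def)
  have \<gamma>K: "\<gamma> t \<in> K" if "t \<in> {0..1}" for t
    using bd that frontier_subset_closed[OF compact_imp_closed[OF cK]] by blast
  obtain g where g: "set_integrable lebesgue {0..1} g" "set_integrable lebesgue {0..1} (\<lambda>t. (norm (g t))\<^sup>2)"
    "\<forall>t\<in>{0..1}. \<gamma> t = \<gamma> 0 + (LINT s:{0..t}|lebesgue. g s)"
    using W unfolding W12_on_def by (elim exE conjE)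
  have \<gamma>g: "\<gamma> t = \<gamma> 0 + integral {0..t} g" if t: "t \<in> {0..1}" for t
  proof -
    have "set_integrable lebesgue {0..t} g" using g(1) by (rule set_integrable_subset) (use t in auto)
    from set_lebesgue_integral_eq_integral(2)[OF this, symmetric] show ?thesis
      using bspec[OF g(3) t] by (rule ssubst)
  qed
  have der: "AE t in lebesgue. t \<in> {0..1} \<longrightarrow> t \<in> {0<..<1} \<and> (\<gamma> has_vector_derivative g t) (at t)"
  proof (rule AE_Ioo_imp_Icc)
    show "AE t in lebesgue. t \<in> {0<..<1} \<longrightarrow> t \<in> {0<..<1} \<and> (\<gamma> has_vector_derivative g t) (at t)"
      using AE_indefinite_integral_derivative[OF g(1,2)]
    proof (rule eventually_mono, intro impI conjI)
      fix t :: real assume d: "t \<in> {0<..<1} \<longrightarrow> ((\<lambda>t. integral {0..t} g) has_vector_derivative g t) (at t)" and t: "t \<in> {0<..<1}"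
      have "((\<lambda>t. \<gamma> 0 + integral {0..t} g) has_vector_derivative 0 + g t) (at t)"
        by (rule has_vector_derivative_add[OF has_vector_derivative_const d[rule_format, OF t]])
      then have "((\<lambda>t. \<gamma> 0 + integral {0..t} g) has_vector_derivative g t) (at t)" by simp
      moreover have "\<gamma> 0 + integral {0..s} g = \<gamma> s" if "s \<in> {0<..<1}" for s using \<gamma>g[of s] that by simp
      ultimately show "(\<gamma> has_vector_derivative g t) (at t)"
        by (rule has_vector_derivative_transform_within_open[OF _ open_greaterThanLessThan t])
    qed
  qed
  define good where "good t \<longleftrightarrow> t \<in> {0<..<1} \<and> (\<gamma> has_vector_derivative g t) (at t) \<and>
      - Jmap (g t) \<in> normal_cone K (\<gamma> t) \<and> (- Jmap (g t)) \<bullet> \<gamma> t = 2" for t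
  have "AE t in lebesgue. t \<in> {0..1} \<longrightarrow> good t"
    using der nc h2
  proof eventually_elim
    case (elim t)
    show ?case
    proof
      assume t: "t \<in> {0..1}"
      have v: "velocity \<gamma> t = g t" unfolding velocity_def by (rule vector_derivative_at) (use elim(1) t in blast)
      have n: "- Jmap (g t) \<in> normal_cone K (\<gamma> t)" using elim(2) t v by simp
      have "(- Jmap (g t)) \<bullet> \<gamma> t = 2"
        using support_function_normal_cone[OF \<gamma>K[OF t] n] elim(3) t v by simp
      then show "good t" unfolding good_def using elim(1) t n by blast
    qed
  qed
  then obtain N where N: "negligible N" "{t. \<not> (t \<in> {0..1} \<longrightarrow> good t)} \<subseteq> N"
    unfolding eventually_ae_filter_negligible by (elim exE conjE)
  define G where "G = {0..1} - N"
  have Gm: "G \<in> sets lebesgue" unfolding G_def using N(1) by (intro sets.Diff) (auto simp: negligible_imp_sets)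
  have G01: "G \<subseteq> {0..1}" by (auto simp: G_def)
  have Gg: "good t" if "t \<in> G" for t using that N(2) by (auto simp: G_def)
  define w where "w t = indicator G t *\<^sub>R (- Jmap (g t))" for t
  have wG: "w t = - Jmap (g t)" if "t \<in> G" for t using that by (simp add: w_def)
  have wC: "w t \<in> polar2 K" for t
  proof (cases "t \<in> G")
    case True
    have "w t + 0 \<in> polar2 K"
      by (rule swing_in_polar2[of _ _ "\<gamma> t"]) (use Gg[OF True] wG[OF True] in \<open>auto simp: good_def swing_def\<close>)
    then show ?thesis by simp
  qed (simp add: w_def polar2_def)
  have bw: "bounded_measurable w"
  proof -
    obtain B where B: "\<And>v. v \<in> polar2 K \<Longrightarrow> norm v \<le> B" using bounded_polar2[OF K(2)] unfolding bounded_iff by blast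
    have "(\<lambda>t. indicat_real {0..1} t *\<^sub>R g t) \<in> borel_measurable lebesgue"
      using g(1) unfolding set_integrable_def by (rule borel_measurable_integrable)
    then have "(\<lambda>t. - Jmap (indicat_real {0..1} t *\<^sub>R g t)) \<in> borel_measurable lebesgue"
      by (intro borel_measurable_uminus borel_measurable_continuous_on[of Jmap] linear_continuous_on bounded_linear_Jmap)
    then have "(\<lambda>t. indicat_real G t *\<^sub>R (- Jmap (indicat_real {0..1} t *\<^sub>R g t))) \<in> borel_measurable lebesgue"
      using Gm by (intro borel_measurable_scaleR borel_measurable_indicator)
    moreover have "(\<lambda>t. indicat_real G t *\<^sub>R (- Jmap (indicat_real {0..1} t *\<^sub>R g t))) = w"
      using G01 by (auto simp: w_def fun_eq_iff indicator_def Jmap_simps)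
    ultimately have "w \<in> borel_measurable lebesgue" by (rule subst[rotated])
    then show ?thesis by (rule bounded_measurableI) (rule B[OF wC])
  qed
  have \<gamma>w: "\<gamma> t = Jmap (prim w t) + \<gamma> 0" if t: "t \<in> {0..1}" for t
  proof -
    have "Jmap (prim w t) = integral {0..t} (\<lambda>s. Jmap (w s))"
      using integral_linear[OF bounded_measurable_integrable_on[OF bw] bounded_linear_Jmap] by (simp add: prim_def o_def)
    also have "\<dots> = integral {0..t} g"
    proof (rule integral_spike[OF N(1)])
      fix s assume "s \<in> {0..t} - N"
      then have "s \<in> G" using t by (auto simp: G_def)
      then show "g s = Jmap (w s)" using wG by (simp add: Jmap_simps)
    qed
    finally show ?thesis using \<gamma>g[OF t] by simp
  qed
  have "Jmap (prim w 1) = 0" using \<gamma>w[of 1] per by simp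
  then have "norm (prim w 1) = 0" by (metis norm_Jmap norm_zero)
  then have pw: "prim w 1 = 0" by simp
  have lw: "loop_velocity (polar2 K) w" using bw wC pw by (simp add: loop_velocity_def)
  have act2: "area w w = 2"
  proof -
    have "area w w + prim w 1 \<bullet> \<gamma> 0 = integral {0..1} (\<lambda>t. w t \<bullet> Jmap (prim w t)) + integral {0..1} (\<lambda>t. w t \<bullet> \<gamma> 0)"
      using integral_inner_const[OF bw] by (simp add: area_def)
    also have "\<dots> = integral {0..1} (\<lambda>t. w t \<bullet> (Jmap (prim w t) + \<gamma> 0))"
      unfolding inner_add_right
      by (intro Henstock_Kurzweil_Integration.integral_add[symmetric] area_integrable bw
          integrable_inner_continuous continuous_on_const)
    also have "\<dots> = integral {0..1} (\<lambda>t::real. 2)"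
    proof (rule integral_spike[OF N(1)])
      fix s assume "s \<in> {0..1} - N"
      then have s: "s \<in> G" "s \<in> {0..1}" by (auto simp: G_def)
      then show "2 = w s \<bullet> (Jmap (prim w s) + \<gamma> 0)"
        using \<gamma>w[OF s(2)] wG[OF s(1)] Gg[OF s(1)] by (simp add: good_def)
    qed
    finally show ?thesis using pw by simp
  qed
  \<comment> \<open>The curve cut off outside one period, which makes it visibly measurable on the line.\<close>
  define \<gamma>1 where "\<gamma>1 t = indicat_real {0..1} t *\<^sub>R (Jmap (prim w t) + \<gamma> 0)" for t
  have \<gamma>1: "\<gamma>1 t = \<gamma> t" if "t \<in> {0..1}" for t using \<gamma>w[OF that] that by (simp add: \<gamma>1_def)
  have \<gamma>1m: "\<gamma>1 \<in> borel_measurable lebesgue"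
    unfolding \<gamma>1_def
    by (intro bounded_measurableD(1) bounded_measurable_continuous_on continuous_on_add continuous_on_const continuous_on_Jmap_prim bw)
  have "AE t in lebesgue. t \<in> G \<longrightarrow>
      (\<forall>a\<in>swing K (\<gamma>1 t, w t). \<forall>b\<in>swing K (\<gamma>1 t, w t). b \<bullet> Jmap a = 0)"
  proof (rule AE_swing_isotropic[OF K lw act2 \<gamma>1m _ Gm G01])
    show "\<gamma>1 t = Jmap (prim w t) + \<gamma> 0" if "t \<in> {0..1}" for t using \<gamma>1[OF that] \<gamma>w[OF that] by simp
    show "w t \<in> normal_cone K (\<gamma>1 t)" if t: "t \<in> G" for t
      using Gg[OF t] wG[OF t] \<gamma>1 G01 t by (auto simp: good_def)
    show "w t \<bullet> \<gamma>1 t = 2" if t: "t \<in> G" for t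
      using Gg[OF t] wG[OF t] \<gamma>1 G01 t by (auto simp: good_def)
  qed
  then obtain N2 where N2: "negligible N2" "{t. \<not> (t \<in> G \<longrightarrow>
      (\<forall>a\<in>swing K (\<gamma>1 t, w t). \<forall>b\<in>swing K (\<gamma>1 t, w t). b \<bullet> Jmap a = 0))} \<subseteq> N2"
    unfolding eventually_ae_filter_negligible by (elim exE conjE)
  \<comment> \<open>Almost every time belongs to \<open>H\<close>, and at each time in \<open>H\<close> the velocity is a normal of the right
    size and \<open>swing\<close> is isotropic.  The sets \<open>Z\<close>, \<open>U\<close> and \<open>A\<close> below are the times of the three
    alternatives.\<close>
  define H where "H = G - N2"
  have Hm: "H \<in> sets lebesgue" unfolding H_def using N2(1) Gm by (intro sets.Diff) (auto simp: negligible_imp_sets)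
  define z where "z t = (\<gamma>1 t, w t)" for t
  define U where "U = {t. \<exists>E. coisotropic_face K E \<and> moves_along K \<gamma> E t}"
  define Z where "Z = {t \<in> H. swing K (z t) = {0}}"
  have HG: "t \<in> G" if "t \<in> H" for t using that by (simp add: H_def)
  have Hz: "z t = (\<gamma> t, w t)" if "t \<in> H" for t using \<gamma>1 G01 HG[OF that] by (auto simp: z_def)
  have Hd: "(\<gamma> has_vector_derivative Jmap (w t)) (at t)" "velocity \<gamma> t = Jmap (w t)" "t \<in> {0<..<1}"
    "w t \<in> normal_cone K (\<gamma> t)" "w t \<bullet> \<gamma> t = 2" if t: "t \<in> H" for t
  proof -
    have gd: "good t" by (rule Gg[OF HG[OF t]])
    have Jw: "Jmap (w t) = g t" using wG[OF HG[OF t]] by (simp add: Jmap_simps)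
    show d: "(\<gamma> has_vector_derivative Jmap (w t)) (at t)" using gd Jw by (simp add: good_def)
    show "velocity \<gamma> t = Jmap (w t)" unfolding velocity_def by (rule vector_derivative_at[OF d])
    show "t \<in> {0<..<1}" "w t \<in> normal_cone K (\<gamma> t)" "w t \<bullet> \<gamma> t = 2"
      using gd wG[OF HG[OF t]] by (simp_all add: good_def)
  qed
  have Zm: "Z \<in> sets lebesgue"
  proof -
    obtain D :: "'n phase set" where D: "countable D" "closure D = UNIV"
      using separable[of "UNIV :: 'n phase set"] by (metis top.extremum_uniqueI)
    have zm: "z \<in> borel_measurable lebesgue"
      unfolding z_def by (rule borel_measurable_Pair[OF \<gamma>1m bounded_measurableD(1)[OF bw]])
    have S: "{t. closest_point (swing K (z t)) d = 0} \<in> sets lebesgue" for d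
    proof -
      have "(\<lambda>t. closest_point (swing K (z t)) d) \<in> borel_measurable lebesgue"
        using zm by (rule measurable_compose[OF _ nearest_swing_measurable])
      then have "(\<lambda>t. closest_point (swing K (z t)) d) -` {0} \<inter> space lebesgue \<in> sets lebesgue"
        by (rule measurable_sets) simp
      moreover have "(\<lambda>t. closest_point (swing K (z t)) d) -` {0} \<inter> space lebesgue = {t. closest_point (swing K (z t)) d = 0}" by auto
      ultimately show ?thesis by simp
    qed
    have eq: "swing K (z t) = {0} \<longleftrightarrow> (\<forall>d\<in>D. closest_point (swing K (z t)) d = 0)" for t
    proof
      assume "swing K (z t) = {0}"
      then show "\<forall>d\<in>D. closest_point (swing K (z t)) d = 0" using nearest_swing_in[of K "z t"] by auto
    next
      assume all: "\<forall>d\<in>D. closest_point (swing K (z t)) d = 0"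
      have "a = 0" if a: "a \<in> swing K (z t)" for a
      proof -
        have "closed {d. norm d \<le> dist a d}" by (intro closed_Collect_le continuous_intros)
        moreover have "D \<subseteq> {d. norm d \<le> dist a d}"
        proof
          fix d assume "d \<in> D"
          then have "dist 0 d \<le> dist a d" using dist_nearest_swing_le[OF a, of d] all by simp
          then show "d \<in> {d. norm d \<le> dist a d}" by simp
        qed
        ultimately have "closure D \<subseteq> {d. norm d \<le> dist a d}" by (rule closure_minimal[rotated])
        then have "norm a \<le> dist a a" using D(2) by blast
        then show "a = 0" by simp
      qed
      then show "swing K (z t) = {0}" by (auto simp: swing_def)
    qed
    have "Z = H \<inter> (\<Inter>d\<in>D. {t. closest_point (swing K (z t)) d = 0})" by (auto simp: Z_def eq)
    moreover have "D \<noteq> {}" using D(2) by auto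
    moreover have "(\<Inter>d\<in>D. {t. closest_point (swing K (z t)) d = 0}) \<in> sets lebesgue"
      using D(1) \<open>D \<noteq> {}\<close> by (rule sets.countable_INT') (use S in blast)
    ultimately show ?thesis using Hm by simp
  qed
  define A where "A = H - Z - U"
  have Am: "A \<in> sets lebesgue"
    unfolding A_def U_def by (intro sets.Diff Hm Zm sets_completionI_sets) (simp add: borel_open open_moves_along)
  have ray: "\<exists>E. extreme_ray (normal_cone K (\<gamma> t)) E \<and> - Jmap (velocity \<gamma> t) \<in> E" if t: "t \<in> Z" for t
  proof -
    have tH: "t \<in> H" and sw: "swing K (\<gamma> t, w t) = {0}" using t Hz by (auto simp: Z_def)
    have "- Jmap (velocity \<gamma> t) = w t" using Hd(2)[OF tH] by simp
    then show ?thesis using extreme_ray_of_trivial_swing[OF K(2) Hd(4,5)[OF tH] sw] by simp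
  qed
  have glide: "\<exists>L. isotropic L \<and> 1 < aff_dim (L \<inter> Jmap ` normal_cone K (\<gamma> t)) \<and>
      velocity \<gamma> t \<in> rel_interior (L \<inter> Jmap ` normal_cone K (\<gamma> t))" if t: "t \<in> A" for t
  proof -
    have tH: "t \<in> H" and nZ: "swing K (\<gamma> t, w t) \<noteq> {0}" using t Hz[of t] by (auto simp: A_def Z_def)
    have "\<exists>a\<in>swing K (\<gamma> t, w t). a \<noteq> 0" using nZ by (auto simp: swing_def)
    then obtain a where a: "a \<in> swing K (\<gamma> t, w t)" "a \<noteq> 0" by blast
    have t01: "t \<in> {0<..<1}" by (rule Hd(3)[OF tH])
    have orth: "v \<bullet> Jmap (w t) = 0" if "v \<in> normal_cone K (\<gamma> t)" for v
      by (rule normal_cone_orthogonal_derivative[OF Hd(1)[OF tH] _ _ that, of "min t (1 - t)"])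
        (use t01 in \<open>auto intro!: \<gamma>K simp: abs_less_iff\<close>)
    have iso: "b \<bullet> Jmap a = 0" if "a \<in> swing K (\<gamma> t, w t)" "b \<in> swing K (\<gamma> t, w t)" for a b
    proof -
      have "t \<notin> N2" "t \<in> G" using tH by (simp_all add: H_def)
      then have "\<forall>a\<in>swing K (\<gamma>1 t, w t). \<forall>b\<in>swing K (\<gamma>1 t, w t). b \<bullet> Jmap a = 0" using N2(2) by blast
      then show ?thesis using that Hz[OF tH] by (simp add: z_def)
    qed
    have "\<exists>L. isotropic L \<and> 1 < aff_dim (L \<inter> Jmap ` normal_cone K (\<gamma> t)) \<and>
        Jmap (w t) \<in> rel_interior (L \<inter> Jmap ` normal_cone K (\<gamma> t))"
      by (rule isotropic_section_of_nontrivial_swing[OF Hd(4,5)[OF tH] _ a])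
        (rule face_directions_isotropic[OF Hd(4,5)[OF tH] iso orth])
    then show ?thesis using Hd(2)[OF tH] by simp
  qed
  have gs: "isotropic_gliding_set K \<gamma> A" if "0 < emeasure lebesgue A"
    unfolding isotropic_gliding_set_def
  proof (intro conjI ballI Am that)
    show "A \<subseteq> {0..<1}" using Hd(3) by (force simp: A_def)
    fix t assume t: "t \<in> A"
    have tH: "t \<in> H" using t by (simp add: A_def)
    show "\<gamma> differentiable (at t)" using Hd(1)[OF tH] by (rule differentiableI_vector)
    show "\<exists>L. isotropic L \<and> 1 < aff_dim (L \<inter> Jmap ` normal_cone K (\<gamma> t)) \<and>
      velocity \<gamma> t \<in> rel_interior (L \<inter> Jmap ` normal_cone K (\<gamma> t))" by (rule glide[OF t])
    show "\<not> (\<exists>E. coisotropic_face K E \<and> moves_along K \<gamma> E t)" using t by (simp add: A_def U_def)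
  qed
  have e1: "AE t in lebesgue. t \<notin> N" and e2: "AE t in lebesgue. t \<notin> N2"
    using N(1) N2(1) unfolding negligible_iff_null_sets by (simp_all add: AE_not_in)
  have e3: "AE t in lebesgue. t \<in> A \<longrightarrow> isotropic_gliding_set K \<gamma> A"
  proof (cases "0 < emeasure lebesgue A")
    case True
    have "isotropic_gliding_set K \<gamma> A" by (rule gs[OF True])
    then show ?thesis by (intro AE_I2 impI)
  next
    case False
    then have "emeasure lebesgue A = 0" by (rule not_gr_zero[THEN iffD1])
    then have "A \<in> null_sets lebesgue" using Am by (rule null_setsI)
    from AE_not_in[OF this] show ?thesis
      by (rule eventually_mono) (intro impI, erule notE)
  qed
  from eventually_conj[OF e1 eventually_conj[OF e2 e3]] show ?thesis
  proof (rule eventually_mono, intro impI)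
    fix t assume elim: "t \<notin> N \<and> t \<notin> N2 \<and> (t \<in> A \<longrightarrow> isotropic_gliding_set K \<gamma> A)" and "t \<in> {0..<1}"
    then have "t \<in> H" by (simp add: H_def G_def)
    then consider "t \<in> Z" | "t \<in> U" | "t \<in> A" unfolding A_def by blast
    then show "(\<exists>E. extreme_ray (normal_cone K (\<gamma> t)) E \<and> - Jmap (velocity \<gamma> t) \<in> E)
      \<or> (\<exists>E. coisotropic_face K E \<and> moves_along K \<gamma> E t)
      \<or> (\<exists>A. isotropic_gliding_set K \<gamma> A \<and> t \<in> A)"
    proof cases
      case 1
      from ray[OF this] show ?thesis by (rule disjI1)
    next
      case 2
      then have "\<exists>E. coisotropic_face K E \<and> moves_along K \<gamma> E t" unfolding U_def by (rule CollectD)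
      then show ?thesis by (intro disjI2 disjI1)
    next
      case 3
      then show ?thesis using elim by (intro disjI2 exI[of _ A] conjI) simp_all
    qed
  qed
qed

end
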